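(* All torsion in the (integral) chromatic homology of a graph is of order two. That is, for every graph $G$ and all $i,j\in\mathbb{Z}$, every torsion element $a\in H^{i,j}(G)=H^{i,j}(G;\mathbb{Z})$ satisfies $2a=0$.
   Context: Graphs are finite, possibly with loops and multiple edges. Chromatic homology over a commutative ring $R$ with identity: let $G$ have edges $e_1,\dots,e_m$ (ordered). For $I=(k_1,\dots,k_m)\in\{0,1\}^m$ let $h(I)=\sum_r k_r$, let $G(I)$ be the spanning subgraph of $G$ with edge set $\{e_r : k_r=1\}$, and let $k(G(I))$ be its number of connected components. Let $\mathcal{A}_2=R[x]/(x^2)$ with $1$ in polynomial grading $0$ and $x$ in polynomial grading $1$. Let $C(G(I))=\mathcal{A}_2^{\otimes k(G(I))}$ (tensor over $R$, one factor per component of $G(I)$), placed in homological grading $h(I)$, with the polynomial grading additive under tensor product. For a hypercube edge $\xi$ from $I$ to $J$ ($J$ is obtained from $I$ by changing the $r$-th entry from $0$ to $1$), let $(-1)^\xi=(-1)^{\sum_{l<r}k_l}$ and define $d_\xi\colon C(G(I))\to C(G(J))$ as follows: if adding $e_r$ merges two components, $d_\xi$ is the multiplication of $\mathcal{A}_2$ on the two corresponding factors and the identity on the others; if adding $e_r$ does not change the number of components, $d_\xi$ is the identity. Let $C(G;R)=\bigoplus_I C(G(I))=\bigoplus_{i,j}C^{i,j}(G;R)$ ($i$ homological, $j$ polynomial grading) and $d=\sum_\xi(-1)^\xi d_\xi$, which has bidegree $(1,0)$. The chromatic homology $H^{i,j}(G;R)$ is the homology of $(C(G;R),d)$ in bigrading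 $(i,j)$; $H^{i,j}(G)$ means $R=\mathbb{Z}$. *)

theory Defs
  imports "HOL-Algebra.Coset" "HOL-Computational_Algebra.Polynomial"
begin

section \<open>The algebra $R[x]/(x^2)$\<close>

quotient_type (overloaded) 'r a2 = "'r::comm_ring_1 poly" / "\<lambda>p q. [:0, 0, 1:] dvd p - q"
proof (rule equivpI)
  show "reflp (\<lambda>p q::'r poly. [:0, 0, 1:] dvd p - q)"
    by (simp add: reflp_def)
  show "symp (\<lambda>p q::'r poly. [:0, 0, 1:] dvd p - q)"
    by (metis dvd_minus_iff minus_diff_eq sympI)
  show "transp (\<lambda>p q::'r poly. [:0, 0, 1:] dvd p - q)"
  proof (rule transpI)
    fix p q r :: "'r poly"
    assume "[:0, 0, 1:] dvd p - q" "[:0, 0, 1:] dvd q - r"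
    then have "[:0, 0, 1:] dvd (p - q) + (q - r)" by (rule dvd_add)
    then show "[:0, 0, 1:] dvd p - r" by simp
  qed
qed

lemma a2_congI:
  fixes p q p' q' :: "'r::comm_ring_1 poly"
  assumes "m dvd p - p'" "m dvd q - q'"
  shows "m dvd (p + q) - (p' + q')" "m dvd (p - q) - (p' - q')" "m dvd p * q - p' * q'"
proof -
  have "(p + q) - (p' + q') = (p - p') + (q - q')" by simp
  then show "m dvd (p + q) - (p' + q')" using assms by (metis dvd_add)
  have "(p - q) - (p' - q') = (p - p') - (q - q')" by simp
  then show "m dvd (p - q) - (p' - q')" using assms by (metis dvd_diff)
  have "p * q - p' * q' = (p - p') * q + p' * (q - q')" by (simp add: algebra_simps)
  then show "m dvd p * q - p' * q'" using assms by (metis dvd_add dvd_mult dvd_mult2)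
qed

instantiation a2 :: (comm_ring_1) comm_ring_1
begin

lift_definition zero_a2 :: "'a a2" is 0 .
lift_definition one_a2 :: "'a a2" is 1 .
lift_definition plus_a2 :: "'a a2 \<Rightarrow> 'a a2 \<Rightarrow> 'a a2" is "(+)" by (rule a2_congI(1))
lift_definition minus_a2 :: "'a a2 \<Rightarrow> 'a a2 \<Rightarrow> 'a a2" is "(-)" by (rule a2_congI(2))
lift_definition times_a2 :: "'a a2 \<Rightarrow> 'a a2 \<Rightarrow> 'a a2" is "(*)" by (rule a2_congI(3))
lift_definition uminus_a2 :: "'a a2 \<Rightarrow> 'a a2" is "uminus"
  using a2_congI(2)[of _ 0 0] by (metis diff_0 diff_self dvd_0_right)

instance
proof
  show "(0::'a a2) \<noteq> 1"
  proof (transfer, rule notI)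
    assume "[:0, 0, 1:] dvd (0 - 1 :: 'a poly)"
    then obtain k :: "'a poly" where "0 - 1 = [:0, 0, 1:] * k" by (rule dvdE)
    then have "coeff (0 - 1) 0 = coeff ([:0, 0, 1:] * k) 0" by simp
    then show False by simp
  qed
qed (transfer; simp add: algebra_simps)+

end

lift_definition a2_x :: "'r::comm_ring_1 a2" is "[:0, 1:]" .

lift_definition a2_scale :: "'r::comm_ring_1 \<Rightarrow> 'r a2 \<Rightarrow> 'r a2" is smult
  by (metis dvd_smult smult_diff_right)

text \<open>The coordinates of an element with respect to the basis $x^0, x^1$.\<close>

lift_definition a2_coeff :: "'r::comm_ring_1 a2 \<Rightarrow> nat \<Rightarrow> 'r" is
  "\<lambda>p n. if n < 2 then coeff p n else 0"
proof (rule ext)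
  fix p q :: "'r poly" and n :: nat
  assume "[:0, 0, 1:] dvd p - q"
  then obtain k where k: "p - q = [:0, 0, 1:] * k" by (rule dvdE)
  have "coeff (p - q) n = 0" if "n < 2"
    using that unfolding k by (cases n) auto
  then show "(if n < 2 then coeff p n else 0) = (if n < 2 then coeff q n else 0)" by simp
qed

lemma a2_x_squared: "a2_x * a2_x = (0 :: 'r::comm_ring_1 a2)"
proof transfer
  have "[:0, 1:] * [:0, 1:] - 0 = [:0, 0, 1 :: 'r:]" by simp
  then show "[:0, 0, 1:] dvd [:0, 1:] * [:0, 1:] - (0 :: 'r poly)" by (metis dvd_refl)
qed

lemma a2_expand: "a = a2_scale (a2_coeff a 0) 1 + a2_scale (a2_coeff a 1) a2_x"
proof (transfer)
  fix p :: "'a poly"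
  obtain c0 c1 r where p: "p = pCons c0 (pCons c1 r)" by (metis pCons_cases)
  have "p - (smult (coeff p 0) 1 + smult (coeff p 1) [:0, 1:]) = [:0, 0, 1:] * r"
    by (simp add: p)
  then have "[:0, 0, 1:] dvd p - (smult (coeff p 0) 1 + smult (coeff p 1) [:0, 1:])"
    by (metis dvd_triv_left)
  then show "[:0, 0, 1:] dvd p - (smult (if (0::nat) < 2 then coeff p 0 else 0) 1 +
      smult (if (1::nat) < 2 then coeff p 1 else 0) [:0, 1:])" by (simp only: zero_less_numeral one_less_numeral_iff semiring_norm if_True)
qed

lemma a2_coeff_simps [simp]:
  "a2_coeff (a + b) n = a2_coeff a n + a2_coeff b n"
  "a2_coeff (a2_scale c a) n = c * a2_coeff a n"
  "a2_coeff 1 n = of_bool (n = 0)"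
  "a2_coeff a2_x n = of_bool (n = 1)"
  by (transfer; auto simp: less_2_cases_iff)+

lemma a2_scale_mult: "a2_scale c a * b = a2_scale c (a * b)"
  by transfer (simp only: mult_smult_left diff_self dvd_0_right)

section \<open>Tensor powers of $R[x]/(x^2)$\<close>

text \<open>
  The tensor power with one factor for each element of a finite set \<open>K\<close> is modelled by
  coordinates: it is free on the tensors \<open>\<Otimes>\<^sub>P x\<^sup>e\<close> with \<open>e = 1\<close> for \<open>P \<in> S\<close> and \<open>e = 0\<close> for
  \<open>P \<in> K - S\<close>, where \<open>S\<close> ranges over the subsets of \<open>K\<close>, and an element is the family of its
  coefficients.  The lemma \<open>a2_tensor_universal\<close> below is the universal property.
\<close>

definition a2_tensor :: "'c set \<Rightarrow> ('c set \<Rightarrow> 'r::comm_ring_1) set" where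
  "a2_tensor K = {t. \<forall>S. t S \<noteq> 0 \<longrightarrow> S \<subseteq> K}"

definition pure_tensor :: "'c set \<Rightarrow> ('c \<Rightarrow> 'r::comm_ring_1 a2) \<Rightarrow> 'c set \<Rightarrow> 'r" where
  "pure_tensor K a = (\<lambda>S. if S \<subseteq> K then \<Prod>P\<in>K. a2_coeff (a P) (of_bool (P \<in> S)) else 0)"

definition basis_labels :: "'c set \<Rightarrow> 'c \<Rightarrow> 'r::comm_ring_1 a2" where
  "basis_labels S P = (if P \<in> S then a2_x else 1)"

subsection \<open>Pure tensors and the universal property\<close>

definition multilinear_on ::
  "('r::comm_ring_1 \<Rightarrow> 'b::ab_group_add \<Rightarrow> 'b) \<Rightarrow> 'c set \<Rightarrow> (('c \<Rightarrow> 'r a2) \<Rightarrow> 'b) \<Rightarrow> bool" where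
  "multilinear_on scale K \<phi> \<longleftrightarrow>
    (\<forall>a b. (\<forall>P\<in>K. a P = b P) \<longrightarrow> \<phi> a = \<phi> b) \<and>
    (\<forall>a P p q. P \<in> K \<longrightarrow> \<phi> (a(P := p + q)) = \<phi> (a(P := p)) + \<phi> (a(P := q))) \<and>
    (\<forall>a P c p. P \<in> K \<longrightarrow> \<phi> (a(P := a2_scale c p)) = scale c (\<phi> (a(P := p))))"

definition linear_on_tensor ::
  "('r::comm_ring_1 \<Rightarrow> 'b::ab_group_add \<Rightarrow> 'b) \<Rightarrow> 'c set \<Rightarrow> (('c set \<Rightarrow> 'r) \<Rightarrow> 'b) \<Rightarrow> bool" where
  "linear_on_tensor scale K L \<longleftrightarrow>
    (\<forall>s\<in>a2_tensor K. \<forall>t\<in>a2_tensor K. L (\<lambda>S. s S + t S) = L s + L t) \<and>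
    (\<forall>t\<in>a2_tensor K. \<forall>c. L (\<lambda>S. c * t S) = scale c (L t))"

lemma pure_tensor_in [simp]: "pure_tensor K a \<in> a2_tensor K"
  by (auto simp: a2_tensor_def pure_tensor_def)

lemma a2_tensor_iff: "t \<in> a2_tensor K \<longleftrightarrow> (\<forall>S. \<not> S \<subseteq> K \<longrightarrow> t S = 0)"
  by (auto simp: a2_tensor_def)

lemma pure_tensor_cong: "(\<And>P. P \<in> K \<Longrightarrow> a P = b P) \<Longrightarrow> pure_tensor K a = pure_tensor K b"
  unfolding pure_tensor_def by (auto intro!: ext prod.cong)

lemma pure_tensor_upd:
  assumes "finite K" "P \<in> K"
  shows "pure_tensor K (a(P := p)) S =
    (if S \<subseteq> K then a2_coeff p (of_bool (P \<in> S)) *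
       (\<Prod>Q\<in>K - {P}. a2_coeff (a Q) (of_bool (Q \<in> S))) else 0)"
proof -
  have "(\<Prod>Q\<in>K - {P}. a2_coeff ((a(P := p)) Q) (of_bool (Q \<in> S))) =
      (\<Prod>Q\<in>K - {P}. a2_coeff (a Q) (of_bool (Q \<in> S)))"
    by (rule prod.cong) auto
  then show ?thesis
    using assms by (simp add: pure_tensor_def prod.remove[of K P] del: fun_upd_apply) simp
qed

lemma pure_tensor_add:
  assumes "finite K" "P \<in> K"
  shows "pure_tensor K (a(P := p + q)) S =
    pure_tensor K (a(P := p)) S + pure_tensor K (a(P := q)) S"
  using assms by (simp add: pure_tensor_upd distrib_right)

lemma pure_tensor_scale:
  assumes "finite K" "P \<in> K"
  shows "pure_tensor K (a(P := a2_scale c p)) S = c * pure_tensor K (a(P := p)) S"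
  using assms by (simp add: pure_tensor_upd mult.assoc)

lemma pure_tensor_basis:
  assumes "finite K" "S \<subseteq> K"
  shows "pure_tensor K (basis_labels S) T = of_bool (T = S)"
proof (cases "T \<subseteq> K")
  case True
  have eq: "a2_coeff (basis_labels S P) (of_bool (P \<in> T)) = of_bool (P \<in> T \<longleftrightarrow> P \<in> S)" for P T
    by (simp add: basis_labels_def)
  show ?thesis
  proof (cases "T = S")
    case False
    then obtain P where "P \<in> K" "\<not> (P \<in> T \<longleftrightarrow> P \<in> S)" using True assms by blast
    then have "(\<Prod>P\<in>K. of_bool (P \<in> T \<longleftrightarrow> P \<in> S)) = (0::'b)"
      using assms(1) by (intro prod_zero) auto
    then show ?thesis using False by (simp add: pure_tensor_def eq)
  qed (simp add: pure_tensor_def eq assms)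
qed (use assms in \<open>auto simp: pure_tensor_def\<close>)

lemma tensor_expand:
  assumes "finite K" "t \<in> a2_tensor K"
  shows "t = (\<lambda>T. \<Sum>S\<in>Pow K. t S * pure_tensor K (basis_labels S) T)"
proof
  fix T
  have "(\<Sum>S\<in>Pow K. t S * pure_tensor K (basis_labels S) T) = (\<Sum>S\<in>Pow K. if S = T then t T else 0)"
    by (rule sum.cong) (auto simp: pure_tensor_basis assms)
  also have "\<dots> = t T"
    using assms by (auto simp: a2_tensor_def)
  finally show "t T = (\<Sum>S\<in>Pow K. t S * pure_tensor K (basis_labels S) T)" by simp
qed

lemma multilinear_expand:
  assumes "module scale" "multilinear_on scale K \<phi>" "finite K"
  shows "\<phi> a = (\<Sum>S\<in>Pow K. scale (pure_tensor K a S) (\<phi> (basis_labels S)))"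
proof -
  interpret module scale by fact
  have cong: "\<phi> a = \<phi> b" if "\<And>P. P \<in> K \<Longrightarrow> a P = b P" for a b
    using assms(2) that unfolding multilinear_on_def by blast
  have split: "\<phi> a = scale (a2_coeff (a P) 0) (\<phi> (a(P := 1))) +
      scale (a2_coeff (a P) 1) (\<phi> (a(P := a2_x)))" if "P \<in> K" for a P
  proof -
    have "\<phi> a = \<phi> (a(P := a2_scale (a2_coeff (a P) 0) 1 + a2_scale (a2_coeff (a P) 1) a2_x))"
      by (metis a2_expand fun_upd_triv)
    with that assms(2) show ?thesis unfolding multilinear_on_def by simp
  qed
  have "\<phi> a = (\<Sum>S\<in>Pow F. scale (\<Prod>P\<in>F. a2_coeff (a P) (of_bool (P \<in> S)))
      (\<phi> (\<lambda>P. if P \<in> F then basis_labels S P else a P)))" if "F \<subseteq> K" for F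
    using finite_subset[OF that assms(3)] that
  proof (induction F arbitrary: a rule: finite_induct)
    case empty
    show ?case by simp
  next
    case (insert P F)
    let ?c = "\<lambda>a F S. \<Prod>P\<in>F. a2_coeff (a P) (of_bool (P \<in> S))"
    let ?b = "\<lambda>a F S P. if P \<in> F then basis_labels S P else a P"
    have part: "\<phi> (a(P := basis_labels U P)) =
        (\<Sum>S\<in>Pow F. scale (?c a F S) (\<phi> (?b a (insert P F) (S \<union> (U \<inter> {P})))))" for U
    proof -
      have "\<phi> (a(P := basis_labels U P)) = (\<Sum>S\<in>Pow F. scale (?c (a(P := basis_labels U P)) F S)
          (\<phi> (?b (a(P := basis_labels U P)) F S)))"
        using insert by blast
      also have "\<dots> = (\<Sum>S\<in>Pow F. scale (?c a F S) (\<phi> (?b a (insert P F) (S \<union> (U \<inter> {P})))))"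
      proof (rule sum.cong[OF refl], rule arg_cong2[of _ _ _ _ scale])
        fix S assume "S \<in> Pow F"
        with insert(2) have *: "?b (a(P := basis_labels U P)) F S =
            ?b a (insert P F) (S \<union> (U \<inter> {P}))"
          by (auto simp: fun_eq_iff basis_labels_def)
        show "\<phi> (?b (a(P := basis_labels U P)) F S) = \<phi> (?b a (insert P F) (S \<union> (U \<inter> {P})))"
          by (rule arg_cong[OF *])
        show "?c (a(P := basis_labels U P)) F S = ?c a F S"
          by (rule prod.cong) (use insert(2) in auto)
      qed
      finally show ?thesis .
    qed
    have part0: "\<phi> (a(P := 1)) = (\<Sum>S\<in>Pow F. scale (?c a F S) (\<phi> (?b a (insert P F) S)))"
      using part[of "{}"] by (simp only: basis_labels_def[of "{}"] empty_iff if_False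
          Int_empty_left Un_empty_right)
    have part1: "\<phi> (a(P := a2_x)) =
        (\<Sum>S\<in>Pow F. scale (?c a F S) (\<phi> (?b a (insert P F) (insert P S))))"
      using part[of "{P}"] by (simp only: basis_labels_def[of "{P}"] singleton_iff if_True
          Int_absorb Un_insert_right Un_empty_right simp_thms)
    have nin: "P \<notin> S" if "S \<in> Pow F" for S using that insert(2) by auto
    have c0: "?c a (insert P F) S = a2_coeff (a P) 0 * ?c a F S" if "S \<in> Pow F" for S
      using insert(1,2) nin[OF that] by simp
    have c1: "?c a (insert P F) (insert P S) = a2_coeff (a P) 1 * ?c a F S"
      if "S \<in> Pow F" for S
    proof -
      have "?c a F (insert P S) = ?c a F S" by (rule prod.cong) (use insert(2) in auto)
      then show ?thesis using insert(1,2) by simp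
    qed
    have "Pow F \<inter> insert P ` Pow F = {}" using insert(2) by auto
    moreover have "inj_on (insert P) (Pow F)" by (rule inj_onI) (simp add: insert_ident nin)
    ultimately have "(\<Sum>S\<in>Pow (insert P F). scale (?c a (insert P F) S) (\<phi> (?b a (insert P F) S))) =
        (\<Sum>S\<in>Pow F. scale (?c a (insert P F) S) (\<phi> (?b a (insert P F) S))) +
        (\<Sum>S\<in>Pow F. scale (?c a (insert P F) (insert P S)) (\<phi> (?b a (insert P F) (insert P S))))"
      using insert(1) by (simp add: Pow_insert sum.union_disjoint sum.reindex)
    also have "(\<Sum>S\<in>Pow F. scale (?c a (insert P F) S) (\<phi> (?b a (insert P F) S))) =
        scale (a2_coeff (a P) 0) (\<phi> (a(P := 1)))"
      by (simp only: part0 c0 scale_sum_right scale_scale cong: sum.cong)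
    also have "(\<Sum>S\<in>Pow F. scale (?c a (insert P F) (insert P S))
        (\<phi> (?b a (insert P F) (insert P S)))) = scale (a2_coeff (a P) 1) (\<phi> (a(P := a2_x)))"
      by (simp only: part1 c1 scale_sum_right scale_scale cong: sum.cong)
    finally show ?case
      using insert.prems by (intro trans[OF split[of P a]]) (simp, rule sym)
  qed
  from this[of K] have "\<phi> a = (\<Sum>S\<in>Pow K. scale (\<Prod>P\<in>K. a2_coeff (a P) (of_bool (P \<in> S)))
      (\<phi> (\<lambda>P. if P \<in> K then basis_labels S P else a P)))" by simp
  also have "\<dots> = (\<Sum>S\<in>Pow K. scale (pure_tensor K a S) (\<phi> (basis_labels S)))"
    by (intro sum.cong refl arg_cong2[of _ _ _ _ scale] cong) (auto simp: pure_tensor_def)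
  finally show ?thesis .
qed

theorem a2_tensor_universal:
  fixes scale :: "'r::comm_ring_1 \<Rightarrow> 'b::ab_group_add \<Rightarrow> 'b"
  assumes "module scale" "multilinear_on scale K \<phi>" "finite K"
  shows "\<exists>L. linear_on_tensor scale K L \<and> (\<forall>a. L (pure_tensor K a) = \<phi> a) \<and>
    (\<forall>L'. linear_on_tensor scale K L' \<and> (\<forall>a. L' (pure_tensor K a) = \<phi> a) \<longrightarrow>
      (\<forall>t\<in>a2_tensor K. L' t = L t))"
proof -
  interpret module scale by fact
  define L where "L t = (\<Sum>S\<in>Pow K. scale (t S) (\<phi> (basis_labels S)))" for t
  have "linear_on_tensor scale K L"
    unfolding linear_on_tensor_def L_def
    by (simp add: scale_left_distrib sum.distrib scale_sum_right)
  moreover have "L (pure_tensor K a) = \<phi> a" for a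
    unfolding L_def by (rule multilinear_expand[OF assms, symmetric])
  moreover have "L' t = L t"
    if L': "linear_on_tensor scale K L'" "\<forall>a. L' (pure_tensor K a) = \<phi> a" and t: "t \<in> a2_tensor K"
    for L' t
  proof -
    have add: "L' (\<lambda>S. s S + t S) = L' s + L' t" if "s \<in> a2_tensor K" "t \<in> a2_tensor K" for s t
      using L'(1) that unfolding linear_on_tensor_def by blast
    have scl: "L' (\<lambda>S. c * s S) = scale c (L' s)" if "s \<in> a2_tensor K" for c s
      using L'(1) that unfolding linear_on_tensor_def by blast
    have zero: "L' (\<lambda>S. 0) = 0"
      using scl[of "\<lambda>S. 0" 0] by (simp add: a2_tensor_def)
    have "L' (\<lambda>T. \<Sum>S\<in>A. t S * pure_tensor K (basis_labels S) T) =
        (\<Sum>S\<in>A. scale (t S) (\<phi> (basis_labels S)))" if "finite A" for A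
      using that
    proof (induction A rule: finite_induct)
      case empty
      show ?case by (simp add: zero)
    next
      case (insert S A)
      have closed: "(\<lambda>T. t S * pure_tensor K (basis_labels S) T) \<in> a2_tensor K"
        "(\<lambda>T. \<Sum>S\<in>A. t S * pure_tensor K (basis_labels S) T) \<in> a2_tensor K"
        unfolding a2_tensor_iff by (simp_all add: pure_tensor_def)
      show ?case
        using insert add[OF closed] scl[OF pure_tensor_in] L'(2) by simp
    qed
    from this[of "Pow K"] show "L' t = L t"
      using tensor_expand[OF assms(3) t] assms(3) by (simp add: L_def)
  qed
  ultimately show ?thesis by blast
qed

section \<open>Graphs and their spanning subgraphs\<close>

text \<open>
  The edges are listed in their chosen order, each as the set of its endpoints: a singleton is a
  loop, and a repeated entry is a multiple edge.  Edges are numbered from \<open>0\<close>.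
\<close>

record 'v multigraph =
  verts :: "'v set"
  edges :: "'v set list"

definition finite_multigraph :: "'v multigraph \<Rightarrow> bool" where
  "finite_multigraph G \<longleftrightarrow> finite (verts G) \<and>
    (\<forall>e\<in>set (edges G). \<exists>u\<in>verts G. \<exists>v\<in>verts G. e = {u, v})"

text \<open>A vertex \<open>I\<close> of the hypercube is given as the set of the indices \<open>r\<close> with \<open>k\<^sub>r = 1\<close>.\<close>

definition cube :: "'v multigraph \<Rightarrow> nat set set" where
  "cube G = Pow {..<length (edges G)}"

definition adjacent :: "'v multigraph \<Rightarrow> nat set \<Rightarrow> ('v \<times> 'v) set" where
  "adjacent G I = {(u, v). \<exists>r\<in>I. edges G ! r = {u, v}}"

definition connected_rel :: "'v multigraph \<Rightarrow> nat set \<Rightarrow> ('v \<times> 'v) set" where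
  "connected_rel G I = {(u, v). u \<in> verts G \<and> v \<in> verts G \<and> (u, v) \<in> (adjacent G I)\<^sup>*}"

definition components :: "'v multigraph \<Rightarrow> nat set \<Rightarrow> 'v set set" where
  "components G I = verts G // connected_rel G I"

section \<open>The chromatic complex\<close>

text \<open>
  For the components of \<open>G(I)\<close> and of \<open>G(J)\<close>, where \<open>J\<close> arises from \<open>I\<close> by adding one edge, both
  cases in the definition of the per-edge map are instances of one formula: the factor at a
  component \<open>W\<close> of \<open>G(J)\<close> is the product of the factors at the components of \<open>G(I)\<close> contained
  in \<open>W\<close>.  See \<open>edge_map_merge\<close> and \<open>edge_map_id\<close> below.
\<close>

definition merge_labels :: "'v set set \<Rightarrow> ('v set \<Rightarrow> 'r::comm_ring_1 a2) \<Rightarrow> 'v set \<Rightarrow> 'r a2" where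
  "merge_labels K a W = (\<Prod>P\<in>{P\<in>K. P \<subseteq> W}. a P)"

text \<open>The linear map that sends \<open>\<Otimes>\<^sub>P a\<^sub>P\<close> to \<open>\<Otimes>\<^sub>W merge_labels K a W\<close>.\<close>

definition tensor_merge ::
  "'v set set \<Rightarrow> 'v set set \<Rightarrow> ('v set set \<Rightarrow> 'r::comm_ring_1) \<Rightarrow> 'v set set \<Rightarrow> 'r" where
  "tensor_merge K K' t =
    (\<lambda>T. \<Sum>S\<in>Pow K. t S * pure_tensor K' (merge_labels K (basis_labels S)) T)"

definition edge_map ::
  "'v multigraph \<Rightarrow> nat set \<Rightarrow> nat set \<Rightarrow> ('v set set \<Rightarrow> 'r::comm_ring_1) \<Rightarrow> 'v set set \<Rightarrow> 'r" where
  "edge_map G I J = tensor_merge (components G I) (components G J)"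

text \<open>A chain is a family \<open>c\<close> with \<open>c I\<close> in the tensor power at \<open>I\<close>.\<close>

type_synonym ('v, 'r) chain = "nat set \<Rightarrow> 'v set set \<Rightarrow> 'r"

definition chains :: "'v multigraph \<Rightarrow> int \<Rightarrow> int \<Rightarrow> ('v, 'r::comm_ring_1) chain set" where
  "chains G i j = {c. \<forall>I S. c I S \<noteq> 0 \<longrightarrow>
    I \<in> cube G \<and> int (card I) = i \<and> S \<subseteq> components G I \<and> int (card S) = j}"

definition differential ::
  "'v multigraph \<Rightarrow> ('v, 'r::comm_ring_1) chain \<Rightarrow> ('v, 'r) chain" where
  "differential G c = (\<lambda>J T. if J \<in> cube G
     then \<Sum>r\<in>J. (- 1) ^ card {l \<in> J - {r}. l < r} * edge_map G (J - {r}) J (c (J - {r})) T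
     else 0)"

definition cycles :: "'v multigraph \<Rightarrow> int \<Rightarrow> int \<Rightarrow> ('v, 'r::comm_ring_1) chain set" where
  "cycles G i j = {c \<in> chains G i j. differential G c = (\<lambda>_ _. 0)}"

definition boundaries :: "'v multigraph \<Rightarrow> int \<Rightarrow> int \<Rightarrow> ('v, 'r::comm_ring_1) chain set" where
  "boundaries G i j = differential G ` chains G (i - 1) j"

definition cycle_group :: "'v multigraph \<Rightarrow> int \<Rightarrow> int \<Rightarrow> ('v, 'r::comm_ring_1) chain monoid" where
  "cycle_group G i j =
    \<lparr>carrier = cycles G i j, monoid.mult = (\<lambda>c d I S. c I S + d I S), monoid.one = (\<lambda>_ _. 0)\<rparr>"

text \<open>The additive group of homology, in the multiplicative notation of the group library.\<close>

definition chromatic_homology ::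
  "'v multigraph \<Rightarrow> int \<Rightarrow> int \<Rightarrow> ('v, 'r::comm_ring_1) chain set monoid" where
  "chromatic_homology G i j = cycle_group G i j Mod boundaries G i j"

definition torsion_element :: "('a, 'b) monoid_scheme \<Rightarrow> 'a \<Rightarrow> bool" where
  "torsion_element H a \<longleftrightarrow> a \<in> carrier H \<and> (\<exists>n::nat. n > 0 \<and> a [^]\<^bsub>H\<^esub> n = \<one>\<^bsub>H\<^esub>)"

section \<open>The complex is well defined\<close>

lemma equiv_connected_rel: "equiv (verts G) (connected_rel G I)"
proof (rule equivI)
  have "sym (adjacent G I)"
    by (auto simp: sym_def adjacent_def insert_commute)
  then have "sym ((adjacent G I)\<^sup>*)" by (rule sym_rtrancl)
  then show "sym (connected_rel G I)" unfolding connected_rel_def sym_def by blast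
  show "trans (connected_rel G I)"
    unfolding connected_rel_def trans_def by (auto dest: rtrancl_trans)
qed (auto simp: connected_rel_def refl_on_def)

lemma finite_components:
  assumes "finite_multigraph G"
  shows "finite (components G I)"
  unfolding components_def
  by (rule finite_quotient) (use assms in \<open>auto simp: finite_multigraph_def connected_rel_def\<close>)

lemma components_disjoint:
  "P \<in> components G I \<Longrightarrow> Q \<in> components G I \<Longrightarrow> P = Q \<or> P \<inter> Q = {}"
  unfolding components_def by (rule quotient_disj[OF equiv_connected_rel])

lemma components_nonempty: "P \<in> components G I \<Longrightarrow> P \<noteq> {}"
  unfolding components_def by (rule in_quotient_imp_non_empty[OF equiv_connected_rel])

lemma components_subset:
  assumes "P \<in> components G I" "W \<in> components G I" "P \<subseteq> W"
  shows "P = W"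
  using components_disjoint[OF assms(1,2)] components_nonempty[OF assms(1)] assms(3)
  by (simp add: Int_absorb2)

lemma connected_rel_mono: "I \<subseteq> J \<Longrightarrow> connected_rel G I \<subseteq> connected_rel G J"
proof -
  assume "I \<subseteq> J"
  then have "adjacent G I \<subseteq> adjacent G J" unfolding adjacent_def by blast
  then have "(adjacent G I)\<^sup>* \<subseteq> (adjacent G J)\<^sup>*" by (rule rtrancl_mono)
  then show ?thesis unfolding connected_rel_def by blast
qed

definition refines :: "'v set set \<Rightarrow> 'v set set \<Rightarrow> bool" where
  "refines K K' \<longleftrightarrow> finite K \<and> finite K' \<and> (\<forall>P\<in>K. \<exists>!W. W \<in> K' \<and> P \<subseteq> W)"

lemma components_refines:
  assumes "finite_multigraph G" "I \<subseteq> J"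
  shows "refines (components G I) (components G J)"
  unfolding refines_def
proof (intro conjI ballI finite_components assms)
  fix P assume P: "P \<in> components G I"
  then obtain v where v: "v \<in> verts G" "P = connected_rel G I `` {v}"
    unfolding components_def by (rule quotientE)
  show "\<exists>!W. W \<in> components G J \<and> P \<subseteq> W"
  proof (rule ex1I)
    show "connected_rel G J `` {v} \<in> components G J \<and> P \<subseteq> connected_rel G J `` {v}"
      using v connected_rel_mono[OF assms(2), of G] by (auto simp: components_def intro: quotientI)
  next
    fix W assume W: "W \<in> components G J \<and> P \<subseteq> W"
    have "connected_rel G J `` {v} \<in> components G J" "P \<subseteq> connected_rel G J `` {v}"
      using v connected_rel_mono[OF assms(2), of G] by (auto simp: components_def intro: quotientI)
    with W components_disjoint[of W G J "connected_rel G J `` {v}"] components_nonempty[OF P]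
    show "W = connected_rel G J `` {v}" by blast
  qed
qed

subsection \<open>The per-edge maps\<close>

lemma tensor_merge_pure:
  fixes a :: "'v set \<Rightarrow> 'r::comm_ring_1 a2"
  assumes "refines K K'"
  shows "tensor_merge K K' (pure_tensor K a) = pure_tensor K' (merge_labels K a)"
proof
  fix T
  have fin: "finite K" "finite K'" using assms by (auto simp: refines_def)
  have mod: "module ((*) :: 'r \<Rightarrow> 'r \<Rightarrow> 'r)"
    by unfold_locales (auto simp: algebra_simps)
  define \<phi> where "\<phi> a = pure_tensor K' (merge_labels K a) T" for a :: "'v set \<Rightarrow> 'r a2"
  have upd: "\<exists>W b q. W \<in> K' \<and>
      (\<forall>p. \<forall>U\<in>K'. merge_labels K (a(P := p)) U = (b(W := p * q)) U)" if P: "P \<in> K"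
    for a :: "'v set \<Rightarrow> 'r a2" and P
  proof -
    obtain W where W: "W \<in> K'" "P \<subseteq> W" and uniq: "\<And>U. U \<in> K' \<Longrightarrow> P \<subseteq> U \<Longrightarrow> U = W"
      using assms P unfolding refines_def by metis
    define q where "q = (\<Prod>Q\<in>{Q\<in>K. Q \<subseteq> W} - {P}. a Q)"
    have "merge_labels K (a(P := p)) U = ((merge_labels K a)(W := p * q)) U" if U: "U \<in> K'" for U p
    proof (cases "U = W")
      case True
      have "merge_labels K (a(P := p)) W = p * (\<Prod>Q\<in>{Q\<in>K. Q \<subseteq> W} - {P}. (a(P := p)) Q)"
        unfolding merge_labels_def using P W(2) fin(1) by (subst prod.remove[of _ P]) auto
      also have "(\<Prod>Q\<in>{Q\<in>K. Q \<subseteq> W} - {P}. (a(P := p)) Q) = q"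
        unfolding q_def by (rule prod.cong) auto
      finally show ?thesis unfolding True fun_upd_same .
    next
      case False
      then have "\<not> P \<subseteq> U" using uniq U by blast
      then have "merge_labels K (a(P := p)) U = merge_labels K a U"
        unfolding merge_labels_def by (intro prod.cong) auto
      with False show ?thesis by simp
    qed
    then show ?thesis using W(1)
      by (intro exI[of _ W] exI[of _ "merge_labels K a"] exI[of _ q] conjI allI ballI)
  qed
  have "multilinear_on (*) K \<phi>"
    unfolding multilinear_on_def
  proof (intro conjI allI impI)
    fix a b :: "'v set \<Rightarrow> 'r a2" assume "\<forall>P\<in>K. a P = b P"
    then have "merge_labels K a = merge_labels K b"
      by (auto simp: merge_labels_def fun_eq_iff intro!: prod.cong)
    then show "\<phi> a = \<phi> b" by (simp add: \<phi>_def)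
  next
    fix a :: "'v set \<Rightarrow> 'r a2" and P assume "P \<in> K"
    from upd[OF this] obtain W b q where W: "W \<in> K'"
      and b: "\<And>p U. U \<in> K' \<Longrightarrow> merge_labels K (a(P := p)) U = (b(W := p * q)) U" by metis
    have eq: "\<phi> (a(P := p)) = pure_tensor K' (b(W := p * q)) T" for p
      unfolding \<phi>_def by (rule fun_cong[OF pure_tensor_cong]) (rule b)
    show "\<phi> (a(P := p + p')) = \<phi> (a(P := p)) + \<phi> (a(P := p'))" for p p'
      by (simp only: eq distrib_right pure_tensor_add[OF fin(2) W])
    show "\<phi> (a(P := a2_scale c p)) = c * \<phi> (a(P := p))" for c p
      by (simp only: eq a2_scale_mult pure_tensor_scale[OF fin(2) W])
  qed
  from multilinear_expand[OF mod this fin(1), of a]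
  show "tensor_merge K K' (pure_tensor K a) T = pure_tensor K' (merge_labels K a) T"
    by (simp add: tensor_merge_def \<phi>_def)
qed

lemma tensor_merge_sum:
  "tensor_merge K K' (\<lambda>S. \<Sum>r\<in>A. k r * t r S) T = (\<Sum>r\<in>A. k r * tensor_merge K K' (t r) T)"
  unfolding tensor_merge_def sum_distrib_right sum_distrib_left
  by (subst sum.swap) (simp add: mult.assoc)

lemma tensor_merge_add:
  "tensor_merge K K' (\<lambda>S. s S + t S) T = tensor_merge K K' s T + tensor_merge K K' t T"
  by (simp add: tensor_merge_def distrib_right sum.distrib)

lemma merge_labels_comp:
  assumes "refines K K'" "W \<in> K''" "refines K' K''" "refines K K''"
  shows "merge_labels K' (merge_labels K a) W = merge_labels K a W"
proof -
  have fin: "finite K" "finite K'" using assms by (auto simp: refines_def)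
  define A where "A = {P\<in>K. P \<subseteq> W}"
  define B where "B = {Q\<in>K'. Q \<subseteq> W}"
  define f where "f P = (THE Q. Q \<in> K' \<and> P \<subseteq> Q)" for P
  have f: "f P \<in> K'" "P \<subseteq> f P" "\<And>Q. Q \<in> K' \<Longrightarrow> P \<subseteq> Q \<Longrightarrow> Q = f P" if "P \<in> K" for P
  proof -
    have "\<exists>!Q. Q \<in> K' \<and> P \<subseteq> Q" using assms(1) that by (auto simp: refines_def)
    from theI'[OF this] show "f P \<in> K'" "P \<subseteq> f P" by (auto simp: f_def)
    with \<open>\<exists>!Q. Q \<in> K' \<and> P \<subseteq> Q\<close> show "\<And>Q. Q \<in> K' \<Longrightarrow> P \<subseteq> Q \<Longrightarrow> Q = f P" by blast
  qed
  have fB: "f P \<in> B" if P: "P \<in> A" for P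
  proof -
    have "P \<in> K" "P \<subseteq> W" using P by (auto simp: A_def)
    obtain U where "U \<in> K''" "f P \<subseteq> U" using f(1)[OF \<open>P \<in> K\<close>] assms(3) unfolding refines_def by blast
    moreover from this have "P \<subseteq> U" using f(2)[OF \<open>P \<in> K\<close>] by blast
    then have "U = W"
      using \<open>P \<in> K\<close> \<open>P \<subseteq> W\<close> \<open>U \<in> K''\<close> assms(2,4) unfolding refines_def by metis
    ultimately show ?thesis using f(1)[OF \<open>P \<in> K\<close>] by (simp add: B_def)
  qed
  have "(\<Prod>Q\<in>B. \<Prod>P\<in>{P\<in>A. f P = Q}. a P) = (\<Prod>P\<in>A. a P)"
    by (rule prod.group) (use fin fB in \<open>auto simp: A_def B_def\<close>)
  moreover have "{P\<in>A. f P = Q} = {P\<in>K. P \<subseteq> Q}" if "Q \<in> B" for Q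
    using that f by (auto simp: A_def B_def)
  ultimately show ?thesis by (simp add: merge_labels_def flip: A_def B_def)
qed

lemma tensor_merge_comp:
  fixes t :: "'v set set \<Rightarrow> 'r::comm_ring_1"
  assumes "refines K K'" "refines K' K''" "refines K K''"
  shows "tensor_merge K' K'' (tensor_merge K K' t) = tensor_merge K K'' t"
proof
  fix T
  let ?b = "basis_labels :: 'v set set \<Rightarrow> 'v set \<Rightarrow> 'r a2"
  have "tensor_merge K' K'' (tensor_merge K K' t) T =
      (\<Sum>S\<in>Pow K. t S * tensor_merge K' K'' (pure_tensor K' (merge_labels K (?b S))) T)"
    unfolding tensor_merge_def[of K K'] by (rule tensor_merge_sum)
  also have "\<dots> = (\<Sum>S\<in>Pow K. t S * pure_tensor K'' (merge_labels K (?b S)) T)"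
  proof (rule sum.cong[OF refl], rule arg_cong[of _ _ "(*) _"])
    fix S
    have "tensor_merge K' K'' (pure_tensor K' (merge_labels K (?b S))) =
        pure_tensor K'' (merge_labels K' (merge_labels K (?b S)))"
      by (rule tensor_merge_pure[OF assms(2)])
    also have "\<dots> = pure_tensor K'' (merge_labels K (?b S))"
      by (rule pure_tensor_cong) (rule merge_labels_comp[OF assms(1) _ assms(2,3)])
    finally show "tensor_merge K' K'' (pure_tensor K' (merge_labels K (?b S))) T =
        pure_tensor K'' (merge_labels K (?b S)) T" by simp
  qed
  finally show "tensor_merge K' K'' (tensor_merge K K' t) T = tensor_merge K K'' t T"
    by (simp add: tensor_merge_def)
qed

text \<open>The two cases in the definition of the per-edge map.\<close>

lemma edge_map_id:
  assumes "finite_multigraph G" "components G J = components G I"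
    and "t \<in> a2_tensor (components G I)"
  shows "edge_map G I J t = t"
proof -
  let ?K = "components G I"
  have "{P \<in> ?K. P \<subseteq> W} = {W}" if "W \<in> ?K" for W
    using that components_subset by blast
  then have "merge_labels ?K b W = b W" if "W \<in> ?K" for W and b :: "'a set \<Rightarrow> 'b a2"
    using that by (simp add: merge_labels_def)
  then have "pure_tensor ?K (merge_labels ?K b) = pure_tensor ?K b" for b :: "'a set \<Rightarrow> 'b a2"
    by (rule pure_tensor_cong)
  with tensor_expand[OF finite_components[OF assms(1)] assms(3)] show ?thesis
    by (simp add: edge_map_def tensor_merge_def assms(2))
qed

lemma components_insert:
  assumes "finite_multigraph G" "insert r I \<in> cube G" "edges G ! r = {u, v}"
    and "P \<in> components G I" "Q \<in> components G I" "u \<in> P" "v \<in> Q"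
  shows "components G (insert r I) = components G I - {P, Q} \<union> {P \<union> Q}"
proof -
  let ?V = "verts G" and ?R = "connected_rel G I" and ?R' = "connected_rel G (insert r I)"
  have equiv: "equiv ?V ?R" by (rule equiv_connected_rel)
  have inV: "x \<in> ?V \<and> y \<in> ?V" if xy: "(x, y) \<in> adjacent G (insert r I)" for x y
  proof -
    obtain s where s: "s \<in> insert r I" "edges G ! s = {x, y}" using xy by (auto simp: adjacent_def)
    then have "s < length (edges G)" using assms(2) by (auto simp: cube_def)
    then have "{x, y} \<in> set (edges G)" using s(2) nth_mem by metis
    then obtain x' y' where "x' \<in> ?V" "y' \<in> ?V" "{x, y} = {x', y'}"
      using assms(1) unfolding finite_multigraph_def by blast
    then show ?thesis by (auto simp: doubleton_eq_iff)
  qed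
  have refl: "(x, x) \<in> ?R" if "x \<in> ?V" for x using that by (simp add: connected_rel_def)
  have sym: "(y, x) \<in> ?R" if "(x, y) \<in> ?R" for x y
    using that equiv by (auto simp: equiv_def sym_def)
  have trans: "(x, z) \<in> ?R" if "(x, y) \<in> ?R" "(y, z) \<in> ?R" for x y z
    using that equiv by (auto simp: equiv_def dest: transD)
  have trans': "(x, z) \<in> ?R'" if "(x, y) \<in> ?R'" "(y, z) \<in> ?R'" for x y z
    using that equiv_connected_rel[of G "insert r I"] by (auto simp: equiv_def dest: transD)
  have comp: "W = ?R `` {w}" "w \<in> ?V" if "W \<in> components G I" "w \<in> W" for W w
  proof -
    obtain x where x: "x \<in> ?V" "W = ?R `` {x}" using \<open>W \<in> components G I\<close>
      unfolding components_def by (rule quotientE)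
    with \<open>w \<in> W\<close> have xw: "(x, w) \<in> ?R" by simp
    show "W = ?R `` {w}" using x(2) equiv_class_eq[OF equiv xw] by simp
    show "w \<in> ?V" using xw by (simp add: connected_rel_def)
  qed
  have P: "P = ?R `` {u}" "u \<in> ?V" and Q: "Q = ?R `` {v}" "v \<in> ?V"
    using comp[OF assms(4,6)] comp[OF assms(5,7)] by auto
  define R2 where "R2 = ?R \<union> (P \<union> Q) \<times> (P \<union> Q)"
  have closed: "z \<in> P \<union> Q" if "(x, z) \<in> ?R" "x \<in> P \<union> Q" for x z
    using that trans unfolding P(1) Q(1) by blast
  have trans2: "(x, z) \<in> R2" if "(x, y) \<in> R2" "(y, z) \<in> R2" for x y z
    using that trans closed sym unfolding R2_def by blast
  have step: "(x, y) \<in> R2" if xy: "(x, y) \<in> adjacent G (insert r I)" for x y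
  proof (cases "(x, y) \<in> adjacent G I")
    case True
    then show ?thesis using inV[OF xy] by (auto simp: R2_def connected_rel_def)
  next
    case False
    with xy have "{x, y} = {u, v}" using assms(3) by (auto simp: adjacent_def)
    then show ?thesis using assms(6,7) by (auto simp: R2_def doubleton_eq_iff)
  qed
  have "?R' = R2"
  proof (rule equalityI; rule subrelI)
    fix x y assume "(x, y) \<in> ?R'"
    then have "(x, y) \<in> (adjacent G (insert r I))\<^sup>*" "x \<in> ?V" by (auto simp: connected_rel_def)
    then show "(x, y) \<in> R2"
    proof (induction rule: rtrancl_induct)
      case base
      then show ?case using refl by (simp add: R2_def)
    next
      case (step y z)
      then show ?case using trans2 \<open>\<And>x y. (x, y) \<in> adjacent G (insert r I) \<Longrightarrow> (x, y) \<in> R2\<close> by blast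
    qed
  next
    fix x y assume xy: "(x, y) \<in> R2"
    have R: "(x, y) \<in> ?R'" if "(x, y) \<in> ?R" for x y
      using connected_rel_mono[of I "insert r I" G] that by blast
    have "(u, v) \<in> adjacent G (insert r I)" "(v, u) \<in> adjacent G (insert r I)"
      using assms(3) by (auto simp: adjacent_def)
    then have uv: "(u, v) \<in> ?R'" "(v, u) \<in> ?R'" using P(2) Q(2) by (auto simp: connected_rel_def)
    have to_u: "(x, u) \<in> ?R' \<and> (u, x) \<in> ?R'" if "x \<in> P \<union> Q" for x
      using that uv R sym trans' unfolding P(1) Q(1) by blast
    from xy consider "(x, y) \<in> ?R" | "x \<in> P \<union> Q" "y \<in> P \<union> Q" by (auto simp: R2_def)
    then show "(x, y) \<in> ?R'"
    proof cases
      case 1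
      then show ?thesis by (rule R)
    next
      case 2
      then show ?thesis using to_u trans' by blast
    qed
  qed
  moreover have "R2 `` {x} = P \<union> Q" if "x \<in> P \<union> Q" for x
    using that closed unfolding R2_def by blast
  moreover have "R2 `` {x} = ?R `` {x}" if "x \<notin> P \<union> Q" for x
    using that unfolding R2_def by blast
  ultimately have cls: "?R' `` {x} = (if x \<in> P \<union> Q then P \<union> Q else ?R `` {x})" for x
    by simp
  show ?thesis
  proof (intro equalityI subsetI)
    fix W assume "W \<in> components G (insert r I)"
    then obtain x where x: "x \<in> ?V" "W = ?R' `` {x}"
      unfolding components_def by (rule quotientE)
    show "W \<in> components G I - {P, Q} \<union> {P \<union> Q}"
    proof (cases "x \<in> P \<union> Q")
      case False
      then have "W = ?R `` {x}" using x(2) cls by simp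
      moreover have "?R `` {x} \<in> components G I" using x(1) by (auto simp: components_def intro: quotientI)
      moreover have "x \<in> ?R `` {x}" using refl[OF x(1)] by simp
      ultimately show ?thesis using False by blast
    qed (use x cls in simp)
  next
    fix W assume "W \<in> components G I - {P, Q} \<union> {P \<union> Q}"
    then consider "W = P \<union> Q" | "W \<in> components G I" "W \<noteq> P" "W \<noteq> Q" by blast
    then show "W \<in> components G (insert r I)"
    proof cases
      case 1
      then have "W = ?R' `` {u}" using cls[of u] assms(6) by simp
      then show ?thesis using P(2) by (auto simp: components_def intro: quotientI)
    next
      case 2
      obtain w where w: "w \<in> W" using components_nonempty[OF 2(1)] by blast
      have "w \<notin> P \<union> Q"
        using w 2 components_disjoint[OF 2(1) assms(4)] components_disjoint[OF 2(1) assms(5)] by blast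
      then have "W = ?R' `` {w}" using cls[of w] comp(1)[OF 2(1) w] by simp
      then show ?thesis using comp(2)[OF 2(1) w] by (auto simp: components_def intro: quotientI)
    qed
  qed
qed

lemma edge_map_merge:
  assumes "finite_multigraph G" "insert r I \<in> cube G" "edges G ! r = {u, v}"
    and "P \<in> components G I" "Q \<in> components G I" "u \<in> P" "v \<in> Q" "P \<noteq> Q"
  shows "edge_map G I (insert r I) (pure_tensor (components G I) a) =
    pure_tensor (components G I - {P, Q} \<union> {P \<union> Q}) (a(P \<union> Q := a P * a Q))"
proof -
  let ?K = "components G I"
  have disj: "U = W \<or> U \<inter> W = {}" if "U \<in> ?K" "W \<in> ?K" for U W
    using components_disjoint that .
  have ne: "U \<noteq> {}" if "U \<in> ?K" for U using components_nonempty that .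
  have "U = P \<or> U = Q" if U: "U \<in> ?K" "U \<subseteq> P \<union> Q" for U
    using disj[OF U(1) assms(4)] disj[OF U(1) assms(5)] ne[OF U(1)] U(2) by blast
  then have "{U \<in> ?K. U \<subseteq> P \<union> Q} = {P, Q}" using assms(4,5) by blast
  then have 1: "merge_labels ?K a (P \<union> Q) = a P * a Q"
    using assms(8) by (simp add: merge_labels_def)
  have 2: "merge_labels ?K a W = a W" if "W \<in> ?K" for W
  proof -
    have "{U \<in> ?K. U \<subseteq> W} = {W}" using that components_subset by blast
    then show ?thesis by (simp add: merge_labels_def)
  qed
  have "edge_map G I (insert r I) (pure_tensor ?K a) =
      pure_tensor (components G (insert r I)) (merge_labels ?K a)"
    unfolding edge_map_def
    by (rule tensor_merge_pure[OF components_refines[OF assms(1)]]) auto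
  also have "\<dots> = pure_tensor (?K - {P, Q} \<union> {P \<union> Q}) (a(P \<union> Q := a P * a Q))"
    unfolding components_insert[OF assms(1-7)] by (rule pure_tensor_cong) (auto simp: 1 2)
  finally show ?thesis .
qed

subsection \<open>The differential has bidegree $(1, 0)$ and square zero\<close>

lemma a2_coeff_x_power:
  assumes "k < 2" "a2_coeff (a2_x ^ n :: 'r::comm_ring_1 a2) k \<noteq> 0"
  shows "n = k"
proof -
  consider "n = 0" | "n = 1" | m where "n = m + 2"
    by (metis One_nat_def Suc_1 add.commute less_2_cases_iff not_less le_Suc_ex)
  then show ?thesis
  proof cases
    case (3 m)
    have "a2_coeff (0 :: 'r a2) k = 0" by transfer simp
    then have False using assms(2) 3 by (simp add: a2_x_squared flip: mult.assoc)
    then show ?thesis ..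
  qed (use assms in \<open>auto split: if_splits\<close>)
qed

lemma tensor_merge_basis_card:
  assumes "refines K K'" "S \<subseteq> K"
    and "pure_tensor K' (merge_labels K (basis_labels S)) T \<noteq> (0 :: 'r::comm_ring_1)"
  shows "card T = card S"
proof -
  have fin: "finite K" "finite K'" using assms by (auto simp: refines_def)
  have T: "T \<subseteq> K'" using assms(3) by (auto simp: pure_tensor_def split: if_splits)
  let ?A = "\<lambda>W. {P \<in> S. P \<subseteq> W}"
  have cardA: "card (?A W) = of_bool (W \<in> T)" if W: "W \<in> K'" for W
  proof -
    have "(\<Prod>P\<in>{P \<in> K. P \<subseteq> W}. basis_labels S P) = (\<Prod>P\<in>?A W. basis_labels S P :: 'r a2)"
      by (rule prod.mono_neutral_right) (use fin assms(2) in \<open>auto simp: basis_labels_def\<close>)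
    also have "\<dots> = a2_x ^ card (?A W)"
      by (simp add: basis_labels_def)
    finally have "merge_labels K (basis_labels S) W = (a2_x ^ card (?A W) :: 'r a2)"
      by (simp add: merge_labels_def)
    moreover have "a2_coeff (merge_labels K (basis_labels S) W) (of_bool (W \<in> T)) \<noteq> (0 :: 'r)"
      using assms(3) T W fin(2) prod_zero by (fastforce simp: pure_tensor_def)
    ultimately show ?thesis by (intro a2_coeff_x_power) auto
  qed
  have "S = (\<Union>W\<in>K'. ?A W)" using assms(1,2) unfolding refines_def by blast
  then have "card S = card (\<Union>W\<in>K'. ?A W)" by simp
  also have "\<dots> = (\<Sum>W\<in>K'. card (?A W))"
  proof (rule card_UN_disjoint)
    show "\<forall>W\<in>K'. \<forall>U\<in>K'. W \<noteq> U \<longrightarrow> ?A W \<inter> ?A U = {}"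
      using assms(1,2) unfolding refines_def by blast
  qed (use fin finite_subset[OF assms(2)] in auto)
  also have "\<dots> = (\<Sum>W\<in>K'. of_bool (W \<in> T))" using cardA by simp
  also have "\<dots> = card T" using T fin(2) by (simp add: Int_absorb1 flip: Int_def)
  finally show ?thesis by simp
qed

lemma differential_chains:
  assumes "finite_multigraph G" "c \<in> chains G i j"
  shows "differential G c \<in> chains G (i + 1) j"
  unfolding chains_def
proof (rule CollectI, intro allI impI)
  fix J T assume nz: "differential G c J T \<noteq> 0"
  then have J: "J \<in> cube G" by (auto simp: differential_def split: if_splits)
  then have finJ: "finite J" by (auto simp: cube_def finite_subset)
  from nz J have "(\<Sum>r\<in>J. (- 1) ^ card {l \<in> J - {r}. l < r} *
      edge_map G (J - {r}) J (c (J - {r})) T) \<noteq> 0" by (simp add: differential_def)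
  then obtain r where r: "r \<in> J" "edge_map G (J - {r}) J (c (J - {r})) T \<noteq> 0"
    by (metis (no_types, lifting) mult_zero_right sum.neutral)
  let ?K = "components G (J - {r})"
  from r(2) obtain S where S: "S \<subseteq> ?K"
    "c (J - {r}) S * pure_tensor (components G J) (merge_labels ?K (basis_labels S)) T \<noteq> 0"
    unfolding edge_map_def tensor_merge_def by (metis (no_types, lifting) PowD sum.neutral)
  from S(2) have *: "c (J - {r}) S \<noteq> 0"
    "pure_tensor (components G J) (merge_labels ?K (basis_labels S :: 'a set \<Rightarrow> 'b a2)) T \<noteq> 0" by auto
  from tensor_merge_basis_card[OF components_refines[OF assms(1)] S(1) *(2)]
  have "card T = card S" by auto
  moreover have "int (card (J - {r})) = i" "int (card S) = j"
    using *(1) assms(2) by (auto simp: chains_def)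
  moreover have "card J = Suc (card (J - {r}))" using r(1) finJ by (metis card.remove)
  moreover have "T \<subseteq> components G J" using *(2) by (auto simp: pure_tensor_def split: if_splits)
  ultimately show "J \<in> cube G \<and> int (card J) = i + 1 \<and> T \<subseteq> components G J \<and> int (card T) = j"
    using J by simp
qed

lemma differential_add:
  "differential G (\<lambda>I S. c I S + d I S) = (\<lambda>I S. differential G c I S + differential G d I S)"
  by (simp add: differential_def edge_map_def tensor_merge_add distrib_left sum.distrib fun_eq_iff)

lemma differential_squared:
  assumes "finite_multigraph G"
  shows "differential G (differential G c) = (\<lambda>_ _. 0 :: 'r::comm_ring_1)"
proof (intro ext)
  fix J T
  show "differential G (differential G c) J T = 0"
  proof (cases "J \<in> cube G")
    case True
    then have fin: "finite J" by (auto simp: cube_def finite_subset)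
    have sub: "J - {r} \<in> cube G" for r using True by (auto simp: cube_def)
    let ?sg = "\<lambda>r J. (- 1 :: 'r) ^ card {l \<in> J. l < r}"
    let ?f = "\<lambda>r s. ?sg r (J - {r}) * (?sg s (J - {r} - {s}) *
      edge_map G (J - {r} - {s}) J (c (J - {r} - {s})) T)"
    have comp: "edge_map G (J - {r}) J (edge_map G (J - {r} - {s}) (J - {r}) t) =
        edge_map G (J - {r} - {s}) J t" for r s and t :: "'a set set \<Rightarrow> 'r"
      unfolding edge_map_def
      by (intro tensor_merge_comp components_refines assms) auto
    have "edge_map G (J - {r}) J (differential G c (J - {r})) T =
        (\<Sum>s\<in>J - {r}. ?sg s (J - {r} - {s}) *
          edge_map G (J - {r} - {s}) J (c (J - {r} - {s})) T)" for r
    proof -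
      have "differential G c (J - {r}) = (\<lambda>S. \<Sum>s\<in>J - {r}. ?sg s (J - {r} - {s}) *
          edge_map G (J - {r} - {s}) (J - {r}) (c (J - {r} - {s})) S)"
        by (simp add: differential_def sub)
      then have "edge_map G (J - {r}) J (differential G c (J - {r})) T =
          (\<Sum>s\<in>J - {r}. ?sg s (J - {r} - {s}) * edge_map G (J - {r}) J
            (edge_map G (J - {r} - {s}) (J - {r}) (c (J - {r} - {s}))) T)"
        unfolding edge_map_def by (simp only: tensor_merge_sum)
      then show ?thesis by (simp only: comp)
    qed
    then have "differential G (differential G c) J T = (\<Sum>r\<in>J. \<Sum>s\<in>J - {r}. ?f r s)"
      using True by (simp add: differential_def[of G "differential G c"] sum_distrib_left)
    also have "\<dots> = (\<Sum>(r, s)\<in>Sigma J (\<lambda>r. J - {r}). ?f r s)"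
      using fin by (subst sum.Sigma) auto
    also have "Sigma J (\<lambda>r. J - {r}) = {(r, s)\<in>J \<times> J. r < s} \<union> {(r, s)\<in>J \<times> J. s < r}"
      by auto
    also have "(\<Sum>(r, s)\<in>\<dots>. ?f r s) =
        (\<Sum>(r, s)\<in>{(r, s)\<in>J \<times> J. r < s}. ?f r s) + (\<Sum>(r, s)\<in>{(r, s)\<in>J \<times> J. s < r}. ?f r s)"
      using fin by (intro sum.union_disjoint) (auto intro: finite_subset[of _ "J \<times> J"])
    also have "(\<Sum>(r, s)\<in>{(r, s)\<in>J \<times> J. s < r}. ?f r s) =
        (\<Sum>(r, s)\<in>{(r, s)\<in>J \<times> J. r < s}. - ?f r s)"
    proof (rule sum.reindex_bij_witness[of _ prod.swap prod.swap])
      fix p assume p: "p \<in> {(r, s)\<in>J \<times> J. s < r}"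
      obtain r s where rs: "p = (r, s)" "r \<in> J" "s \<in> J" "s < r" using p by auto
      have "{l \<in> J - {r}. l < r} = insert s {l \<in> J - {s} - {r}. l < r}" using rs by auto
      then have "card {l \<in> J - {r}. l < r} = Suc (card {l \<in> J - {s} - {r}. l < r})"
        using fin by simp
      moreover have "{l \<in> J - {r} - {s}. l < s} = {l \<in> J - {s}. l < s}" using rs by auto
      moreover have "J - {r} - {s} = J - {s} - {r}" by auto
      ultimately show "(case prod.swap p of (r, s) \<Rightarrow> - ?f r s) = (case p of (r, s) \<Rightarrow> ?f r s)"
        by (simp add: rs(1) ac_simps)
    qed auto
    finally show ?thesis by (simp add: sum_negf case_prod_unfold)
  qed (simp add: differential_def)
qed

subsection \<open>Homology groups\<close>

lemma differential_uminus:
  "differential G (\<lambda>I S. - c I S) = (\<lambda>I S. - differential G c I S)"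
  by (simp add: differential_def edge_map_def tensor_merge_def sum_negf fun_eq_iff)

lemma comm_group_cycle_group:
  "comm_group (cycle_group G i j :: ('v, 'r::comm_ring_1) chain monoid)"
proof (rule comm_groupI)
  fix c d :: "('v, 'r) chain"
  assume c: "c \<in> carrier (cycle_group G i j)" and d: "d \<in> carrier (cycle_group G i j)"
  have "c I S + d I S \<noteq> 0 \<Longrightarrow> c I S \<noteq> 0 \<or> d I S \<noteq> 0" for I S by auto
  with c d show "c \<otimes>\<^bsub>cycle_group G i j\<^esub> d \<in> carrier (cycle_group G i j)"
    unfolding cycle_group_def cycles_def chains_def by (fastforce simp: differential_add)
next
  fix c :: "('v, 'r) chain"
  assume c: "c \<in> carrier (cycle_group G i j)"
  show "\<exists>d\<in>carrier (cycle_group G i j). d \<otimes>\<^bsub>cycle_group G i j\<^esub> c = \<one>\<^bsub>cycle_group G i j\<^esub>"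
    by (rule bexI[of _ "\<lambda>I S. - c I S"])
      (use c in \<open>auto simp: cycle_group_def cycles_def chains_def differential_uminus\<close>)
next
  have "differential G (\<lambda>_ _. 0 :: 'r) = (\<lambda>_ _. 0)"
    by (simp add: differential_def edge_map_def tensor_merge_def fun_eq_iff)
  then show "\<one>\<^bsub>cycle_group G i j\<^esub> \<in> carrier (cycle_group G i j :: ('v, 'r) chain monoid)"
    by (simp add: cycle_group_def cycles_def chains_def)
qed (auto simp: cycle_group_def ac_simps)

lemma boundaries_normal:
  assumes "finite_multigraph G"
  shows "boundaries G i j \<lhd> (cycle_group G i j :: ('v, 'r::comm_ring_1) chain monoid)"
proof -
  let ?Z = "cycle_group G i j :: ('v, 'r) chain monoid"
  interpret comm_group ?Z by (rule comm_group_cycle_group)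
  have sub: "boundaries G i j \<subseteq> carrier ?Z"
    using differential_chains[OF assms, of _ "i - 1" j] differential_squared[OF assms]
    by (auto simp: boundaries_def cycle_group_def cycles_def)
  have "subgroup (boundaries G i j) ?Z"
  proof (rule subgroupI)
    have "(\<lambda>_ _. 0) \<in> chains G (i - 1) j" by (simp add: chains_def)
    then show "boundaries G i j \<noteq> ({} :: ('v, 'r) chain set)" by (auto simp: boundaries_def)
  next
    fix c assume "c \<in> (boundaries G i j :: ('v, 'r) chain set)"
    then obtain b where b: "b \<in> chains G (i - 1) j" "c = differential G b" by (auto simp: boundaries_def)
    have "(\<lambda>I S. - b I S) \<in> chains G (i - 1) j" using b(1) by (simp add: chains_def)
    then have bd: "(\<lambda>I S. - c I S) \<in> boundaries G i j"
      unfolding boundaries_def b(2) differential_uminus[symmetric] by (rule imageI)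
    moreover have "inv\<^bsub>?Z\<^esub> c = (\<lambda>I S. - c I S)"
      using sub bd \<open>c \<in> boundaries G i j\<close>
      by (intro inv_equality) (auto simp: cycle_group_def)
    ultimately show "inv\<^bsub>?Z\<^esub> c \<in> boundaries G i j" by simp
  next
    fix c d assume "c \<in> (boundaries G i j :: ('v, 'r) chain set)" "d \<in> (boundaries G i j :: ('v, 'r) chain set)"
    then obtain a b :: "('v, 'r) chain" where ab: "a \<in> chains G (i - 1) j" "c = differential G a"
      "b \<in> chains G (i - 1) j" "d = differential G b" by (auto simp: boundaries_def)
    have "a I S + b I S \<noteq> 0 \<Longrightarrow> a I S \<noteq> 0 \<or> b I S \<noteq> 0" for I S by auto
    then have "(\<lambda>I S. a I S + b I S) \<in> chains G (i - 1) j"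
      using ab(1,3) unfolding chains_def by fastforce
    then show "c \<otimes>\<^bsub>?Z\<^esub> d \<in> boundaries G i j"
      unfolding boundaries_def ab by (simp add: cycle_group_def flip: differential_add)
  qed (rule sub)
  then show ?thesis by (rule subgroup_imp_normal)
qed

theorem comm_group_chromatic_homology:
  assumes "finite_multigraph G"
  shows "comm_group (chromatic_homology G i j :: ('v, 'r::comm_ring_1) chain set monoid)"
  unfolding chromatic_homology_def
  by (rule comm_group.abelian_FactGroup[OF comm_group_cycle_group])
    (rule normal_imp_subgroup[OF boundaries_normal[OF assms]])

end

theory Submission
  imports Defs
begin

text \<open>
  Deform \<open>x\<^sup>2 = 0\<close> to \<open>x\<^sup>2 = x\<close>.  The differential becomes \<open>d + \<Phi>\<close>, where \<open>\<Phi>\<close> has bidegree \<open>(1, -1)\<close>, and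
  since \<open>\<int>[x]/(x\<^sup>2 - x)\<close> splits, the deformed complex is a sum of cubes and has free homology.

  Let the graph be connected with a root \<open>w\<close>.  On the generators with label \<open>1\<close> at the component of
  \<open>w\<close>, deletion and contraction of edges shows that the homology of \<open>d\<close> is free and concentrated on
  one diagonal \<open>i + j = n\<close>.  Only \<open>\<Phi>\<close> itself preserves this diagonal, so by homological
  perturbation it acts on the homology of \<open>d\<close> as a differential whose own homology is free.
  The whole complex is the cone of the map \<open>\<delta>\<close> that moves a label \<open>x\<close> to the root when the component
  carrying it is merged into the root.  If \<open>\<nu>\<close> is the sum of the derivations \<open>\<partial>/\<partial>x\<close> over the components
  other than the root, then \<open>d\<nu> - \<nu>d = 2\<Phi> + \<delta>\<close>, so the complex is isomorphic to the cone of \<open>-2\<Phi>\<close>,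
  and all torsion in the homology of that cone has order two.

  For disconnected graphs the complex is a tensor product, and a factor of this shape contributes
  copies of the other factor and of the cone of multiplication by two on it.
\<close>

section \<open>Linear operators on integral functions\<close>

text \<open>The factor two is a failure of the Leibniz rule: d/dx does not respect x^2 = 0, since on
  the product of x and x it yields 1 x + x 1 = 2x, while \<open>\<Phi>\<close> records the term x of
  this product once. The obstacle is that perturbation in general puts a whole series
  \<open>\<Phi>\<close> - \<open>\<Phi> h \<Phi>\<close> + ... on the homology of \<open>d\<close>.
  Each \<open>h\<close> lowers i + j by one, so on a single diagonal only the first term survives.
  This is why a root is needed: the complex consists of two rooted copies, with 1 or x at the root,
  and these lie on two neighbouring diagonals. Freeness is used as an equation: the contraction of
  the deformed complex descends to an operator \<open>K\<close> with
  \<open>\<theta> K \<theta> = \<theta>\<close>, where \<open>\<theta>\<close> is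
  \<open>\<Phi>\<close> on the homology of \<open>d\<close>. Where \<open>\<theta>\<close> is
  inverted by \<open>K\<close>, the map \<open>-2 \<theta>\<close> is twice an isomorphism and gives
  torsion of order two; elsewhere the differential vanishes. All maps live in one ring of operators
  on functions on a fixed index set. Homotopies and splittings are then identities in that ring, and
  these pass to tensor products without a Kuenneth formula.\<close>

typedef 'i endo = "{f :: ('i \<Rightarrow> int) \<Rightarrow> 'i \<Rightarrow> int.
    \<forall>k x y. f (\<lambda>i. k * x i + y i) = (\<lambda>i. k * f x i + f y i)}"
  morphisms app Endo
  by (rule exI[of _ "\<lambda>x. x"]) simp

setup_lifting type_definition_endo

instantiation endo :: (type) ring_1
begin

lift_definition zero_endo :: "'a endo" is "\<lambda>_ _. 0" by simp
lift_definition one_endo :: "'a endo" is "\<lambda>x. x" by simp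
lift_definition plus_endo :: "'a endo \<Rightarrow> 'a endo \<Rightarrow> 'a endo" is "\<lambda>f g x i. f x i + g x i"
  by (simp add: algebra_simps)
lift_definition minus_endo :: "'a endo \<Rightarrow> 'a endo \<Rightarrow> 'a endo" is "\<lambda>f g x i. f x i - g x i"
  by (simp add: algebra_simps)
lift_definition uminus_endo :: "'a endo \<Rightarrow> 'a endo" is "\<lambda>f x i. - f x i"
  by simp
lift_definition times_endo :: "'a endo \<Rightarrow> 'a endo \<Rightarrow> 'a endo" is "\<lambda>f g x. f (g x)"
  by simp

instance
proof
  fix a b c :: "'a endo"
  show "a * b * c = a * (b * c)" by transfer simp
  show "a + b + c = a + (b + c)" by transfer (simp add: algebra_simps)
  show "a + b = b + a" by transfer (simp add: algebra_simps)
  show "0 + a = a" by transfer simp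
  show "- a + a = 0" by transfer simp
  show "a - b = a + - b" by transfer simp
  show "1 * a = a" "a * 1 = a" by (transfer, simp)+
  show "(a + b) * c = a * c + b * c" by transfer simp
  show "a * (b + c) = a * b + a * c"
  proof transfer
    fix a b c :: "('a \<Rightarrow> int) \<Rightarrow> 'a \<Rightarrow> int"
    assume "\<forall>k x y. a (\<lambda>i. k * x i + y i) = (\<lambda>i. k * a x i + a y i)"
    from this[rule_format, of 1] show "(\<lambda>x. a (\<lambda>i. b x i + c x i)) = (\<lambda>x i. a (b x) i + a (c x) i)"
      by simp
  qed
  show "(0::'a endo) \<noteq> 1"
  proof transfer
    have "(\<lambda>_ _. 0) (\<lambda>_. 1) \<noteq> (\<lambda>x :: 'a \<Rightarrow> int. x) (\<lambda>_. 1)" by (simp add: fun_eq_iff)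
    then show "(\<lambda>_ _. 0) \<noteq> (\<lambda>x :: 'a \<Rightarrow> int. x)" by metis
  qed
qed

end

lemma app_lincomb: "app X (\<lambda>i. k * c i + d i) = (\<lambda>i. k * app X c i + app X d i)"
  using app[of X] by blast

lemma app_zero [simp]: "app X (\<lambda>_. 0) = (\<lambda>_. 0)"
proof -
  have "app X (\<lambda>_. - 1 * 0 + 0) = (\<lambda>i. - 1 * app X (\<lambda>_. 0) i + app X (\<lambda>_. 0) i)"
    by (rule app_lincomb)
  then show ?thesis by simp
qed

lemma app_add: "app X (\<lambda>i. c i + d i) = (\<lambda>i. app X c i + app X d i)"
  using app_lincomb[of X 1 c d] by simp

lemma app_scale: "app X (\<lambda>i. k * c i) = (\<lambda>i. k * app X c i)"
  using app_lincomb[of X k c "\<lambda>_. 0"] by simp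

lemma app_sum: "app X (\<lambda>i. \<Sum>n\<in>A. k n * c n i) = (\<lambda>i. \<Sum>n\<in>A. k n * app X (c n) i)"
  by (induction A rule: infinite_finite_induct) (simp_all add: app_lincomb)

lemma app_ring [simp]:
  "app 0 c = (\<lambda>_. 0)" "app 1 c = c" "app (X * Y) c = app X (app Y c)"
  "app (X + Y) c = (\<lambda>i. app X c i + app Y c i)" "app (X - Y) c = (\<lambda>i. app X c i - app Y c i)"
  "app (- X) c = (\<lambda>i. - app X c i)"
  by (transfer, simp)+

lemma app_double: "app (2 * X) c i = 2 * app X c i"
  unfolding mult_2 app_ring by simp

lemma endo_eqI: "(\<And>c i. app X c i = app Y c i) \<Longrightarrow> X = Y"
  by (rule app_inject[THEN iffD1]) (auto intro!: ext)

text \<open>Integers have no 2-torsion, hence neither do operators. This is needed because squares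
  of odd operators are obtained only doubled, from anticommutators.\<close>

lemma endo_double_zero:
  assumes "X + X = 0" shows "X = (0 :: 'i endo)"
proof (rule endo_eqI)
  fix c i
  have "app X c i + app X c i = app (X + X) c i" by simp
  then show "app X c i = app 0 c i" by (simp add: assms)
qed

lemma app_Endo:
  assumes "\<And>k x y i. f (\<lambda>i. k * x i + y i) i = k * f x i + f y i"
  shows "app (Endo f) = f"
  by (rule Endo_inverse) (auto simp: assms)

text \<open>Support of an operator, row by row: the value at s depends only on the arguments t with
  (s, t) in the relation. Rows come first, so degree shifts in such relations are opposite to those
  of the operator.\<close>

definition reads :: "'i endo \<Rightarrow> ('i \<times> 'i) set \<Rightarrow> bool" where
  "reads X \<rho> \<longleftrightarrow> (\<forall>s c c'. (\<forall>t. (s, t) \<in> \<rho> \<longrightarrow> c t = c' t) \<longrightarrow> app X c s = app X c' s)"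

lemma readsD: "reads X \<rho> \<Longrightarrow> (\<And>t. (s, t) \<in> \<rho> \<Longrightarrow> c t = c' t) \<Longrightarrow> app X c s = app X c' s"
  unfolding reads_def by blast

lemma reads_zeroD: "reads X \<rho> \<Longrightarrow> (\<And>t. (s, t) \<in> \<rho> \<Longrightarrow> c t = 0) \<Longrightarrow> app X c s = 0"
  using readsD[of X \<rho> s c "\<lambda>_. 0"] by simp

lemma reads_mono: "reads X \<rho> \<Longrightarrow> \<rho> \<subseteq> \<sigma> \<Longrightarrow> reads X \<sigma>"
  unfolding reads_def by blast

lemma reads_0 [simp]: "reads 0 \<rho>"
  by (simp add: reads_def)

lemma reads_1: "Id \<subseteq> \<rho> \<Longrightarrow> reads 1 \<rho>"
  unfolding reads_def by auto

lemma reads_add: "reads X \<rho> \<Longrightarrow> reads Y \<rho> \<Longrightarrow> reads (X + Y) \<rho>"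
  unfolding reads_def app_ring by (intro allI impI arg_cong2[of _ _ _ _ "(+)"]) blast+

lemma reads_diff: "reads X \<rho> \<Longrightarrow> reads Y \<rho> \<Longrightarrow> reads (X - Y) \<rho>"
  unfolding reads_def app_ring by (intro allI impI arg_cong2[of _ _ _ _ "(-)"]) blast+

lemma reads_uminus: "reads X \<rho> \<Longrightarrow> reads (- X) \<rho>"
  unfolding reads_def app_ring by (intro allI impI arg_cong[of _ _ uminus]) blast

lemma reads_sum: "(\<And>n. n \<in> A \<Longrightarrow> reads (X n) \<rho>) \<Longrightarrow> reads (\<Sum>n\<in>A. X n) \<rho>"
  by (induction A rule: infinite_finite_induct) (simp_all add: reads_add)

lemma reads_mult: "reads X \<rho> \<Longrightarrow> reads Y \<sigma> \<Longrightarrow> \<rho> O \<sigma> \<subseteq> \<tau> \<Longrightarrow> reads (X * Y) \<tau>"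
  unfolding reads_def app_ring by blast

text \<open>Interpolation: the function that equals c on the row of \<open>\<rho>\<close> and c' off
  it cannot be told from c through \<open>\<rho>\<close>, nor from c' through
  \<open>\<sigma>\<close>. With disjoint supports this makes the operator zero.\<close>

lemma reads_Int: "reads X \<rho> \<Longrightarrow> reads X \<sigma> \<Longrightarrow> reads X (\<rho> \<inter> \<sigma>)"
  unfolding reads_def
proof (intro allI impI)
  fix s and c c' :: "'a \<Rightarrow> int"
  assume X: "\<forall>s c c'. (\<forall>t. (s, t) \<in> \<rho> \<longrightarrow> c t = c' t) \<longrightarrow> app X c s = app X c' s"
    "\<forall>s c c'. (\<forall>t. (s, t) \<in> \<sigma> \<longrightarrow> c t = c' t) \<longrightarrow> app X c s = app X c' s"
    and c: "\<forall>t. (s, t) \<in> \<rho> \<inter> \<sigma> \<longrightarrow> c t = c' t"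
  define e where "e t = (if (s, t) \<in> \<rho> then c t else c' t)" for t
  have "app X c s = app X e s" using X(1) by (simp add: e_def)
  also have "\<dots> = app X c' s" by (rule X(2)[rule_format]) (use c in \<open>auto simp: e_def\<close>)
  finally show "app X c s = app X c' s" .
qed

lemma reads_empty: "reads X {} \<Longrightarrow> X = 0"
proof (rule endo_eqI)
  fix c i assume "reads X {}"
  then show "app X c i = app 0 c i" using reads_zeroD[of X "{}" i c] by simp
qed

lemma reads_expand:
  assumes "reads X \<rho>" "\<And>t. (s, t) \<in> \<rho> \<Longrightarrow> t \<in> A" "finite A"
  shows "app X c s = (\<Sum>t\<in>A. c t * app X (\<lambda>i. of_bool (i = t)) s)"
proof -
  have "app X c s = app X (\<lambda>i. \<Sum>t\<in>A. c t * of_bool (i = t)) s"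
    by (rule readsD[OF assms(1)]) (use assms(2,3) in \<open>simp add: of_bool_def if_distrib cong: if_cong\<close>)
  then show ?thesis by (simp add: app_sum)
qed

definition restr :: "'i set \<Rightarrow> 'i endo" where
  "restr S = Endo (\<lambda>c i. if i \<in> S then c i else 0)"

lemma app_restr [simp]: "app (restr S) c = (\<lambda>i. if i \<in> S then c i else 0)"
  unfolding restr_def by (subst app_Endo) auto

lemma restr_mult: "restr S * restr T = restr (S \<inter> T)"
  by (rule endo_eqI) auto

lemma restr_Un: "S \<inter> T = {} \<Longrightarrow> restr (S \<union> T) = restr S + restr T"
  by (rule endo_eqI) auto

lemma restr_mult_left: "reads X (S \<times> UNIV) \<Longrightarrow> restr S * X = X"
proof (rule endo_eqI)
  fix c i assume X: "reads X (S \<times> UNIV)"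
  show "app (restr S * X) c i = app X c i"
    using reads_zeroD[OF X, of i c] by auto
qed

lemma restr_mult_right: "reads X (UNIV \<times> S) \<Longrightarrow> X * restr S = X"
  by (rule endo_eqI) (auto intro!: readsD)

lemma reads_restr: "reads (restr S) (Id_on S)"
  by (auto simp: reads_def)

section \<open>Homological perturbation\<close>

text \<open>Geometric series. The sum is part of the conclusion because the support of the inverse
  is later read off from its terms.\<close>

lemma nilpotent_inverse:
  fixes x :: "'a::ring_1"
  assumes "x ^ n = 0"
  obtains u where "(1 + x) * u = 1" "u * (1 + x) = 1" "u = (\<Sum>k<n. (- x) ^ k)"
proof -
  define s where "s m = (\<Sum>k<m. (- x) ^ k)" for m
  have c: "s m * x = x * s m" for m
  proof -
    have "x * (- x) ^ k = (- x) ^ k * x" for k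
      using power_commutes[of "- x" k] by simp
    then show ?thesis unfolding s_def sum_distrib_left sum_distrib_right by simp
  qed
  have "(1 + x) * s m = 1 - (- x) ^ m" for m
  proof (induction m)
    case (Suc m)
    have "s (Suc m) = s m + (- x) ^ m" by (simp add: s_def)
    then have "(1 + x) * s (Suc m) = (1 + x) * s m + ((- x) ^ m + x * (- x) ^ m)"
      by (simp only: distrib_left distrib_right mult_1_left)
    with Suc show ?case by simp
  qed (simp add: s_def)
  moreover have "(- x) ^ n = 0" using assms by (simp add: power_minus[of x])
  ultimately have 1: "(1 + x) * s n = 1" by simp
  moreover from this have "s n * (1 + x) = 1" using c[of n]
    by (simp only: distrib_left distrib_right mult_1_left mult_1_right)
  ultimately show thesis using that[of "s n"] by (simp add: s_def)
qed

text \<open>Completes a relation between products to a rewrite rule that also applies inside words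
  bracketed to the right.\<close>

lemma assoc_eq: "(x::'a::semigroup_mult) * y = w \<Longrightarrow> x * (y * z) = w * z"
  by (simp add: mult.assoc[symmetric])

text \<open>Homological perturbation with \<open>u\<close> inverse to \<open>1 + h * X\<close>. The
  perturbed inclusion is \<open>u * P\<close>, the perturbed projection
  \<open>P * (1 - X * u * h)\<close>, the induced differential \<open>P * X * u * P\<close> and the
  new homotopy \<open>u * h\<close>: the first two claims say that inclusion and projection are
  chain maps, the third that they are inverse up to homotopy.\<close>

lemma perturbation:
  fixes d X h P u :: "'a::ring_1"
  assumes anti: "X * d = - (d * X)" and XX: "X * X = 0"
    and ret: "1 = P + d * h + h * d" and dP: "d * P = 0" and Pd: "P * d = 0"
    and u: "u * (1 + h * X) = 1" "(1 + h * X) * u = 1"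
  shows "(d + X) * u * P = u * P * X * u * P"
    and "P * (1 - X * u * h) * (d + X) = P * X * u * P * (1 - X * u * h)"
    and "1 - u * P * (1 - X * u * h) = (d + X) * (u * h) + u * h * (d + X)"
proof -
  have hd: "h * d = 1 - P - d * h" using ret by (simp add: algebra_simps)
  \<comment> \<open>\<open>1 + h * X\<close> intertwines \<open>d + X\<close> with \<open>d\<close>
    up to the term \<open>P * X\<close>; everything else is derived from this.\<close>
  have "(1 + h * X) * (d + X) = d + X - (h * d) * X"
    by (simp add: algebra_simps anti XX)
  also have "\<dots> = d * (1 + h * X) + P * X"
    unfolding hd by (simp add: algebra_simps)
  finally have 1: "(1 + h * X) * (d + X) = d * (1 + h * X) + P * X" .
  have "(d + X) * u = u * ((1 + h * X) * (d + X)) * u"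
    by (simp add: u(1) flip: mult.assoc)
  also have "\<dots> = u * d * ((1 + h * X) * u) + u * P * X * u"
    unfolding 1 by (simp only: distrib_left distrib_right mult.assoc)
  finally have Du: "(d + X) * u = u * d + u * P * X * u" by (simp add: u(2))
  show "(d + X) * u * P = u * P * X * u * P"
    unfolding Du by (simp add: distrib_right mult.assoc dP)
  have uhX: "u + u * h * X = 1" using u(1) by (simp add: algebra_simps)
  have "(d + X) * (u * h) + u * h * (d + X) = (d + X) * u * h + u * (h * d) + u * h * X"
    by (simp add: algebra_simps)
  also have "\<dots> = u * (d * h + h * d) + u * h * X + u * P * X * u * h"
    unfolding Du by (simp add: algebra_simps)
  also have "d * h + h * d = 1 - P" using ret by (simp add: algebra_simps)
  also have "u * (1 - P) + u * h * X + u * P * X * u * h = (u + u * h * X) - u * P * (1 - X * u * h)"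
    by (simp add: algebra_simps)
  finally show C: "1 - u * P * (1 - X * u * h) = (d + X) * (u * h) + u * h * (d + X)"
    by (simp add: uhX)
  have PXd: "P * X * d = 0" using anti Pd by (simp add: mult.assoc assoc_eq[OF Pd])
  have PXX: "P * X * X = 0" by (simp add: mult.assoc XX)
  have "P * (1 - X * u * h) * (d + X) = P * d + P * X - P * X * (u * h * (d + X))"
    by (simp add: algebra_simps)
  also have "u * h * (d + X) = 1 - u * P * (1 - X * u * h) - (d + X) * (u * h)"
    unfolding C by simp
  also have "P * X * (1 - u * P * (1 - X * u * h) - (d + X) * (u * h)) =
      P * X - P * X * u * P * (1 - X * u * h) - (P * X * d + P * X * X) * (u * h)"
    by (simp add: algebra_simps)
  finally show "P * (1 - X * u * h) * (d + X) = P * X * u * P * (1 - X * u * h)"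
    by (simp add: Pd PXd PXX)
qed

text \<open>
  Up to homotopy \<open>h\<close> the complex is the sum of a part \<open>P\<close> with zero differential and a part \<open>e\<close> on
  which multiplication by two is null-homotopic by \<open>k\<close>.  The involution \<open>\<kappa>\<close> is meant to be the sign of
  the homological grading; the compatibility with it makes the splitting pass to tensor products.
\<close>

definition torsion_split :: "'a::ring_1 \<Rightarrow> 'a \<Rightarrow> bool" where
  "torsion_split \<kappa> d \<longleftrightarrow> (\<exists>P e h k. 1 = P + e + d * h + h * d \<and> d * P = 0 \<and> P * d = 0 \<and>
     2 * e = d * k + k * d \<and> \<kappa> * P = P * \<kappa> \<and> \<kappa> * e = e * \<kappa> \<and>
     \<kappa> * h = - (h * \<kappa>) \<and> \<kappa> * k = - (k * \<kappa>))"

text \<open>The algebraic core. \<open>\<epsilon>\<close> sends one copy of the rooted complex to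
  the other and \<open>\<epsilon>'\<close> sends it back, so
  \<open>d + \<delta> * \<epsilon>\<close> is the cone of \<open>\<delta>\<close>. A base change
  turns it into the perturbation of \<open>d\<close> by \<open>- 2 * \<Phi> * \<epsilon>\<close>;
  this is reduced to \<open>P\<close>, and there the contraction of the deformed complex provides
  the splitting.\<close>

lemma torsion_split_cone:
  fixes d \<Phi> h P H \<pi> \<nu> \<delta> \<epsilon> \<epsilon>' \<kappa> u :: "'a::ring_1"
  assumes dd: "d * d = 0" and anti: "\<Phi> * d = - (d * \<Phi>)" and \<Phi>\<Phi>: "\<Phi> * \<Phi> = 0"
    and ret: "1 = P + d * h + h * d" "d * P = 0" "P * d = 0" "P * P = P"
    and u: "u * (1 + h * \<Phi>) = 1" "(1 + h * \<Phi>) * u = 1"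
    and conc: "P * \<Phi> * u * P = P * \<Phi> * P" "P * (1 - \<Phi> * u * h) * u * P = P"
    and H: "(d + \<Phi>) * H + H * (d + \<Phi>) = 1 - \<pi>" "\<pi> * (d + \<Phi>) = 0"
    and \<nu>: "d * \<nu> - \<nu> * d = 2 * \<Phi> + \<delta>"
    and \<epsilon>: "\<epsilon> * \<epsilon> = 0" "\<epsilon>' * \<epsilon> + \<epsilon> * \<epsilon>' = 1"
    and comm: "\<And>T. T \<in> {d, \<Phi>, h, P, H, \<pi>, \<nu>, \<delta>, u} \<Longrightarrow> \<epsilon> * T = T * \<epsilon>"
      "\<And>T. T \<in> {d, \<Phi>, h, P, H, \<pi>, \<nu>, \<delta>, u} \<Longrightarrow> \<epsilon>' * T = T * \<epsilon>'"
    and even: "\<And>T. T \<in> {P, \<nu>, \<epsilon>, \<epsilon>', u} \<Longrightarrow> \<kappa> * T = T * \<kappa>"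
    and odd: "\<And>T. T \<in> {\<Phi>, h, H} \<Longrightarrow> \<kappa> * T = - (T * \<kappa>)"
  shows "torsion_split \<kappa> (d + \<delta> * \<epsilon>)"
proof -
  define D where "D = d + \<Phi>"
  define u' where "u' = 1 - \<Phi> * u * h"
  \<comment> \<open>Perturbation by \<open>\<Phi>\<close> induces \<open>P * \<Phi> * u * P\<close>
    on \<open>P\<close>; by \<open>conc\<close> no correction to \<open>P * \<Phi> * P\<close>
    remains.\<close>
  define \<theta> where "\<theta> = P * \<Phi> * P"
  \<comment> \<open>\<open>H\<close> transferred to \<open>P\<close> along the perturbed projection
    \<open>P * u'\<close> and inclusion \<open>u * P\<close>; \<open>\<mu>\<close> is
    \<open>\<pi>\<close> transferred in the same way.\<close>
  define K where "K = P * u' * H * u * P"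
  define \<mu> where "\<mu> = P * u' * \<pi> * u * P"
  note pert = perturbation[OF anti \<Phi>\<Phi> ret(1-3) u]
  have DuP: "D * u * P = u * \<theta>" using pert(1) conc(1) by (simp add: D_def \<theta>_def mult.assoc)
  have PuD: "P * u' * D = \<theta> * u'"
    using pert(2) conc(1) by (simp add: D_def \<theta>_def u'_def flip: mult.assoc)
  have DD: "D * D = 0" by (simp add: D_def algebra_simps dd anti \<Phi>\<Phi>)
  have P\<theta>: "P * \<theta> = \<theta>" "\<theta> * P = \<theta>" and PK: "P * K = K" "K * P = K"
    by (simp_all add: \<theta>_def K_def mult.assoc ret(4) assoc_eq[OF ret(4)])
  have uu: "P * u' * u * P = P" using conc(2) by (simp add: u'_def)
  have "\<theta> * K = (\<theta> * P) * u' * H * u * P" by (simp add: K_def mult.assoc)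
  also have "\<dots> = P * u' * (D * H) * u * P" unfolding P\<theta> PuD[symmetric] by (simp add: mult.assoc)
  finally have 1: "\<theta> * K = P * u' * (D * H) * u * P" .
  have "K * \<theta> = P * u' * H * (u * (P * \<theta>))" by (simp add: K_def mult.assoc)
  also have "\<dots> = P * u' * (H * D) * u * P" unfolding P\<theta> DuP[symmetric] by (simp add: mult.assoc)
  finally have 2: "K * \<theta> = P * u' * (H * D) * u * P" .
  have "\<theta> * K + K * \<theta> = P * u' * (D * H + H * D) * u * P"
    unfolding 1 2 by (simp add: algebra_simps)
  also have "\<dots> = P - \<mu>" unfolding D_def H(1) \<mu>_def
    by (simp only: left_diff_distrib right_diff_distrib mult_1_right uu)
  finally have K: "\<theta> * K + K * \<theta> = P - \<mu>" .
  have "\<mu> * \<theta> = P * u' * \<pi> * (u * (P * \<theta>))" by (simp add: \<mu>_def mult.assoc)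
  also have "\<dots> = P * u' * (\<pi> * D) * u * P" unfolding P\<theta> DuP[symmetric] by (simp add: mult.assoc)
  finally have \<mu>\<theta>: "\<mu> * \<theta> = 0" using H(2) by (simp add: D_def)
  have "\<theta> * \<theta> * u' = (\<theta> * P) * u' * D" using PuD by (simp add: mult.assoc)
  also have "\<dots> = P * u' * (D * D)" unfolding P\<theta> PuD[symmetric] by (simp add: mult.assoc)
  finally have "\<theta> * \<theta> * (P * u' * u * P) = 0" using P\<theta>(2) DD by (simp flip: mult.assoc) (simp add: mult.assoc)
  then have \<theta>\<theta>: "\<theta> * \<theta> = 0" unfolding uu by (simp add: mult.assoc P\<theta>)
  \<comment> \<open>As \<open>\<mu>\<close> kills \<open>\<theta>\<close>, the operator
    \<open>K\<close> is a generalised inverse: \<open>K * \<theta>\<close> is an idempotent with the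
    kernel of \<open>\<theta>\<close>, and \<open>\<theta> * K\<close> one with its image.\<close>
  have \<theta>K\<theta>: "\<theta> * K * \<theta> = \<theta>"
  proof -
    have "\<theta> * K * \<theta> = (\<theta> * K + K * \<theta>) * \<theta>" by (simp add: distrib_right mult.assoc \<theta>\<theta>)
    then show ?thesis unfolding K by (simp add: left_diff_distrib \<mu>\<theta> P\<theta>)
  qed
  have c\<epsilon>: "\<epsilon> * u' = u' * \<epsilon>" "\<epsilon> * \<theta> = \<theta> * \<epsilon>" "\<epsilon> * K = K * \<epsilon>"
    and c\<epsilon>': "\<epsilon>' * \<theta> = \<theta> * \<epsilon>'" "\<epsilon>' * K = K * \<epsilon>'"
    using comm by (simp_all add: u'_def \<theta>_def K_def algebra_simps assoc_eq[OF comm(1)] assoc_eq[OF comm(2)])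
  \<comment> \<open>What the base change \<open>T\<close> below leaves of
    \<open>\<delta> * \<epsilon>\<close>. As \<open>\<epsilon>\<close> squares to zero and commutes
    with \<open>h\<close> and \<open>\<Phi>\<close>, the inverse \<open>v\<close> of
    \<open>1 + h * X\<close> stops after the linear term.\<close>
  define X where "X = - 2 * \<Phi> * \<epsilon>"
  define v where "v = 1 + 2 * h * \<Phi> * \<epsilon>"
  have X: "X * d = - (d * X)" "X * X = 0"
  proof -
    have "\<Phi> * \<epsilon> * d = - (d * (\<Phi> * \<epsilon>))" "\<Phi> * \<epsilon> * (\<Phi> * \<epsilon>) = 0"
      using comm(1)[of d] comm(1)[of \<Phi>] by (simp_all add: mult.assoc assoc_eq[OF anti] assoc_eq[OF \<Phi>\<Phi>])
        (simp_all add: anti \<Phi>\<Phi> flip: mult.assoc)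
    then show "X * d = - (d * X)" "X * X = 0"
      by (simp_all add: X_def mult_2 algebra_simps)
  qed
  have hX: "h * X = - 2 * h * \<Phi> * \<epsilon>" by (simp add: X_def mult_2 algebra_simps)
  have nil: "h * \<Phi> * \<epsilon> * (h * \<Phi> * \<epsilon>) = 0"
    by (simp add: mult.assoc comm assoc_eq[OF comm(1)] \<epsilon>)
  have v: "v * (1 + h * X) = 1" "(1 + h * X) * v = 1"
    using nil by (simp_all add: v_def hX mult_2 algebra_simps)
  define v' where "v' = 1 - X * v * h"
  note pert2 = perturbation[OF X ret(1-3) v]
  have PXvP: "P * X * v * P = - 2 * \<theta> * \<epsilon>"
  proof -
    have "\<Phi> * \<epsilon> * (h * \<Phi> * \<epsilon>) = 0" by (simp add: mult.assoc comm assoc_eq[OF comm(1)] \<epsilon>)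
    then have "X * v = X" by (simp add: X_def v_def mult_2 algebra_simps)
    then have "P * X * v * P = P * X * P" by (simp add: mult.assoc)
    then show ?thesis by (simp add: X_def \<theta>_def mult_2 algebra_simps comm)
  qed
  define Z where "Z = d + X"
  have ZvP: "Z * v * P = v * (- 2 * \<theta> * \<epsilon>)" using pert2(1) PXvP by (simp add: Z_def mult.assoc)
  have PvZ: "P * v' * Z = - 2 * \<theta> * \<epsilon> * v'" using pert2(2) unfolding PXvP by (simp add: Z_def v'_def)
  have Zhom: "1 - v * P * v' = Z * (v * h) + v * h * Z" using pert2(3) by (simp add: Z_def v'_def)
  \<comment> \<open>\<open>\<epsilon>' * \<epsilon>\<close> and
    \<open>\<epsilon> * \<epsilon>'\<close> project to the source and the target of
    \<open>\<epsilon>\<close>. In the source \<open>e1\<close> selects a complement of the kernel of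
    \<open>\<theta>\<close>, in the target the image; between these the differential is minus twice
    an isomorphism inverted by \<open>K\<close>, whence \<open>k1\<close>.\<close>
  define e1 where "e1 = K * \<theta> * \<epsilon>' * \<epsilon> + \<theta> * K * \<epsilon> * \<epsilon>'"
  define P1 where "P1 = P - e1"
  define k1 where "k1 = - K * \<epsilon>'"
  have \<epsilon>\<epsilon>'\<epsilon>: "\<epsilon> * \<epsilon>' * \<epsilon> = \<epsilon>"
    using arg_cong[OF \<epsilon>(2), of "\<lambda>x. x * \<epsilon>"] \<epsilon>(1) by (simp add: distrib_right mult.assoc)
  have Pe1: "P * e1 = e1" "e1 * P = e1"
    using comm by (simp_all add: e1_def algebra_simps assoc_eq[OF PK(1)] assoc_eq[OF P\<theta>(1)]
        assoc_eq[OF comm(1)] assoc_eq[OF comm(2)] PK P\<theta>)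
      (simp_all add: P\<theta> PK flip: mult.assoc)
  have PP1: "P * P1 = P1" "P1 * P = P1" by (simp_all add: P1_def algebra_simps Pe1 ret(4))
  have Pk1: "P * k1 = k1" "k1 * P = k1"
    using comm by (simp_all add: k1_def assoc_eq[OF PK(1)] PK mult.assoc) (simp add: PK flip: mult.assoc)
  have "\<theta> * \<epsilon> * e1 = \<theta> * K * \<theta> * (\<epsilon> * \<epsilon>' * \<epsilon>) + \<theta> * \<theta> * K * (\<epsilon> * \<epsilon>) * \<epsilon>'"
    by (simp add: e1_def distrib_left mult.assoc assoc_eq[OF c\<epsilon>(2)] assoc_eq[OF c\<epsilon>(3)])
  then have \<theta>e: "\<theta> * \<epsilon> * e1 = \<theta> * \<epsilon>" unfolding \<theta>K\<theta> \<epsilon>\<epsilon>'\<epsilon> \<epsilon>(1) by simp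
  have "e1 * (\<theta> * \<epsilon>) = K * (\<theta> * \<theta>) * \<epsilon>' * (\<epsilon> * \<epsilon>) + \<theta> * K * \<theta> * (\<epsilon> * \<epsilon>' * \<epsilon>)"
    by (simp add: e1_def distrib_right mult.assoc assoc_eq[OF c\<epsilon>(2)] assoc_eq[OF c\<epsilon>'(1)])
  then have e\<theta>: "e1 * (\<theta> * \<epsilon>) = \<theta> * \<epsilon>" unfolding \<theta>K\<theta> \<epsilon>\<epsilon>'\<epsilon> \<epsilon>(1) by simp
  have P\<theta>\<epsilon>: "P * (\<theta> * \<epsilon>) = \<theta> * \<epsilon>" "\<theta> * \<epsilon> * P = \<theta> * \<epsilon>"
    using comm(1)[of P] by (simp_all add: mult.assoc) (simp_all add: P\<theta> flip: mult.assoc)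
  have \<theta>P1: "\<theta> * \<epsilon> * P1 = 0" "P1 * (\<theta> * \<epsilon>) = 0"
    by (simp_all only: P1_def right_diff_distrib left_diff_distrib P\<theta>\<epsilon> \<theta>e e\<theta> diff_self)
  have k1: "- 2 * \<theta> * \<epsilon> * k1 + k1 * (- 2 * \<theta> * \<epsilon>) = 2 * e1"
  proof -
    have "\<theta> * \<epsilon> * k1 + k1 * (\<theta> * \<epsilon>) = - e1"
      by (simp add: k1_def e1_def mult.assoc assoc_eq[OF c\<epsilon>(3)] assoc_eq[OF c\<epsilon>'(1)])
    then have "- 2 * (\<theta> * \<epsilon> * k1 + k1 * (\<theta> * \<epsilon>)) = 2 * e1" by simp
    then show ?thesis by (simp add: mult_2 algebra_simps)
  qed
  \<comment> \<open>Unipotent base change along \<open>\<nu>\<close>: conjugation subtracts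
    \<open>d * \<nu> - \<nu> * d\<close> from \<open>\<delta>\<close>, which leaves
    \<open>- 2 * \<Phi>\<close>.\<close>
  define T where "T = 1 + \<nu> * \<epsilon>"
  define T' where "T' = 1 - \<nu> * \<epsilon>"
  have "\<nu> * \<epsilon> * (\<nu> * \<epsilon>) = 0" by (simp add: mult.assoc comm assoc_eq[OF comm(1)] \<epsilon>)
  then have T: "T * T' = 1" "T' * T = 1" by (simp_all add: T_def T'_def algebra_simps)
  have "T * (d + \<delta> * \<epsilon>) * T' = d + (\<delta> - (d * \<nu> - \<nu> * d)) * \<epsilon>"
    by (simp add: T_def T'_def algebra_simps comm assoc_eq[OF comm(1)] \<epsilon> assoc_eq[OF \<epsilon>(1)])
  also have "\<dots> = Z" unfolding \<nu> by (simp add: Z_def X_def algebra_simps)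
  finally have "T' * (T * (d + \<delta> * \<epsilon>) * T') * T = T' * Z * T" by simp
  then have dC: "d + \<delta> * \<epsilon> = T' * Z * T"
    using T by (simp add: mult.assoc) (simp add: T flip: mult.assoc)
  define C where "C = (\<lambda>Y. T' * Y * T)"
  have C: "C x * C y = C (x * y)" "C x + C y = C (x + y)" "C 1 = 1" "C 0 = 0" "C (2 * x) = 2 * C x" for x y
    using T assoc_eq[OF T(1)] by (simp_all add: C_def mult.assoc algebra_simps mult_2)
  have dC: "d + \<delta> * \<epsilon> = C Z" by (simp add: C_def dC)
  have ev: "\<kappa> * u' = u' * \<kappa>" "\<kappa> * \<theta> = - (\<theta> * \<kappa>)" "\<kappa> * K = - (K * \<kappa>)"
    "\<kappa> * X = - (X * \<kappa>)" "\<kappa> * v = v * \<kappa>" "\<kappa> * v' = v' * \<kappa>" "\<kappa> * T = T * \<kappa>" "\<kappa> * T' = T' * \<kappa>"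
    "\<kappa> * e1 = e1 * \<kappa>" "\<kappa> * P1 = P1 * \<kappa>" "\<kappa> * k1 = - (k1 * \<kappa>)"
    using even odd assoc_eq[OF even] assoc_eq[OF odd]
    by (simp_all add: u'_def \<theta>_def K_def X_def v_def v'_def T_def T'_def e1_def P1_def k1_def
        algebra_simps mult_2)
  show ?thesis unfolding torsion_split_def
  proof (intro exI conjI)
    have "Z * (v * h) + v * h * Z + v * (P1 + e1) * v' = 1"
      unfolding Zhom[symmetric] P1_def by simp
    then have "C (Z * (v * h) + v * h * Z + v * (P1 + e1) * v') = C 1" by simp
    then have "C Z * C (v * h) + C (v * h) * C Z + (C (v * P1 * v') + C (v * e1 * v')) = 1"
      unfolding C(1) C(2) C(3) by (simp only: distrib_left distrib_right)
    then show "1 = C (v * P1 * v') + C (v * e1 * v') + (d + \<delta> * \<epsilon>) * C (v * h) + C (v * h) * (d + \<delta> * \<epsilon>)"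
      unfolding dC by (simp add: ac_simps)
    have ZvY: "Z * (v * Y * v') = v * (- 2 * \<theta> * \<epsilon> * Y) * v'" if "P * Y = Y" for Y
    proof -
      have "Z * (v * Y * v') = Z * v * P * Y * v'" using that by (simp add: mult.assoc)
      then show ?thesis unfolding ZvP by (simp add: mult.assoc)
    qed
    have YvZ: "v * Y * v' * Z = v * (Y * (- 2 * \<theta> * \<epsilon>)) * v'" if "Y * P = Y" for Y
    proof -
      have "v * Y * v' * Z = v * Y * (P * v' * Z)" using that by (simp flip: mult.assoc) (simp add: mult.assoc)
      then show ?thesis unfolding PvZ by (simp add: mult.assoc)
    qed
    have "- 2 * \<theta> * \<epsilon> * P1 = - 2 * (\<theta> * \<epsilon> * P1)" "P1 * (- 2 * \<theta> * \<epsilon>) = - (2 * (P1 * (\<theta> * \<epsilon>)))"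
      by (simp_all add: mult_2 algebra_simps)
    then have "- 2 * \<theta> * \<epsilon> * P1 = 0" "P1 * (- 2 * \<theta> * \<epsilon>) = 0" by (simp_all only: \<theta>P1) simp_all
    then show "(d + \<delta> * \<epsilon>) * C (v * P1 * v') = 0" "C (v * P1 * v') * (d + \<delta> * \<epsilon>) = 0"
      unfolding dC C(1) ZvY[OF PP1(1)] YvZ[OF PP1(2)] by (simp_all add: C(4))
    have "2 * (v * e1 * v') = v * (2 * e1) * v'" by (simp add: mult_2 algebra_simps)
    then show "2 * C (v * e1 * v') = (d + \<delta> * \<epsilon>) * C (v * k1 * v') + C (v * k1 * v') * (d + \<delta> * \<epsilon>)"
      unfolding dC C(1) ZvY[OF Pk1(1)] YvZ[OF Pk1(2)] C(2) C(5)[symmetric]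
      by (simp only: k1[symmetric] distrib_left distrib_right)
    note ev' = ev even odd assoc_eq[OF ev(1)] assoc_eq[OF ev(5)] assoc_eq[OF ev(6)] assoc_eq[OF ev(7)]
      assoc_eq[OF ev(8)] assoc_eq[OF ev(9)] assoc_eq[OF ev(10)] assoc_eq[OF ev(11)] assoc_eq[OF odd]
    show "\<kappa> * C (v * P1 * v') = C (v * P1 * v') * \<kappa>" "\<kappa> * C (v * e1 * v') = C (v * e1 * v') * \<kappa>"
      "\<kappa> * C (v * h) = - (C (v * h) * \<kappa>)" "\<kappa> * C (v * k1 * v') = - (C (v * k1 * v') * \<kappa>)"
      using ev' by (simp_all add: C_def mult.assoc)
  qed
qed

section \<open>Retractions of two-step complexes\<close>

text \<open>\<open>e\<close> plays the part of the identity on the piece where the complex lives, so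
  that complexes on different blocks are compared within one ring. \<open>P\<close> may fail to be
  idempotent; \<open>retracts_idempotent\<close> repairs this once at the end.\<close>

definition retracts :: "'a::ring_1 \<Rightarrow> 'a \<Rightarrow> 'a \<Rightarrow> 'a \<Rightarrow> bool" where
  "retracts e d h P \<longleftrightarrow> e = P + d * h + h * d \<and> d * P = 0 \<and> P * d = 0 \<and>
     e * h = h \<and> h * e = h \<and> e * P = P \<and> P * e = P"

text \<open>The cone of \<open>g\<close> from the \<open>\<alpha>\<close> part to the
  \<open>\<beta>\<close> part. On homology \<open>g\<close> induces \<open>P' * g * P\<close>; when
  this vanishes the long exact sequence falls apart, and the triangular formulas glue the two
  retractions.\<close>

lemma retracts_extension:
  fixes d g :: "'a::ring_1"
  assumes g: "g * d = - (d * g)" "g * \<alpha> = \<beta> * g" "\<alpha> * g = 0" "g * \<beta> = 0"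
    and \<alpha>\<beta>: "\<alpha> * \<beta> = 0" "\<beta> * \<alpha> = 0"
    and a: "retracts \<alpha> d h P" and b: "retracts \<beta> d h' P'" and "P' * g * P = 0"
  shows "retracts (\<alpha> + \<beta>) (d + g) (h' + h - h' * g * h) (P' + P - P' * g * h - h' * g * P)"
proof -
  note a' = a[unfolded retracts_def] and b' = b[unfolded retracts_def]
  have hd: "h * d = \<alpha> - P - d * h" "h' * d = \<beta> - P' - d * h'" using a' b' by (simp_all add: algebra_simps)
  have c: "d * P = 0" "P * d = 0" "\<alpha> * h = h" "h * \<alpha> = h" "\<alpha> * P = P" "P * \<alpha> = P"
    "d * P' = 0" "P' * d = 0" "\<beta> * h' = h'" "h' * \<beta> = h'" "\<beta> * P' = P'" "P' * \<beta> = P'"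
    using a' b' by auto
  have z: "h * g = 0" "P * g = 0" "g * h' = 0" "g * P' = 0"
    by (metis c(4) g(3) mult.assoc mult_zero_right, metis c(6) g(3) mult.assoc mult_zero_right,
        metis c(9) g(4) mult.assoc mult_zero_left, metis c(11) g(4) mult.assoc mult_zero_left)
  have o: "\<alpha> * h' = 0" "\<alpha> * P' = 0" "h' * \<alpha> = 0" "P' * \<alpha> = 0" "\<beta> * h = 0" "\<beta> * P = 0" "h * \<beta> = 0" "P * \<beta> = 0"
    using c \<alpha>\<beta> by (metis mult.assoc mult_zero_left mult_zero_right)+
  have gh: "\<beta> * (g * h) = g * h" "\<beta> * (g * P) = g * P"
    using c g(2) by (metis mult.assoc)+
  have PgP: "P' * (g * P) = 0" using assms(9) by (simp add: mult.assoc)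
  have "d * h' = \<beta> - P' - h' * d" using b' by (simp add: algebra_simps)
  then have "d * (h' * (g * P)) = (\<beta> - P' - h' * d) * (g * P)" by (simp add: assoc_eq)
  then have dhgP: "d * (h' * (g * P)) = g * P"
    using gh PgP assoc_eq[OF g(1), of P] c(1)
    by (simp add: algebra_simps)
  note rel = c hd z o PgP g gh \<alpha>\<beta> dhgP
  note rel = rel c[THEN assoc_eq] hd[THEN assoc_eq] z[THEN assoc_eq] o[THEN assoc_eq] g[THEN assoc_eq]
  show ?thesis unfolding retracts_def
    by (intro conjI) (simp_all add: rel algebra_simps)
qed

text \<open>\<open>\<sigma>\<close> is a section of \<open>g\<close>, and \<open>\<xi>\<close>
  parametrises the kernel of \<open>g\<close> in the \<open>\<alpha>\<close> part, with left inverse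
  \<open>\<tau>\<close>. Gaussian elimination cancels the image of \<open>\<sigma>\<close> against
  \<open>\<beta>\<close>, so a shifted copy of the \<open>\<beta>\<close> complex, embedded by
  \<open>\<xi>\<close>, remains.\<close>

lemma retracts_bridge:
  fixes d g :: "'a::ring_1"
  assumes g: "g * d = - (d * g)" "g * \<alpha> = \<beta> * g" "\<alpha> * g = 0" "g * \<beta> = 0"
    and \<alpha>\<beta>: "\<alpha> * \<beta> = 0" "\<beta> * \<alpha> = 0" and d\<alpha>: "d * \<alpha> = \<alpha> * d" "d * \<beta> = \<beta> * d"
    and dd: "d * d = 0"
    and \<sigma>: "\<alpha> * \<sigma> = \<sigma>" "\<sigma> * \<beta> = \<sigma>" and \<xi>: "\<alpha> * \<xi> = \<xi>" "\<xi> * \<beta> = \<xi>" and \<tau>: "\<beta> * \<tau> = \<tau>" "\<tau> * \<alpha> = \<tau>"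
    and rel: "g * \<sigma> = \<beta>" "\<sigma> * g + \<xi> * \<tau> = \<alpha>" "\<tau> * \<xi> = \<beta>" "g * \<xi> = 0" "d * \<xi> = - (\<xi> * d)"
    and b: "retracts \<beta> d h P"
  shows "retracts (\<alpha> + \<beta>) (d + g) (\<sigma> - \<xi> * h * \<tau> + \<xi> * h * \<tau> * d * \<sigma>)
    (\<xi> * P * \<tau> - \<xi> * P * \<tau> * d * \<sigma>)"
proof -
  note b' = b[unfolded retracts_def]
  \<comment> \<open>The component of \<open>d\<close> from the image of \<open>\<sigma>\<close> to
    that of \<open>\<xi>\<close>, responsible for the correction terms.\<close>
  define \<kappa> where "\<kappa> = \<tau> * d * \<sigma>"
  have "d * \<sigma> = \<alpha> * d * \<sigma>" using \<sigma> d\<alpha> by (metis mult.assoc)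
  also have "\<dots> = \<sigma> * (g * d) * \<sigma> + \<xi> * \<kappa>" unfolding rel(2)[symmetric] by (simp add: \<kappa>_def algebra_simps)
  also have "\<sigma> * (g * d) * \<sigma> = - (\<sigma> * d * (g * \<sigma>))" unfolding g by (simp add: mult.assoc)
  also have "\<dots> = - (\<sigma> * d)" unfolding rel(1) using d\<alpha>(2) \<sigma>(2) by (metis mult.assoc)
  finally have d\<sigma>: "d * \<sigma> = \<xi> * \<kappa> - \<sigma> * d" by simp
  have "\<tau> * d = \<tau> * d * \<alpha>" using \<tau> d\<alpha> by (metis mult.assoc)
  also have "\<dots> = \<kappa> * g + \<tau> * (d * \<xi>) * \<tau>" unfolding rel(2)[symmetric] by (simp add: \<kappa>_def algebra_simps)
  also have "\<tau> * (d * \<xi>) * \<tau> = - (\<tau> * \<xi> * d * \<tau>)" unfolding rel(5) by (simp add: mult.assoc)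
  also have "\<dots> = - (d * \<tau>)" unfolding rel(3) using d\<alpha>(2) \<tau>(1) by (metis mult.assoc)
  finally have \<tau>d: "\<tau> * d = \<kappa> * g - d * \<tau>" by simp
  have \<kappa>\<beta>: "\<kappa> * \<beta> = \<kappa>" "\<beta> * \<kappa> = \<kappa>" unfolding \<kappa>_def using \<sigma> \<tau> by (simp_all add: mult.assoc) (simp add: mult.assoc[symmetric])
  have \<tau>g: "\<tau> * g = 0" using \<tau>(2) g(3) mult.assoc[of \<tau> \<alpha> g] by simp
  have "\<kappa> * d = \<tau> * d * (\<sigma> * d)" by (simp add: \<kappa>_def mult.assoc)
  also have "\<sigma> * d = \<xi> * \<kappa> - d * \<sigma>" using d\<sigma> by simp
  also have "\<tau> * d * (\<xi> * \<kappa> - d * \<sigma>) = \<tau> * (d * \<xi>) * \<kappa>" by (simp add: algebra_simps dd assoc_eq[OF dd])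
  also have "\<dots> = - (\<beta> * d * \<kappa>)" unfolding rel by (simp add: assoc_eq[OF rel(3)] mult.assoc)
  also have "\<dots> = - (d * \<kappa>)" using d\<alpha>(2) \<kappa>\<beta>(2) by (metis mult.assoc)
  finally have \<kappa>d: "\<kappa> * d = - (d * \<kappa>)" .
  have hd: "h * d = \<beta> - P - d * h" using b' by (simp add: algebra_simps)
  have c: "d * P = 0" "P * d = 0" "\<beta> * h = h" "h * \<beta> = h" "\<beta> * P = P" "P * \<beta> = P" using b' by auto
  have \<xi>\<tau>: "\<xi> * \<tau> = \<alpha> - \<sigma> * g" using rel(2) by (simp add: algebra_simps)
  have z: "\<xi> * \<alpha> = 0" "\<sigma> * \<alpha> = 0" "\<beta> * \<xi> = 0" "\<beta> * \<sigma> = 0" "\<tau> * \<beta> = 0" "\<kappa> * \<alpha> = 0"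
    using \<xi> \<sigma> \<tau> \<kappa>\<beta> \<alpha>\<beta> by (metis mult.assoc mult_zero_left mult_zero_right)+
  note r = c hd \<kappa>d \<tau>d d\<sigma> \<tau>g g(1) rel(1,3,4,5) \<xi> \<sigma> \<tau> \<kappa>\<beta> z
  note r = r c[THEN assoc_eq] hd[THEN assoc_eq] \<kappa>d[THEN assoc_eq] \<tau>d[THEN assoc_eq] d\<sigma>[THEN assoc_eq] \<tau>g[THEN assoc_eq]
    g(1)[THEN assoc_eq] rel(1,3,4,5)[THEN assoc_eq] \<xi>[THEN assoc_eq] \<sigma>[THEN assoc_eq] \<tau>[THEN assoc_eq]
    \<kappa>\<beta>[THEN assoc_eq] z[THEN assoc_eq]
  have "retracts (\<alpha> + \<beta>) (d + g) (\<sigma> - \<xi> * h * \<tau> + \<xi> * h * \<kappa>) (\<xi> * P * \<tau> - \<xi> * P * \<kappa>)"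
    unfolding retracts_def
    by (intro conjI) (simp_all add: r \<xi>\<tau> algebra_simps)
  then show ?thesis by (simp add: \<kappa>_def mult.assoc)
qed

text \<open>\<open>g\<close> is invertible with inverse \<open>\<sigma>\<close>, so its cone is
  contractible.\<close>

lemma retracts_loop:
  fixes d g :: "'a::ring_1"
  assumes "\<alpha> * \<beta> = 0" "\<beta> * \<alpha> = 0"
    and "\<alpha> * \<sigma> = \<sigma>" "\<sigma> * \<beta> = \<sigma>" "g * \<sigma> = \<beta>" "\<sigma> * g = \<alpha>" "d * \<sigma> = - (\<sigma> * d)"
  shows "retracts (\<alpha> + \<beta>) (d + g) \<sigma> 0"
proof -
  have "\<sigma> * \<alpha> = 0" "\<beta> * \<sigma> = 0" using assms by (metis mult.assoc mult_zero_left mult_zero_right)+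
  then show ?thesis unfolding retracts_def using assms by (simp add: algebra_simps)
qed

text \<open>\<open>d * h * P = P - P * P\<close> and \<open>P * d = 0\<close> give P^3 = P^2, so the
  square of \<open>P\<close> is idempotent. The difference is \<open>P * h * d\<close>, which the
  summand \<open>P * h\<close> of the new homotopy absorbs.\<close>

lemma retracts_idempotent:
  fixes d :: "'a::ring_1"
  assumes "retracts 1 d h P"
  shows "retracts 1 d (h + P * h) (P * P)" "P * P * (P * P) = P * P"
proof -
  note a = assms[unfolded retracts_def]
  have hd: "h * d = 1 - P - d * h" using a by (simp add: algebra_simps)
  have c: "d * P = 0" "P * d = 0" using a by auto
  have "P * (h * d) = P - P * P" unfolding hd by (simp add: algebra_simps assoc_eq[OF c(2)])
  then show "retracts 1 d (h + P * h) (P * P)" unfolding retracts_def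
    by (simp add: hd c assoc_eq[OF c(1)] assoc_eq[OF c(2)] distrib_left distrib_right mult.assoc)
  have "1 * P = (P + d * h + h * d) * P" using a by simp
  then have "(d * h + h * d) * P = P - P * P" by (simp add: algebra_simps)
  then have "d * h * P = P - P * P" by (simp add: distrib_right mult.assoc c)
  then have "P * (P - P * P) = 0" by (metis assoc_eq[OF c(2)] mult.assoc mult_zero_left)
  then have "P * P * P = P * P" by (simp add: algebra_simps)
  then show "P * P * (P * P) = P * P" by (simp flip: mult.assoc)
qed

section \<open>Saturated vertex sets\<close>

locale ends =
  fixes a b :: "nat \<Rightarrow> 'v"
begin

definition comp_of :: "nat set \<Rightarrow> 'v \<Rightarrow> 'v set" where
  "comp_of I v = {u. (v, u) \<in> (\<Union>r\<in>I. {(a r, b r), (b r, a r)})\<^sup>*}"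

text \<open>A labelling is encoded by the union of the components labelled x rather than by the set
  of these components: the same vertex set then makes sense at every \<open>I\<close> for which it
  is saturated, and adding an edge often leaves it unchanged.\<close>

definition sat :: "nat set \<Rightarrow> 'v set \<Rightarrow> bool" where
  "sat I U \<longleftrightarrow> (\<forall>r\<in>I. a r \<in> U \<longleftrightarrow> b r \<in> U)"

text \<open>For saturated \<open>U\<close> this is the polynomial grading.\<close>

definition deg :: "nat set \<Rightarrow> 'v set \<Rightarrow> nat" where
  "deg I U = card (comp_of I ` U)"

lemma sat_simps [simp]:
  "sat {} U" "sat I {}"
  "sat (insert r I) U \<longleftrightarrow> (a r \<in> U \<longleftrightarrow> b r \<in> U) \<and> sat I U"
  by (auto simp: sat_def)

lemma sat_mono: "sat J U \<Longrightarrow> I \<subseteq> J \<Longrightarrow> sat I U"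
  by (auto simp: sat_def)

lemma sat_Un: "sat I U \<Longrightarrow> sat I X \<Longrightarrow> sat I (U \<union> X)"
  and sat_Diff: "sat I U \<Longrightarrow> sat I X \<Longrightarrow> sat I (U - X)"
  and sat_union: "sat I U \<Longrightarrow> sat J U \<Longrightarrow> sat (I \<union> J) U"
  by (auto simp: sat_def)

lemma comp_self [simp]: "v \<in> comp_of I v"
  by (simp add: comp_of_def)

lemma comp_sat [simp]: "sat I (comp_of I v)"
  unfolding sat_def comp_of_def by (auto intro: rtrancl_into_rtrancl)

lemma comp_least:
  assumes "sat I U" "v \<in> U"
  shows "comp_of I v \<subseteq> U"
proof
  fix u assume "u \<in> comp_of I v"
  then have "(v, u) \<in> (\<Union>r\<in>I. {(a r, b r), (b r, a r)})\<^sup>*" by (simp add: comp_of_def)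
  then show "u \<in> U" by induction (use assms in \<open>auto simp: sat_def\<close>)
qed

lemma comp_eq: "u \<in> comp_of I v \<Longrightarrow> comp_of I u = comp_of I v"
proof -
  assume u: "u \<in> comp_of I v"
  have "sym (\<Union>r\<in>I. {(a r, b r), (b r, a r)})" by (auto simp: sym_def)
  then have "v \<in> comp_of I u" using u sym_rtrancl unfolding comp_of_def sym_def by blast
  then show ?thesis using u by (simp add: comp_least subset_antisym)
qed

lemma mem_comp: "u \<in> comp_of I v \<longleftrightarrow> comp_of I u = comp_of I v"
  using comp_eq comp_self by metis

lemma comp_image_comp [simp]: "comp_of I ` comp_of I v = {comp_of I v}"
proof -
  have "comp_of I ` comp_of I v = (\<lambda>_. comp_of I v) ` comp_of I v"
    by (rule image_cong) (simp_all add: mem_comp)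
  then show ?thesis using image_constant[of v "comp_of I v"] by simp
qed

lemma comp_disjoint: "u \<notin> comp_of I v \<Longrightarrow> comp_of I u \<inter> comp_of I v = {}"
  by (metis comp_eq comp_self disjoint_iff)

lemma sat_disjoint: "sat I U \<Longrightarrow> v \<notin> U \<Longrightarrow> comp_of I v \<inter> U = {}"
  using comp_least comp_eq comp_self by blast

lemma comp_mono: "I \<subseteq> J \<Longrightarrow> comp_of I v \<subseteq> comp_of J v"
  by (rule comp_least) (auto intro: sat_mono[OF comp_sat])

lemma comp_insert:
  "comp_of (insert r I) v = (if v \<in> comp_of I (a r) \<union> comp_of I (b r)
     then comp_of I (a r) \<union> comp_of I (b r) else comp_of I v)"
proof (rule subset_antisym)
  let ?W = "comp_of I (a r) \<union> comp_of I (b r)"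
  have W: "sat (insert r I) ?W" by (simp add: sat_Un)
  moreover have "sat (insert r I) (comp_of I v)" if "v \<notin> ?W"
  proof -
    have "a r \<notin> comp_of I v" "b r \<notin> comp_of I v" using that comp_eq comp_self by blast+
    then show ?thesis by simp
  qed
  ultimately show "comp_of (insert r I) v \<subseteq> (if v \<in> ?W then ?W else comp_of I v)"
    by (intro comp_least) auto
  have ab: "comp_of (insert r I) (a r) = comp_of (insert r I) (b r)"
    using comp_sat[of "insert r I" "a r", unfolded sat_def]
    by (intro comp_eq[symmetric]) simp
  have "?W \<subseteq> comp_of (insert r I) (a r)"
    using comp_mono[of I "insert r I" "a r"] comp_mono[of I "insert r I" "b r"] ab by auto
  then show "(if v \<in> ?W then ?W else comp_of I v) \<subseteq> comp_of (insert r I) v"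
    using comp_mono[of I "insert r I" v] comp_eq[of v "insert r I" "a r"] by auto
qed

lemma comp_insert_same: "b r \<in> comp_of I (a r) \<Longrightarrow> comp_of (insert r I) = comp_of I"
  using comp_eq comp_insert by (auto simp: fun_eq_iff)

lemma sat_insert_same: "b r \<in> comp_of I (a r) \<Longrightarrow> sat (insert r I) U \<longleftrightarrow> sat I U"
  by (metis comp_eq comp_least comp_self sat_simps(3) subsetD)

lemma deg_Diff:
  assumes "finite U" "sat I U" "v \<in> U"
  shows "deg I U = Suc (deg I (U - comp_of I v))"
proof -
  have "comp_of I ` U = insert (comp_of I v) (comp_of I ` (U - comp_of I v))"
    using assms comp_eq by auto
  moreover have "comp_of I v \<notin> comp_of I ` (U - comp_of I v)" using comp_self by blast
  ultimately show ?thesis using assms(1) by (simp add: deg_def)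
qed

lemma deg_cong: "(\<And>v. v \<in> U \<Longrightarrow> comp_of I v = comp_of J v) \<Longrightarrow> deg I U = deg J U"
  unfolding deg_def by (metis image_cong)

lemma deg_insert_out:
  assumes "sat I U" "a r \<notin> U" "b r \<notin> U"
  shows "deg (insert r I) U = deg I U"
proof (rule deg_cong)
  fix v assume "v \<in> U"
  then have "v \<notin> comp_of I (a r) \<union> comp_of I (b r)"
    using sat_disjoint[OF assms(1,2)] sat_disjoint[OF assms(1,3)] by blast
  then show "comp_of (insert r I) v = comp_of I v" by (simp add: comp_insert)
qed

text \<open>Both ends of r lie on the same side of \<open>U\<close>, so a component inside
  \<open>U\<close> is lost only if r joins two different ones there. This count gives the degrees of
  both \<open>dd\<close> and \<open>Phi\<close>.\<close>

lemma deg_insert: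
  assumes "finite U" "sat (insert r I) U"
  shows "deg I U = deg (insert r I) U + of_bool (a r \<in> U \<and> b r \<notin> comp_of I (a r))"
proof -
  consider "b r \<in> comp_of I (a r)" | "a r \<notin> U" | "a r \<in> U" "b r \<notin> comp_of I (a r)" by blast
  then show ?thesis
  proof cases
    case 1
    then show ?thesis by (simp add: deg_def comp_insert_same)
  next
    case 2
    then show ?thesis using assms deg_insert_out[of I U r] by simp
  next
    case 3
    let ?P = "comp_of I (a r)" and ?Q = "comp_of I (b r)"
    have b: "b r \<in> U - ?P" and sI: "sat I U" using 3 assms(2) by auto
    have W: "comp_of (insert r I) (a r) = ?P \<union> ?Q" by (simp add: comp_insert)
    have "deg (insert r I) U = Suc (deg (insert r I) (U - (?P \<union> ?Q)))"
      using deg_Diff[OF assms 3(1)] unfolding W .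
    also have "deg (insert r I) (U - (?P \<union> ?Q)) = deg I (U - (?P \<union> ?Q))"
      by (rule deg_insert_out) (auto intro!: sat_Diff sat_Un sI)
    finally have "deg (insert r I) U = Suc (deg I (U - (?P \<union> ?Q)))" .
    moreover have "deg I U = Suc (Suc (deg I (U - ?P - ?Q)))"
      using deg_Diff[OF assms(1) sI 3(1)] deg_Diff[of "U - ?P" I "b r"] b assms(1) sI by (simp add: sat_Diff)
    moreover have "U - ?P - ?Q = U - (?P \<union> ?Q)" by blast
    ultimately show ?thesis using 3 by simp
  qed
qed

end

section \<open>Signs of the cube\<close>

definition sg :: "nat \<Rightarrow> nat set \<Rightarrow> int" where
  "sg r I = (- 1) ^ card {l \<in> I. l < r}"

lemma sg_square [simp]: "sg r I * sg r I = 1"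
  by (simp add: sg_def flip: power_add)

lemma sg_square_left [simp]: "sg r I * (sg r I * x) = x"
  by (metis mult.assoc mult_1 sg_square)

lemma sg_insert [simp]: "sg r (insert r I) = sg r I" and sg_Diff [simp]: "sg r (I - {r}) = sg r I"
  unfolding sg_def by (auto intro!: arg_cong[of _ _ "\<lambda>S. (- 1) ^ card S"])

text \<open>Exactly one of the two indices is counted in the sign of the other, namely the smaller
  one, so the two orders of adding them differ by a sign.\<close>

lemma sg_swap:
  assumes "r \<noteq> s" "finite I" "r \<notin> I" "s \<notin> I"
  shows "sg r I * sg s (insert r I) = - (sg s I * sg r (insert s I))"
proof -
  have "{l \<in> insert x I. l < y} = (if x < y then insert x {l \<in> I. l < y} else {l \<in> I. l < y})" for x y
    by auto
  then have "sg y (insert x I) = (if x < y then - sg y I else sg y I)" if "x \<notin> I" for x y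
    using that assms(2) by (simp add: sg_def)
  then show ?thesis using assms by (cases "r < s") auto
qed

lemma sg_swap':
  assumes "r \<noteq> s" "finite I" "r \<notin> I" "s \<notin> I"
  shows "sg r I * sg s I = - (sg s (insert r I) * sg r (insert s I))"
proof -
  have "sg r I * sg s I = sg r I * sg s I * (sg s (insert r I) * sg s (insert r I))" by simp
  also have "\<dots> = (sg r I * sg s (insert r I)) * sg s I * sg s (insert r I)" by (simp only: ac_simps)
  also have "\<dots> = - (sg s (insert r I) * sg r (insert s I))"
    unfolding sg_swap[OF assms] by (simp add: ac_simps)
  finally show ?thesis .
qed

section \<open>The deformed differential\<close>

locale ugraph = ends a b for a b :: "nat \<Rightarrow> 'v" +
  fixes V :: "'v set" and E :: "nat set"
  assumes finite_V: "finite V" and finite_E: "finite E"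
    and ends_in: "r \<in> E \<Longrightarrow> a r \<in> V" "r \<in> E \<Longrightarrow> b r \<in> V"
begin

text \<open>
  A pair \<open>(I, U)\<close> stands for the generator at \<open>I\<close> with label \<open>x\<close> at the components contained in \<open>U\<close>
  and label \<open>1\<close> elsewhere; the components that meet \<open>W\<close> must be labelled \<open>1\<close>.
\<close>

definition valid :: "'v set \<Rightarrow> (nat set \<times> 'v set) set" where
  "valid W = {(I, U). I \<subseteq> E \<and> U \<subseteq> V - W \<and> sat I U}"

lemma validI: "I \<subseteq> E \<Longrightarrow> U \<subseteq> V - W \<Longrightarrow> sat I U \<Longrightarrow> (I, U) \<in> valid W"
  by (simp add: valid_def)

lemma validD:
  assumes "(I, U) \<in> valid W"
  shows "I \<subseteq> E" "U \<subseteq> V" "U \<inter> W = {}" "sat I U" "finite I" "finite U"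
  using assms finite_E finite_V unfolding valid_def by (auto intro: finite_subset)

lemma valid_mono: "(J, U) \<in> valid W \<Longrightarrow> I \<subseteq> J \<Longrightarrow> (I, U) \<in> valid W"
  by (auto simp: valid_def intro: sat_mono)

lemma valid_Diff: "(I, U) \<in> valid W \<Longrightarrow> sat I X \<Longrightarrow> (I, U - X) \<in> valid W"
  by (auto simp: valid_def intro: sat_Diff)

lemma finite_valid: "finite (valid W)"
  by (rule finite_subset[of _ "Pow E \<times> Pow V"]) (auto simp: valid_def finite_E finite_V)

lemma comp_subset_V: "I \<subseteq> E \<Longrightarrow> v \<in> V \<Longrightarrow> comp_of I v \<subseteq> V"
  by (rule comp_least) (use ends_in in \<open>auto simp: sat_def\<close>)

text \<open>An operator with this support has bidegree (-p, -q), because rows are targets: the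
  differential has p = -1 and q = 0.\<close>

definition grade :: "'v set \<Rightarrow> int \<Rightarrow> int \<Rightarrow> ((nat set \<times> 'v set) \<times> (nat set \<times> 'v set)) set" where
  "grade W p q = {((I, U), (J, X)). (I, U) \<in> valid W \<and> (J, X) \<in> valid W \<and>
     int (card J) = int (card I) + p \<and> int (deg J X) = int (deg I U) + q}"

lemma grade_relcomp: "grade W p q O grade W p' q' \<subseteq> grade W (p + p') (q + q')"
  by (auto simp: grade_def)

lemma reads_grade_mult:
  "reads X (grade W p q) \<Longrightarrow> reads Y (grade W p' q') \<Longrightarrow> reads (X * Y) (grade W (p + p') (q + q'))"
  by (erule (1) reads_mult) (rule grade_relcomp)

lemma reads_grade_valid:
  assumes "reads X (grade W p q)"
  shows "restr (valid W) * X = X" "X * restr (valid W) = X"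
  by (rule restr_mult_left restr_mult_right, rule reads_mono[OF assms], auto simp: grade_def)+

text \<open>The parameter \<open>A\<close> of active edges allows the same construction to serve for
  the full differential, for a block of free edges and for a single edge.\<close>

definition edge_op :: "'v set \<Rightarrow> (nat \<Rightarrow> nat set \<Rightarrow> ('v set \<Rightarrow> int) \<Rightarrow> 'v set \<Rightarrow> int) \<Rightarrow> nat set \<Rightarrow>
    (nat set \<times> 'v set) endo" where
  "edge_op W L A = Endo (\<lambda>c (J, U). if (J, U) \<in> valid W
     then \<Sum>r\<in>J \<inter> A. sg r J * L r (J - {r}) (\<lambda>X. c (J - {r}, X)) U else 0)"

text \<open>
  The coefficients at a generator after adding the edge \<open>r\<close>: \<open>pull\<close> comes from \<open>1 \<cdot> x = x \<cdot> 1 = x\<close>, and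
  \<open>squash\<close> from the additional term in \<open>x \<cdot> x = x\<close>.
\<close>

definition pull :: "nat \<Rightarrow> nat set \<Rightarrow> ('v set \<Rightarrow> int) \<Rightarrow> 'v set \<Rightarrow> int" where
  "pull r I f U = (if a r \<in> U \<and> b r \<notin> comp_of I (a r)
     then f (U - comp_of I (a r)) + f (U - comp_of I (b r)) else f U)"

definition squash :: "nat \<Rightarrow> nat set \<Rightarrow> ('v set \<Rightarrow> int) \<Rightarrow> 'v set \<Rightarrow> int" where
  "squash r I f U = (if a r \<in> U \<and> b r \<notin> comp_of I (a r) then f U else 0)"

definition lin :: "(nat \<Rightarrow> nat set \<Rightarrow> ('v set \<Rightarrow> int) \<Rightarrow> 'v set \<Rightarrow> int) \<Rightarrow> bool" where
  "lin L \<longleftrightarrow> (\<forall>r I k f g U. L r I (\<lambda>X. k * f X + g X) U = k * L r I f U + L r I g U)"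

lemma lin_pull [simp]: "lin pull"
  and lin_squash [simp]: "lin squash"
  and lin_id [simp]: "lin (\<lambda>r I f. f)"
  by (simp_all add: lin_def pull_def squash_def distrib_left)

lemma app_edge_op:
  assumes "lin L"
  shows "app (edge_op W L A) c (J, U) = (if (J, U) \<in> valid W
     then \<Sum>r\<in>J \<inter> A. sg r J * L r (J - {r}) (\<lambda>X. c (J - {r}, X)) U else 0)"
  unfolding edge_op_def
  by (subst app_Endo)
    (use assms in \<open>auto simp: lin_def sum.distrib sum_distrib_left algebra_simps split: prod.split\<close>)

lemma edge_op_Un:
  assumes "lin L" "A \<inter> B = {}"
  shows "edge_op W L (A \<union> B) = edge_op W L A + edge_op W L B"
proof (rule endo_eqI)
  fix c and i :: "nat set \<times> 'v set"
  obtain J U where i: "i = (J, U)" by (cases i)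
  show "app (edge_op W L (A \<union> B)) c i = app (edge_op W L A + edge_op W L B) c i"
  proof (cases "(J, U) \<in> valid W")
    case True
    from assms(2) have "J \<inter> A \<inter> (J \<inter> B) = {}" by auto
    then show ?thesis using True validD(5)[OF True] assms(1)
      by (simp add: i app_edge_op Int_Un_distrib sum.union_disjoint)
  qed (simp add: i app_edge_op assms(1))
qed

lemma reads_edge_op:
  assumes "lin L"
    and loc: "\<And>r I f f' U. r \<notin> I \<Longrightarrow> r \<in> A \<Longrightarrow> (insert r I, U) \<in> valid W \<Longrightarrow>
      (\<And>X. (I, X) \<in> valid W \<Longrightarrow> int (deg I X) = int (deg (insert r I) U) + q \<Longrightarrow> f X = f' X) \<Longrightarrow>
      L r I f U = L r I f' U"
  shows "reads (edge_op W L A) (grade W (- 1) q)"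
  unfolding reads_def
proof (intro allI impI)
  fix s and c c' :: "nat set \<times> 'v set \<Rightarrow> int"
  assume eq: "\<forall>t. (s, t) \<in> grade W (- 1) q \<longrightarrow> c t = c' t"
  obtain J U where s: "s = (J, U)" by (cases s)
  show "app (edge_op W L A) c s = app (edge_op W L A) c' s"
  proof (cases "(J, U) \<in> valid W")
    case True
    have "L r (J - {r}) (\<lambda>X. c (J - {r}, X)) U = L r (J - {r}) (\<lambda>X. c' (J - {r}, X)) U" if r: "r \<in> J \<inter> A" for r
    proof (rule loc)
      show "(insert r (J - {r}), U) \<in> valid W" using True r by (simp add: insert_absorb)
    next
      fix X assume "(J - {r}, X) \<in> valid W" "int (deg (J - {r}) X) = int (deg (insert r (J - {r})) U) + q"
      then show "c (J - {r}, X) = c' (J - {r}, X)"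
        using True r validD(5)[OF True] card.remove[of J r]
        by (intro eq[rule_format]) (auto simp: s grade_def insert_absorb)
    qed (use r in auto)
    then show ?thesis by (simp add: s app_edge_op assms(1))
  qed (simp add: s app_edge_op assms(1))
qed

section \<open>The differential and its deformation\<close>

definition dd :: "'v set \<Rightarrow> nat set \<Rightarrow> (nat set \<times> 'v set) endo" where
  "dd W A = edge_op W pull A"

definition Phi :: "'v set \<Rightarrow> nat set \<Rightarrow> (nat set \<times> 'v set) endo" where
  "Phi W A = edge_op W squash A"

lemmas app_dd = app_edge_op[OF lin_pull, folded dd_def]
lemmas app_Phi = app_edge_op[OF lin_squash, folded Phi_def]

lemma reads_dd: "reads (dd W A) (grade W (- 1) 0)"
  unfolding dd_def
proof (rule reads_edge_op[OF lin_pull])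
  fix r I U and f f' :: "'v set \<Rightarrow> int"
  assume v: "(insert r I, U) \<in> valid W"
    and eq: "\<And>X. (I, X) \<in> valid W \<Longrightarrow> int (deg I X) = int (deg (insert r I) U) + 0 \<Longrightarrow> f X = f' X"
  note vD = validD[OF v]
  have vI: "(I, U) \<in> valid W" using v by (rule valid_mono) auto
  note d = deg_insert[OF vD(6,4)]
  show "pull r I f U = pull r I f' U"
  proof (cases "a r \<in> U \<and> b r \<notin> comp_of I (a r)")
    case True
    have "b r \<in> U" using True vD(4) by simp
    have "f (U - comp_of I v) = f' (U - comp_of I v)" if "v \<in> U" for v
      using d True deg_Diff[OF vD(6) validD(4)[OF vI] that] by (intro eq valid_Diff vI) auto
    then show ?thesis using True \<open>b r \<in> U\<close> by (simp add: pull_def)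
  next
    case False
    then have "f U = f' U" using d by (intro eq vI) auto
    then show ?thesis using False by (auto simp: pull_def)
  qed
qed

lemma reads_Phi: "reads (Phi W A) (grade W (- 1) 1)"
  unfolding Phi_def
proof (rule reads_edge_op[OF lin_squash])
  fix r I U and f f' :: "'v set \<Rightarrow> int"
  assume v: "(insert r I, U) \<in> valid W"
    and eq: "\<And>X. (I, X) \<in> valid W \<Longrightarrow> int (deg I X) = int (deg (insert r I) U) + 1 \<Longrightarrow> f X = f' X"
  note vD = validD[OF v]
  have vI: "(I, U) \<in> valid W" using v by (rule valid_mono) auto
  show "squash r I f U = squash r I f' U"
    using deg_insert[OF vD(6,4)] by (auto simp: squash_def intro!: eq vI)
qed

text \<open>
  An element of \<open>\<int>[x]/(x\<^sup>2 - x)\<close> is a function of \<open>x \<in> {0, 1}\<close>.  This expands the monomials as functions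
  of the set \<open>F\<close> where \<open>x = 1\<close>, and the deformed differential becomes restriction of functions.
\<close>

definition zeta :: "'v set \<Rightarrow> (nat set \<times> 'v set) endo" where
  "zeta W = Endo (\<lambda>c (I, F). if (I, F) \<in> valid W
     then \<Sum>X | X \<subseteq> F \<and> sat I X. c (I, X) else c (I, F))"

lemma app_zeta: "app (zeta W) c (I, F) = (if (I, F) \<in> valid W
     then \<Sum>X | X \<subseteq> F \<and> sat I X. c (I, X) else c (I, F))"
  unfolding zeta_def
  by (subst app_Endo) (auto simp: sum.distrib sum_distrib_left split: prod.split)

text \<open>\<open>zeta\<close> is unitriangular for inclusion: \<open>zeta W - 1\<close> passes to
  proper subsets, and chains of these in \<open>V\<close> have bounded length. The last property
  makes the inverse inherit whatever commutes with \<open>zeta\<close>.\<close>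

lemma zeta_inverse:
  obtains u where "u * zeta W = 1" "zeta W * u = 1" "\<forall>Y. zeta W * Y = Y * zeta W \<longrightarrow> u * Y = Y * u"
proof -
  define n where "n = zeta W - 1"
  have app_n: "app n c (I, F) = (if (I, F) \<in> valid W then \<Sum>X | X \<subset> F \<and> sat I X. c (I, X) else 0)" for c I F
  proof (cases "(I, F) \<in> valid W")
    case True
    note v = validD[OF True]
    have "{X. X \<subseteq> F \<and> sat I X} = insert F {X. X \<subset> F \<and> sat I X}" using v(4) by auto
    moreover have "finite {X. X \<subset> F \<and> sat I X}" using v(6) by (auto intro: finite_subset[of _ "Pow F"])
    ultimately show ?thesis using True by (simp add: n_def app_zeta)
  qed (simp add: n_def app_zeta)
  have n_pow: "reads (n ^ k) {((I, F), (J, X)). finite F \<longrightarrow> card X + k \<le> card F}" for k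
  proof (induction k)
    case 0
    show ?case by (auto intro: reads_1)
  next
    case (Suc k)
    have "reads n {((I, F), (J, X)). finite F \<and> X \<subset> F}"
      unfolding reads_def
    proof (intro allI impI)
      fix s :: "nat set \<times> 'v set" and c c' :: "nat set \<times> 'v set \<Rightarrow> int"
      assume eq: "\<forall>t. (s, t) \<in> {((I, F), (J, X)). finite F \<and> X \<subset> F} \<longrightarrow> c t = c' t"
      obtain I F where s: "s = (I, F)" by (cases s)
      show "app n c s = app n c' s"
        using eq validD(6)[of I F W] unfolding s app_n by (auto intro!: sum.cong)
    qed
    then have "reads (n * n ^ k) {((I, F), (J, X)). finite F \<longrightarrow> card X + Suc k \<le> card F}"
    proof (rule reads_mult[OF _ Suc], intro subrelI)
      fix s t :: "nat set \<times> 'v set"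
      assume "(s, t) \<in> {((I, F), (J, X)). finite F \<and> X \<subset> F} O
        {((I, F), (J, X)). finite F \<longrightarrow> card X + k \<le> card F}"
      then obtain X where *: "X \<subset> snd s" "finite X \<longrightarrow> card (snd t) + k \<le> card X" "finite (snd s)"
        unfolding relcomp_unfold by (auto simp: case_prod_unfold)
      then have "finite X" "card X < card (snd s)" by (auto intro: finite_subset psubset_card_mono)
      with * show "(s, t) \<in> {((I, F), (J, X)). finite F \<longrightarrow> card X + Suc k \<le> card F}"
        by (auto simp: case_prod_unfold)
    qed
    then show ?case by simp
  qed
  \<comment> \<open>A proper subset of a subset of \<open>V\<close> has fewer than
    \<open>card V\<close> elements, so after one factor the remaining \<open>card V\<close> factors
    cannot all pass to smaller sets.\<close>
  have "n * n ^ card V = 0"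
  proof (rule endo_eqI)
    fix c and i :: "nat set \<times> 'v set"
    obtain I F where i: "i = (I, F)" by (cases i)
    have "app (n ^ card V) c (I, X) = 0" if "X \<subset> F" "(I, F) \<in> valid W" for X
    proof (rule reads_zeroD[OF n_pow])
      fix t :: "nat set \<times> 'v set" assume t: "((I, X), t) \<in> {((I, F), (J, X)). finite F \<longrightarrow> card X + card V \<le> card F}"
      have "finite X" "card X < card V"
        using that(1) validD(2)[OF that(2)] finite_subset[OF _ finite_V, of X]
          psubset_card_mono[OF finite_V, of X] by blast+
      then show "c t = 0" using t by auto
    qed
    then show "app (n * n ^ card V) c i = app 0 c i" by (simp add: i app_n)
  qed
  then have "n ^ Suc (card V) = 0" by simp
  then obtain u where u: "(1 + n) * u = 1" "u * (1 + n) = 1" by (rule nilpotent_inverse)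
  have "1 + n = zeta W" by (simp add: n_def)
  note u = u[unfolded this]
  show thesis
  proof (rule that[OF u(2,1)], intro allI impI)
    fix Y assume "zeta W * Y = Y * zeta W"
    then have "u * (zeta W * Y) * u = u * (Y * zeta W) * u" by simp
    then have "(u * zeta W) * Y * u = u * Y * (zeta W * u)" by (simp only: mult.assoc)
    then show "u * Y = Y * u" by (simp add: u)
  qed
qed

text \<open>Multiplication in the split algebra restricts a function of two variables to the
  diagonal. Combinatorially, the sets X are sorted by which ends of r they contain: exactly one end
  matches the two summands of \<open>pull\<close>, both ends match \<open>squash\<close>, no end
  matches the unchanged coefficient.\<close>

lemma zeta_local:
  assumes "finite F" "sat (insert r I) F"
  shows "(\<Sum>U | U \<subseteq> F \<and> sat (insert r I) U. pull r I f U + squash r I f U) = (\<Sum>X | X \<subseteq> F \<and> sat I X. f X)"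
proof (cases "b r \<in> comp_of I (a r)")
  case True
  then show ?thesis by (simp add: sat_insert_same pull_def squash_def del: sat_simps)
next
  case False
  let ?P = "comp_of I (a r)" and ?Q = "comp_of I (b r)"
  have PQ: "?P \<inter> ?Q = {}" using False comp_disjoint by blast
  have aQ: "a r \<notin> ?Q" using PQ comp_self[of "a r" I] by blast
  define S where "S A B = {X. X \<subseteq> F \<and> sat I X \<and> (a r \<in> X \<longleftrightarrow> A) \<and> (b r \<in> X \<longleftrightarrow> B)}" for A B
  have finS: "finite (S A B)" for A B using assms(1) by (simp add: S_def)
  have J: "{U. U \<subseteq> F \<and> sat (insert r I) U} = S True True \<union> S False False" by (auto simp: S_def)
  have all: "{X. X \<subseteq> F \<and> sat I X} = S True True \<union> S False False \<union> (S True False \<union> S False True)"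
    by (auto simp: S_def)
  have disj: "S True True \<inter> S False False = {}" "S True False \<inter> S False True = {}"
    "(S True True \<union> S False False) \<inter> (S True False \<union> S False True) = {}" by (auto simp: S_def)
  have F: "?Q \<subseteq> F" if "a r \<in> X" "X \<subseteq> F" for X
    using that assms(2) by (intro comp_least) auto
  have F': "?P \<subseteq> F" if "b r \<in> X" "X \<subseteq> F" for X
    using that assms(2) by (intro comp_least) auto
  have 1: "(\<Sum>U\<in>S True True. f (U - ?Q)) = (\<Sum>X\<in>S True False. f X)"
  proof (rule sum.reindex_bij_witness[of _ "\<lambda>X. X \<union> ?Q" "\<lambda>U. U - ?Q"])
    fix U assume U: "U \<in> S True True"
    then have "?Q \<subseteq> U" by (intro comp_least) (auto simp: S_def)
    then show "U - ?Q \<union> ?Q = U" by auto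
    show "U - ?Q \<in> S True False" using U False aQ by (auto simp: S_def sat_Diff)
  next
    fix X assume X: "X \<in> S True False"
    then have "?Q \<inter> X = {}" by (intro sat_disjoint) (auto simp: S_def)
    then show "X \<union> ?Q - ?Q = X" by auto
    show "X \<union> ?Q \<in> S True True" using X F[of X] by (auto simp: S_def sat_Un)
  qed simp
  have 2: "(\<Sum>U\<in>S True True. f (U - ?P)) = (\<Sum>X\<in>S False True. f X)"
  proof (rule sum.reindex_bij_witness[of _ "\<lambda>X. X \<union> ?P" "\<lambda>U. U - ?P"])
    fix U assume U: "U \<in> S True True"
    then have "?P \<subseteq> U" by (intro comp_least) (auto simp: S_def)
    then show "U - ?P \<union> ?P = U" by auto
    show "U - ?P \<in> S False True" using U False aQ by (auto simp: S_def sat_Diff)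
  next
    fix X assume X: "X \<in> S False True"
    then have "?P \<inter> X = {}" by (intro sat_disjoint) (auto simp: S_def)
    then show "X \<union> ?P - ?P = X" by auto
    show "X \<union> ?P \<in> S True True" using X F'[of X] by (auto simp: S_def sat_Un)
  qed simp
  have "(\<Sum>U\<in>S True True. pull r I f U + squash r I f U) =
      (\<Sum>U\<in>S True True. f (U - ?P) + f (U - ?Q) + f U)"
    using False by (intro sum.cong) (auto simp: S_def pull_def squash_def)
  moreover have "(\<Sum>U\<in>S False False. pull r I f U + squash r I f U) = (\<Sum>U\<in>S False False. f U)"
    by (intro sum.cong) (auto simp: S_def pull_def squash_def)
  ultimately show ?thesis
    unfolding J all using disj finS by (simp add: sum.union_disjoint sum.distrib 1 2)
qed

lemma zeta_deform:
  "zeta W * (dd W A + Phi W A) = edge_op W (\<lambda>r I f. f) A * zeta W"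
proof (rule endo_eqI)
  fix c and i :: "nat set \<times> 'v set"
  obtain J F where i: "i = (J, F)" by (cases i)
  show "app (zeta W * (dd W A + Phi W A)) c i = app (edge_op W (\<lambda>r I f. f) A * zeta W) c i"
  proof (cases "(J, F) \<in> valid W")
    case True
    note v = validD[OF True]
    have vX: "(J, X) \<in> valid W" if "X \<subseteq> F" "sat J X" for X
      using True that by (auto simp: valid_def)
    have "app (zeta W * (dd W A + Phi W A)) c i = (\<Sum>X | X \<subseteq> F \<and> sat J X. \<Sum>r\<in>J \<inter> A.
        sg r J * (pull r (J - {r}) (\<lambda>X. c (J - {r}, X)) X + squash r (J - {r}) (\<lambda>X. c (J - {r}, X)) X))"
      using True vX by (auto simp: i app_zeta app_dd app_Phi sum.distrib distrib_left intro!: sum.cong)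
    also have "\<dots> = (\<Sum>r\<in>J \<inter> A. sg r J * (\<Sum>X | X \<subseteq> F \<and> sat J X.
        pull r (J - {r}) (\<lambda>X. c (J - {r}, X)) X + squash r (J - {r}) (\<lambda>X. c (J - {r}, X)) X))"
      by (subst sum.swap) (simp add: sum_distrib_left)
    also have "\<dots> = (\<Sum>r\<in>J \<inter> A. sg r J * (\<Sum>X | X \<subseteq> F \<and> sat (J - {r}) X. c (J - {r}, X)))"
    proof (rule sum.cong[OF refl])
      fix r assume "r \<in> J \<inter> A"
      then have "insert r (J - {r}) = J" by auto
      then show "sg r J * (\<Sum>X | X \<subseteq> F \<and> sat J X. pull r (J - {r}) (\<lambda>X. c (J - {r}, X)) X +
          squash r (J - {r}) (\<lambda>X. c (J - {r}, X)) X) =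
        sg r J * (\<Sum>X | X \<subseteq> F \<and> sat (J - {r}) X. c (J - {r}, X))"
        using zeta_local[of F r "J - {r}" "\<lambda>X. c (J - {r}, X)"] v(4,6) by (simp del: sat_simps)
    qed
    also have "\<dots> = app (edge_op W (\<lambda>r I f. f) A * zeta W) c i"
      using True valid_mono[OF True] by (auto simp: i app_edge_op app_zeta intro!: sum.cong)
    finally show ?thesis .
  qed (simp add: i app_zeta app_edge_op app_dd app_Phi)
qed

lemma restriction_anticomm:
  "edge_op W (\<lambda>r I f. f) A * edge_op W (\<lambda>r I f. f) B +
    edge_op W (\<lambda>r I f. f) B * edge_op W (\<lambda>r I f. f) A = 0"
proof (rule endo_eqI)
  fix c and i :: "nat set \<times> 'v set"
  obtain J F where i: "i = (J, F)" by (cases i)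
  let ?L = "\<lambda>r I f. f"
  show "app (edge_op W ?L A * edge_op W ?L B + edge_op W ?L B * edge_op W ?L A) c i = app 0 c i"
  proof (cases "(J, F) \<in> valid W")
    case True
    note v = validD[OF True]
    let ?h = "\<lambda>r s. sg r J * (sg s (J - {r}) * c (J - {r} - {s}, F))"
    have eq: "app (edge_op W ?L A * edge_op W ?L B) c i =
        (\<Sum>(r, s)\<in>{(r, s). r \<in> J \<inter> A \<and> s \<in> J \<inter> B \<and> r \<noteq> s}. ?h r s)" for A B
    proof -
      have "app (edge_op W ?L A * edge_op W ?L B) c i = (\<Sum>r\<in>J \<inter> A. \<Sum>s\<in>(J - {r}) \<inter> B. ?h r s)"
        using True valid_mono[OF True] by (auto simp: i app_edge_op sum_distrib_left intro!: sum.cong)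
      also have "\<dots> = (\<Sum>(r, s)\<in>Sigma (J \<inter> A) (\<lambda>r. (J - {r}) \<inter> B). ?h r s)"
        using v(5) by (intro sum.Sigma) auto
      also have "Sigma (J \<inter> A) (\<lambda>r. (J - {r}) \<inter> B) = {(r, s). r \<in> J \<inter> A \<and> s \<in> J \<inter> B \<and> r \<noteq> s}"
        by auto
      finally show ?thesis .
    qed
    have "(\<Sum>(r, s)\<in>{(r, s). r \<in> J \<inter> B \<and> s \<in> J \<inter> A \<and> r \<noteq> s}. ?h r s) =
        (\<Sum>(r, s)\<in>{(r, s). r \<in> J \<inter> A \<and> s \<in> J \<inter> B \<and> r \<noteq> s}. - ?h r s)"
    proof (rule sum.reindex_bij_witness[of _ prod.swap prod.swap])
      fix p assume "p \<in> {(r, s). r \<in> J \<inter> B \<and> s \<in> J \<inter> A \<and> r \<noteq> s}"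
      then obtain r s where p: "p = (r, s)" "r \<in> J" "s \<in> J" "r \<noteq> s" by auto
      define K where "K = J - {r, s}"
      have J: "J = insert r (insert s K)" "J - {r} = insert s K" "J - {s} = insert r K"
        "insert s K - {s} = K" "insert r K - {r} = K" "r \<notin> K" "s \<notin> K" "finite K"
        using p v(5) by (auto simp: K_def)
      have "sg r J = sg r (insert s K)" "sg s J = sg s (insert r K)"
        unfolding J(1) by (simp, subst insert_commute, simp)
      moreover have "sg r K * sg s (insert r K) = - (sg s K * sg r (insert s K))"
        using p J by (intro sg_swap) auto
      ultimately have "sg s J * sg r K = - (sg r J * sg s K)" by (simp add: ac_simps)
      then have "sg s J * (sg r K * z) = - (sg r J * (sg s K * z))" for z
        by (metis mult.assoc mult_minus_left)
      then show "(case prod.swap p of (r, s) \<Rightarrow> - ?h r s) = (case p of (r, s) \<Rightarrow> ?h r s)"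
        by (simp add: p(1) J(2-5))
    qed auto
    then show ?thesis by (simp add: eq[of A B] eq[of B A] case_prod_unfold sum_negf del: app_ring(3))
  qed (simp add: i app_edge_op)
qed

text \<open>Conjugation by \<open>zeta\<close> replaces the deformed differential by restriction of
  functions. Restrictions commute, so only the signs of the cube matter.\<close>

lemma deform_anticomm:
  "(dd W A + Phi W A) * (dd W B + Phi W B) + (dd W B + Phi W B) * (dd W A + Phi W A) = 0"
proof -
  obtain u where u: "u * zeta W = 1" by (rule zeta_inverse)
  let ?D = "\<lambda>A. dd W A + Phi W A" and ?R = "edge_op W (\<lambda>r I f. f)"
  have "zeta W * (?D A * ?D B) = ?R A * ?R B * zeta W" for A B
    by (simp add: zeta_deform mult.assoc assoc_eq[OF zeta_deform])
  then have "zeta W * (?D A * ?D B + ?D B * ?D A) = (?R A * ?R B + ?R B * ?R A) * zeta W"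
    by (simp only: distrib_left distrib_right)
  also have "\<dots> = 0" by (simp add: restriction_anticomm)
  finally have "u * (zeta W * (?D A * ?D B + ?D B * ?D A)) = 0" by simp
  then show ?thesis by (simp add: assoc_eq[OF u])
qed

lemma graded_independent:
  assumes "X + Y = 0" "reads X \<rho>" "reads Y \<sigma>" "\<rho> \<inter> \<sigma> = {}"
  shows "X = 0"
proof -
  have X: "X = - Y" using assms(1) by (rule eq_neg_iff_add_eq_0[THEN iffD2])
  have "reads (- Y) \<sigma>" using assms(3) by (rule reads_uminus)
  then have "reads X (\<rho> \<inter> \<sigma>)" unfolding X[symmetric] by (rule reads_Int[OF assms(2)])
  then show ?thesis using reads_empty unfolding assms(4) by blast
qed

text \<open>The relation \<open>deform_anticomm\<close> is separated by polynomial degree: its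
  components \<open>x0\<close>, \<open>x1\<close> and \<open>x2\<close> have disjoint supports and
  must vanish one by one. For equal edge sets \<open>x1\<close> and \<open>x2\<close> come
  doubled.\<close>

lemma
  shows dd_anticomm: "dd W A * dd W B = - (dd W B * dd W A)"
    and Phi_dd: "Phi W A * dd W A = - (dd W A * Phi W A)"
    and Phi_Phi: "Phi W A * Phi W A = 0"
proof -
  define x0 where "x0 B = dd W A * dd W B + dd W B * dd W A" for B
  define x1 where "x1 B = dd W A * Phi W B + Phi W A * dd W B + (dd W B * Phi W A + Phi W B * dd W A)" for B
  define x2 where "x2 B = Phi W A * Phi W B + Phi W B * Phi W A" for B
  have sum: "x0 B + (x1 B + x2 B) = 0" for B
  proof -
    have "x0 B + (x1 B + x2 B) =
        (dd W A + Phi W A) * (dd W B + Phi W B) + (dd W B + Phi W B) * (dd W A + Phi W A)"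
      unfolding x0_def x1_def x2_def by (simp add: distrib_left distrib_right)
    then show ?thesis unfolding deform_anticomm .
  qed
  have r: "reads (x0 B) (grade W (- 2) 0)" "reads (x1 B) (grade W (- 2) 1)" "reads (x2 B) (grade W (- 2) 2)" for B
    unfolding x0_def x1_def x2_def
    using reads_grade_mult[OF reads_dd[of W A] reads_dd[of W B]]
      reads_grade_mult[OF reads_dd[of W B] reads_dd[of W A]]
      reads_grade_mult[OF reads_dd[of W A] reads_Phi[of W B]]
      reads_grade_mult[OF reads_dd[of W B] reads_Phi[of W A]]
      reads_grade_mult[OF reads_Phi[of W A] reads_dd[of W B]]
      reads_grade_mult[OF reads_Phi[of W B] reads_dd[of W A]]
      reads_grade_mult[OF reads_Phi[of W A] reads_Phi[of W B]]
      reads_grade_mult[OF reads_Phi[of W B] reads_Phi[of W A]]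
    by (simp_all add: reads_add)
  have x0: "x0 B = 0" for B
  proof (rule graded_independent[OF sum r(1)])
    show "reads (x1 B + x2 B) (grade W (- 2) 1 \<union> grade W (- 2) 2)"
      using reads_mono[OF r(2) Un_upper1] reads_mono[OF r(3) Un_upper2] by (rule reads_add)
  qed (auto simp: grade_def)
  then show "dd W A * dd W B = - (dd W B * dd W A)"
    unfolding x0_def by (rule eq_neg_iff_add_eq_0[THEN iffD2])
  have 12: "x1 B + x2 B = 0" for B using sum[of B] unfolding x0 by simp
  have "x1 A = 0" by (rule graded_independent[OF 12 r(2,3)]) (auto simp: grade_def)
  then have "(dd W A * Phi W A + Phi W A * dd W A) + (dd W A * Phi W A + Phi W A * dd W A) = 0"
    by (simp add: x1_def)
  from endo_double_zero[OF this] show "Phi W A * dd W A = - (dd W A * Phi W A)"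
    by (intro eq_neg_iff_add_eq_0[THEN iffD2]) (simp only: add.commute)
  have "x2 A = 0" using 12[of A] \<open>x1 A = 0\<close> by simp
  then show "Phi W A * Phi W A = 0" unfolding x2_def by (rule endo_double_zero)
qed

lemma dd_dd: "dd W A * dd W A = 0"
  using dd_anticomm[of W A A] by (rule endo_double_zero[OF eq_neg_iff_add_eq_0[THEN iffD1]])

end

section \<open>Contraction of the deformed complex\<close>

definition flip :: "(nat set \<times> 'v set) endo" where
  "flip = Endo (\<lambda>c s. (- 1) ^ card (fst s) * c s)"

lemma app_flip [simp]: "app flip c s = (- 1) ^ card (fst s) * c s"
  unfolding flip_def by (subst app_Endo) (simp_all add: algebra_simps)

lemma flip_even:
  assumes "reads X {(s, t). even (card (fst s)) = even (card (fst t))}"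
  shows "flip * X = X * flip"
proof (rule endo_eqI)
  fix c s
  have "app X (app flip c) s = app X (\<lambda>t. (- 1) ^ card (fst s) * c t) s"
    by (rule readsD[OF assms]) (auto simp: minus_one_power_iff)
  then show "app (flip * X) c s = app (X * flip) c s" by (simp add: app_scale)
qed

lemma flip_odd:
  assumes "reads X {(s, t). even (card (fst s)) \<noteq> even (card (fst t))}"
  shows "flip * X = - (X * flip)"
proof (rule endo_eqI)
  fix c s
  have "app X (app flip c) s = app X (\<lambda>t. - ((- 1) ^ card (fst s)) * c t) s"
    by (rule readsD[OF assms]) (auto simp: minus_one_power_iff)
  then show "app (flip * X) c s = app (- (X * flip)) c s"
    by (simp only: app_scale app_ring app_flip)
qed

context ugraph begin

lemma flip_odd_grade:
  assumes "reads X (grade W p q)" "odd p"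
  shows "flip * X = - (X * flip)"
proof -
  have "even (card J) \<noteq> even (card I)" if "int (card J) = int (card I) + p" for I J :: "nat set"
  proof -
    have "even (int (card J)) \<noteq> even (int (card I))" using that assms(2) by simp
    then show ?thesis by simp
  qed
  then have "grade W p q \<subseteq> {(s, t). even (card (fst s)) \<noteq> even (card (fst t))}"
    by (auto simp: grade_def)
  then show ?thesis by (intro flip_odd reads_mono[OF assms(1)])
qed

lemma flip_even_grade:
  assumes "reads X (grade W p q)" "even p"
  shows "flip * X = X * flip"
proof -
  have "even (card J) = even (card I)" if "int (card J) = int (card I) + p" for I J :: "nat set"
  proof -
    have "even (int (card J)) = even (int (card I))" using that assms(2) by simp
    then show ?thesis by simp
  qed
  then have "grade W p q \<subseteq> {(s, t). even (card (fst s)) = even (card (fst t))}"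
    by (auto simp: grade_def)
  then show ?thesis by (intro flip_even reads_mono[OF assms(1)])
qed

text \<open>After expansion the deformed complex of a colouring is a full cube on its monochromatic
  edges, which is contracted by toggling the first one.\<close>

definition monochrome :: "'v set \<Rightarrow> nat set" where
  "monochrome F = {r \<in> E. a r \<in> F \<longleftrightarrow> b r \<in> F}"

definition toggle :: "'v set \<Rightarrow> (nat set \<times> 'v set) endo" where
  "toggle W = Endo (\<lambda>c (I, F). if (I, F) \<in> valid W \<and> monochrome F \<noteq> {} \<and> Min (monochrome F) \<notin> I
     then sg (Min (monochrome F)) I * c (insert (Min (monochrome F)) I, F) else 0)"

lemma app_toggle: "app (toggle W) c (I, F) = (if (I, F) \<in> valid W \<and> monochrome F \<noteq> {} \<and> Min (monochrome F) \<notin> I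
     then sg (Min (monochrome F)) I * c (insert (Min (monochrome F)) I, F) else 0)"
  unfolding toggle_def
  by (subst app_Endo) (auto simp: algebra_simps split: prod.split)

lemma mono_Min:
  assumes "monochrome F \<noteq> {}"
  shows "Min (monochrome F) \<in> monochrome F"
  by (rule Min_in) (use assms finite_E in \<open>auto simp: monochrome_def\<close>)

lemma valid_subset_mono: "(I, F) \<in> valid W \<Longrightarrow> I \<subseteq> monochrome F"
  by (auto simp: valid_def monochrome_def sat_def)

text \<open>For fixed F the complex is the cube of subsets of \<open>monochrome F\<close>. Adding
  and removing the smallest edge m gives the identity, and the terms with another edge cancel in
  pairs by \<open>sg_swap'\<close>. What survives are the colourings without monochromatic edge,
  whose cube is a point, and the indices outside \<open>valid W\<close>, where both operators
  vanish.\<close>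

lemma toggle_contraction:
  fixes W
  defines "D \<equiv> edge_op W (\<lambda>r I f. f) E" and "\<pi> \<equiv> restr (- valid W \<union> {(I, F). monochrome F = {}})"
  shows "D * toggle W + toggle W * D = 1 - \<pi>" and "\<pi> * D = 0"
proof -
  show "D * toggle W + toggle W * D = 1 - \<pi>"
  proof (rule endo_eqI)
    fix c and i :: "nat set \<times> 'v set"
    obtain J F where i: "i = (J, F)" by (cases i)
    show "app (D * toggle W + toggle W * D) c i = app (1 - \<pi>) c i"
    proof (cases "(J, F) \<in> valid W \<and> monochrome F \<noteq> {}")
      case True
      then have vJ: "(J, F) \<in> valid W" and ne: "monochrome F \<noteq> {}" by auto
      note v = validD[OF vJ]
      define m where "m = Min (monochrome F)"
      have mF: "m \<in> E" "a m \<in> F \<longleftrightarrow> b m \<in> F" using mono_Min[OF ne] by (auto simp: m_def monochrome_def)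
      have JE: "J \<inter> E = J" using v(1) by auto
      have vI: "(J - {r}, F) \<in> valid W" for r using vJ by (rule valid_mono) auto
      have tog: "app (toggle W) c' (I, F) = (if m \<in> I then 0 else sg m I * c' (insert m I, F))"
        if "(I, F) \<in> valid W" for I c'
        using that ne by (simp add: app_toggle m_def)
      show ?thesis
      proof (cases "m \<in> J")
        case mJ: True
        have "app D (app (toggle W) c) (J, F) =
            (\<Sum>r\<in>J. if r = m then sg m J * (sg m (J - {m}) * c (insert m (J - {m}), F)) else 0)"
          unfolding D_def app_edge_op[OF lin_id] JE using vJ mJ
          by (auto simp: tog[OF vI] simp del: sg_Diff intro!: sum.cong)
        also have "\<dots> = c (J, F)" using mJ v(5) by (simp add: insert_absorb)
        finally show ?thesis using vJ ne mJ
          by (simp add: i tog \<pi>_def)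
      next
        case mJ: False
        have vm: "(insert m J, F) \<in> valid W" using vJ mF v(4) by (simp add: valid_def)
        have m': "m \<notin> J - {r}" for r using mJ by auto
        have JmE: "insert m J \<inter> E = insert m J" using JE mF by auto
        have 1: "app D (app (toggle W) c) (J, F) =
            (\<Sum>r\<in>J. sg r J * (sg m (J - {r}) * c (insert m (J - {r}), F)))"
          unfolding D_def app_edge_op[OF lin_id] JE using vJ m'
          by (auto simp: tog[OF vI] intro!: sum.cong)
        have "app (toggle W) (app D c) (J, F) =
            sg m J * (\<Sum>r\<in>insert m J. sg r (insert m J) * c (insert m J - {r}, F))"
          using vJ vm mJ by (simp add: tog D_def app_edge_op[OF lin_id] JmE)
        also have "\<dots> = c (J, F) + (\<Sum>r\<in>J. sg m J * (sg r (insert m J) * c (insert m J - {r}, F)))"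
          using v(5) mJ by (simp add: distrib_left sum_distrib_left)
        also have "(\<Sum>r\<in>J. sg m J * (sg r (insert m J) * c (insert m J - {r}, F))) =
            (\<Sum>r\<in>J. - (sg r J * (sg m (J - {r}) * c (insert m (J - {r}), F))))"
        proof (rule sum.cong[OF refl])
          fix r assume r: "r \<in> J"
          define K where "K = J - {r}"
          have K: "J = insert r K" "r \<notin> K" "m \<notin> K" "r \<noteq> m" "finite K" using r mJ v(5) by (auto simp: K_def)
          have "sg r (insert m J) = sg r (insert m K)" unfolding K(1) insert_commute[of m] by simp
          then have "sg m J * sg r (insert m J) = - (sg r J * sg m K)"
            using sg_swap'[OF K(4,5,2,3)] unfolding K(1) by (simp add: ac_simps)
          then have "sg m J * (sg r (insert m J) * z) = - (sg r J * (sg m K * z))" for z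
            by (metis mult.assoc mult_minus_left)
          moreover have "insert m J - {r} = insert m K" using K by auto
          ultimately show "sg m J * (sg r (insert m J) * c (insert m J - {r}, F)) =
              - (sg r J * (sg m (J - {r}) * c (insert m (J - {r}), F)))" by (simp add: K_def)
        qed
        finally show ?thesis using 1 vJ ne by (simp add: i \<pi>_def sum_negf)
      qed
    next
      case False
      then have "app (toggle W) c' (J, F) = 0" for c' by (auto simp: app_toggle)
      moreover have "app D (app (toggle W) c) (J, F) = 0"
        using False valid_subset_mono[of J F W] by (auto simp: D_def app_edge_op)
      ultimately show ?thesis using False by (auto simp: i \<pi>_def)
    qed
  qed
  show "\<pi> * D = 0"
  proof (rule endo_eqI)
    fix c and i :: "nat set \<times> 'v set"
    obtain J F where i: "i = (J, F)" by (cases i)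
    show "app (\<pi> * D) c i = app 0 c i"
      using valid_subset_mono[of J F W]
      by (auto simp: i D_def \<pi>_def app_edge_op)
  qed
qed

text \<open>The toggle contraction conjugated back by \<open>zeta\<close>. Since \<open>zeta\<close>
  does not change I, it commutes with \<open>flip\<close>, and the sign rule survives.\<close>

lemma deform_contraction:
  obtains H \<pi> where "(dd W E + Phi W E) * H + H * (dd W E + Phi W E) = 1 - \<pi>"
    "\<pi> * (dd W E + Phi W E) = 0" "flip * H = - (H * flip)"
proof -
  obtain u where u: "u * zeta W = 1" "zeta W * u = 1"
    and comm: "\<forall>Y. zeta W * Y = Y * zeta W \<longrightarrow> u * Y = Y * u" by (rule zeta_inverse[of W])
  define D where "D = edge_op W (\<lambda>r I f. f) E"
  define \<pi> where "\<pi> = restr (- valid W \<union> {(I, F). monochrome F = {}})"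
  note t = toggle_contraction[of W, folded D_def \<pi>_def]
  define C where "C = (\<lambda>Y. u * Y * zeta W)"
  have C: "C x * C y = C (x * y)" "C x + C y = C (x + y)" "C x - C y = C (x - y)" "C 0 = 0" "C 1 = 1" for x y
    using assoc_eq[OF u(2)] u by (simp_all add: C_def mult.assoc algebra_simps)
  have CD: "dd W E + Phi W E = C D"
  proof -
    have "u * (zeta W * (dd W E + Phi W E)) = C D"
      unfolding zeta_deform C_def D_def by (simp add: mult.assoc)
    then show ?thesis by (simp add: assoc_eq[OF u(1)])
  qed
  have zf: "zeta W * flip = flip * zeta W"
  proof (rule flip_even[symmetric])
    show "reads (zeta W) {(s, t). even (card (fst s)) = even (card (fst t))}"
      unfolding reads_def
    proof (intro allI impI)
      fix s :: "nat set \<times> 'v set" and c c' :: "nat set \<times> 'v set \<Rightarrow> int"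
      assume "\<forall>t. (s, t) \<in> {(s, t). even (card (fst s)) = even (card (fst t))} \<longrightarrow> c t = c' t"
      then have "c (fst s, X) = c' (fst s, X)" for X by simp
      then show "app (zeta W) c s = app (zeta W) c' s" by (cases s) (simp add: app_zeta)
    qed
  qed
  note uf = comm[rule_format, OF zf]
  have "flip * toggle W = - (toggle W * flip)"
  proof (rule flip_odd, unfold reads_def, intro allI impI)
    fix s :: "nat set \<times> 'v set" and c c' :: "nat set \<times> 'v set \<Rightarrow> int"
    assume eq: "\<forall>t. (s, t) \<in> {(s, t). even (card (fst s)) \<noteq> even (card (fst t))} \<longrightarrow> c t = c' t"
    obtain I F where s: "s = (I, F)" by (cases s)
    show "app (toggle W) c s = app (toggle W) c' s"
      using eq validD(5)[of I F W] by (auto simp: s app_toggle)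
  qed
  then have "u * (flip * toggle W) * zeta W = u * - (toggle W * flip) * zeta W" by simp
  then have "(u * flip) * toggle W * zeta W = - (u * toggle W * (flip * zeta W))"
    by (simp add: mult.assoc)
  then have "flip * C (toggle W) = - (C (toggle W) * flip)"
    unfolding C_def uf zf[symmetric] by (simp add: mult.assoc)
  moreover have "C D * C (toggle W) + C (toggle W) * C D = 1 - C \<pi>" "C \<pi> * C D = 0"
    by (simp_all only: C(1,2) t) (simp_all only: C(3)[symmetric] C(4,5))
  ultimately show thesis using that[of "C (toggle W)" "C \<pi>"] unfolding CD by blast
qed

section \<open>Moving a label to the root\<close>

definition unlabelled :: "'v \<Rightarrow> nat set \<Rightarrow> 'v set \<Rightarrow> 'v set set" where
  "unlabelled w I U = comp_of I ` (V - U) - {comp_of I w}"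

text \<open>The derivation turns a label x into 1, so in coefficients a labelling collects from
  those with one more x.\<close>

definition nu :: "'v \<Rightarrow> (nat set \<times> 'v set) endo" where
  "nu w = Endo (\<lambda>c (I, U). if (I, U) \<in> valid {w} then \<Sum>P\<in>unlabelled w I U. c (I, U \<union> P) else 0)"

text \<open>The component that merges into the root had label x, and this label is now at the root,
  where \<open>U\<close> does not record it; hence \<open>U\<close> collects from \<open>U\<close>
  enlarged by that component.\<close>

definition root_merge :: "'v \<Rightarrow> nat \<Rightarrow> nat set \<Rightarrow> ('v set \<Rightarrow> int) \<Rightarrow> 'v set \<Rightarrow> int" where
  "root_merge w r I f U =
    (if a r \<in> comp_of I w \<and> b r \<notin> comp_of I w then f (U \<union> comp_of I (b r))
     else if b r \<in> comp_of I w \<and> a r \<notin> comp_of I w then f (U \<union> comp_of I (a r)) else 0)"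

lemma lin_root_merge [simp]: "lin (root_merge w)"
  by (auto simp: lin_def root_merge_def)

definition delta :: "'v \<Rightarrow> (nat set \<times> 'v set) endo" where
  "delta w = edge_op {w} (root_merge w) E"

lemma app_delta: "app (delta w) c (J, U) = (if (J, U) \<in> valid {w}
    then \<Sum>r\<in>J \<inter> E. sg r J * root_merge w r (J - {r}) (\<lambda>X. c (J - {r}, X)) U else 0)"
  unfolding delta_def by (rule app_edge_op[OF lin_root_merge])

lemma app_nu: "app (nu w) c (I, U) =
  (if (I, U) \<in> valid {w} then \<Sum>P\<in>unlabelled w I U. c (I, U \<union> P) else 0)"
  unfolding nu_def
  by (subst app_Endo) (auto simp: sum.distrib sum_distrib_left split: prod.split)

lemma finite_unlabelled: "finite (unlabelled w I U)"
  by (simp add: unlabelled_def finite_V)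

lemma unlabelledD:
  assumes "P \<in> unlabelled w I U" "(I, U) \<in> valid {w}"
  shows "P \<inter> U = {}" "w \<notin> P" "(I, U \<union> P) \<in> valid {w}" "\<And>v. v \<in> P \<Longrightarrow> comp_of I v = P"
proof -
  note v = validD[OF assms(2)]
  obtain x where x: "P = comp_of I x" "x \<in> V" "x \<notin> U" "P \<noteq> comp_of I w"
    using assms(1) by (auto simp: unlabelled_def)
  show "P \<inter> U = {}" unfolding x(1) by (rule sat_disjoint[OF v(4) x(3)])
  show w: "w \<notin> P" using x by (auto simp: mem_comp)
  show "comp_of I v = P" if "v \<in> P" for v using that x by (simp add: mem_comp)
  have "P \<subseteq> V" unfolding x(1) using v(1) x(2) by (rule comp_subset_V)
  with w assms(2) x(1) show "(I, U \<union> P) \<in> valid {w}" by (auto simp: valid_def sat_Un)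
qed

text \<open>The Leibniz rule for one edge has two defects. The product of x and x is 0, but its
  formal derivative is 2x, which gives \<open>squash\<close> twice. If r merges a component with
  label x into the root, the rooted differential drops the result, whereas differentiating first
  leaves the product of 1 and 1; this is \<open>root_merge\<close>.\<close>

lemma dd_nu_local:
  fixes f :: "'v set \<Rightarrow> int"
  assumes "w \<in> V" "(insert r I, U) \<in> valid {w}"
  defines "N \<equiv> \<lambda>X. \<Sum>P\<in>unlabelled w I X. f (X \<union> P)"
  shows "pull r I N U - (\<Sum>P\<in>unlabelled w (insert r I) U. pull r I f (U \<union> P)) =
    2 * squash r I f U + root_merge w r I f U"
proof -
  let ?J = "insert r I" and ?P = "comp_of I (a r)" and ?Q = "comp_of I (b r)"
  note v = validD[OF assms(2)]
  have vI: "(I, U) \<in> valid {w}" using assms(2) by (rule valid_mono) auto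
  have ab: "a r \<in> U \<longleftrightarrow> b r \<in> U" using v(4) by simp
  have abV: "a r \<in> V" "b r \<in> V" using v(1) ends_in by auto
  have wU: "w \<notin> U" using v(3) by auto
  have sI: "sat I U" using validD(4)[OF vI] .
  show ?thesis
  proof (cases "b r \<in> ?P")
    case True
    then have "a r \<in> comp_of I w \<longleftrightarrow> b r \<in> comp_of I w" by (simp add: mem_comp)
    then have "root_merge w r I f U = 0" by (auto simp: root_merge_def)
    then show ?thesis using True
      by (simp add: pull_def squash_def unlabelled_def comp_insert_same N_def)
  next
    case PQ: False
    have disj: "?P \<inter> ?Q = {}" using PQ comp_disjoint by blast
    show ?thesis
    proof (cases "a r \<in> U")
      case True
      then have bU: "b r \<in> U" using ab by simp
      have sub: "?P \<subseteq> U" "?Q \<subseteq> U" using sI True bU by (auto intro: comp_least[THEN subsetD])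
      have "w \<notin> ?P" "w \<notin> ?Q" using sub wU by auto
      then have "a r \<notin> comp_of I w" "b r \<notin> comp_of I w" by (auto simp: mem_comp)
      then have root: "root_merge w r I f U = 0" by (simp add: root_merge_def)
      have same: "comp_of ?J x = comp_of I x" if "x \<notin> U" for x
        using that sub by (auto simp: comp_insert)
      have out: "unlabelled w ?J U = unlabelled w I U"
        using same wU by (auto simp: unlabelled_def)
      have outD: "unlabelled w I (U - comp_of I y) = insert (comp_of I y) (unlabelled w I U)"
        "comp_of I y \<notin> unlabelled w I U" if "y \<in> U" "comp_of I y \<subseteq> U" for y
      proof -
        have "comp_of I y \<noteq> comp_of I w" using that(2) wU comp_self by blast
        moreover have "V - (U - comp_of I y) = comp_of I y \<union> (V - U)" using that v(2) by blast
        ultimately show "unlabelled w I (U - comp_of I y) = insert (comp_of I y) (unlabelled w I U)"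
          by (simp add: unlabelled_def image_Un insert_Diff_if)
        show "comp_of I y \<notin> unlabelled w I U"
          using unlabelledD(1)[OF _ vI, of "comp_of I y"] that comp_self[of y I] by blast
      qed
      \<comment> \<open>Both summands of \<open>pull\<close> arise in this way, with y one or the
        other end of r, so \<open>f U\<close> occurs twice.\<close>
      have N: "N (U - comp_of I y) = f U + (\<Sum>P\<in>unlabelled w I U. f (U \<union> P - comp_of I y))"
        if y: "y \<in> U" "comp_of I y \<subseteq> U" for y
      proof -
        have "U - comp_of I y \<union> P = U \<union> P - comp_of I y" if "P \<in> unlabelled w I U" for P
          using unlabelledD(1)[OF that vI] y(2) by auto
        moreover have "U - comp_of I y \<union> comp_of I y = U" using y(2) by auto
        ultimately show ?thesis unfolding N_def outD(1)[OF y]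
          using outD(2)[OF y] finite_unlabelled by (simp add: sum.insert_if)
      qed
      show ?thesis
        using True PQ N[OF True sub(1)] N[OF bU sub(2)] root
        by (simp add: pull_def squash_def out sum.distrib)
    next
      case aU: False
      then have bU: "b r \<notin> U" using ab by simp
      have sub: "?P \<inter> U = {}" "?Q \<inter> U = {}" using sat_disjoint[OF sI] aU bU by auto
      define B where "B = comp_of I ` (V - U - ?P - ?Q)"
      have VU: "V - U = ?P \<union> ?Q \<union> (V - U - ?P - ?Q)"
        using sub comp_subset_V[OF _ abV(1), of I] comp_subset_V[OF _ abV(2), of I] v(1) by blast
      have outI: "unlabelled w I U = insert ?P (insert ?Q B) - {comp_of I w}"
        unfolding unlabelled_def by (subst VU) (simp only: image_Un comp_image_comp B_def Un_insert_left Un_empty_left)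
      have "comp_of ?J ` (?P \<union> ?Q) = {?P \<union> ?Q}"
      proof -
        have "comp_of ?J ` (?P \<union> ?Q) = (\<lambda>_. ?P \<union> ?Q) ` (?P \<union> ?Q)"
          by (rule image_cong[OF refl]) (simp add: comp_insert)
        then show ?thesis using image_constant[of "a r" "?P \<union> ?Q"] by simp
      qed
      moreover have "comp_of ?J ` (V - U - ?P - ?Q) = B"
        unfolding B_def by (rule image_cong[OF refl]) (simp add: comp_insert)
      ultimately have outJ: "unlabelled w ?J U = insert (?P \<union> ?Q) B - {comp_of ?J w}"
        unfolding unlabelled_def by (subst VU) (simp only: image_Un Un_insert_left Un_empty_left)
      have B: "a r \<notin> P" "b r \<notin> P" if "P \<in> B" for P
        using that by (auto simp: B_def mem_comp)
      have nB: "?P \<notin> B" "?Q \<notin> B" "?P \<union> ?Q \<notin> B"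
        using B[of ?P] B[of ?Q] B[of "?P \<union> ?Q"] comp_self[of "a r" I] comp_self[of "b r" I] by auto
      have PQne: "?P \<noteq> ?Q" using PQ comp_self[of "b r" I] by auto
      have aQ: "a r \<notin> ?Q" using PQne by (simp add: mem_comp)
      have finB: "finite B" by (simp add: B_def finite_V)
      have N: "N U = (\<Sum>P\<in>unlabelled w I U. f (U \<union> P))" by (simp add: N_def)
      have sumB: "(\<Sum>P\<in>B'. pull r I f (U \<union> P)) = (\<Sum>P\<in>B'. f (U \<union> P))" if "B' \<subseteq> B" for B'
        using B that aU by (intro sum.cong refl) (auto simp: pull_def)
      have lhs: "pull r I N U = N U" "squash r I f U = 0" using aU by (simp_all add: pull_def squash_def)
      consider "w \<in> ?P" | "w \<in> ?Q" | "w \<notin> ?P" "w \<notin> ?Q" by blast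
      then show ?thesis
      proof cases
        case 1
        then have cw: "comp_of I w = ?P" by (rule comp_eq)
        have "comp_of ?J w = ?P \<union> ?Q" using 1 by (simp add: comp_insert)
        then have 2: "unlabelled w I U = insert ?Q B" "unlabelled w ?J U = B"
          using nB PQne unfolding outI outJ cw by auto
        have "root_merge w r I f U = f (U \<union> ?Q)" using cw PQ by (simp add: root_merge_def)
        then show ?thesis using finB nB by (simp add: lhs N 2 sumB)
      next
        case 2
        then have cw: "comp_of I w = ?Q" by (rule comp_eq)
        have "comp_of ?J w = ?P \<union> ?Q" using 2 by (simp add: comp_insert)
        then have 3: "unlabelled w I U = insert ?P B" "unlabelled w ?J U = B"
          using nB PQne unfolding outI outJ cw by auto
        have "root_merge w r I f U = f (U \<union> ?P)" using cw aQ by (simp add: root_merge_def)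
        then show ?thesis using finB nB by (simp add: lhs N 3 sumB)
      next
        case 3
        then have cw: "comp_of I w \<noteq> ?P" "comp_of I w \<noteq> ?Q" by (auto simp: mem_comp)
        have cJ: "comp_of ?J w = comp_of I w" using 3 by (simp add: comp_insert)
        have cw': "comp_of I w \<noteq> ?P \<union> ?Q" using 3 comp_self[of w I] by blast
        define B' where "B' = B - {comp_of I w}"
        have 4: "unlabelled w I U = insert ?P (insert ?Q B')" "unlabelled w ?J U = insert (?P \<union> ?Q) B'"
          using cw cw' unfolding outI outJ cJ B'_def by auto
        have nB': "?P \<notin> B'" "?Q \<notin> B'" "?P \<union> ?Q \<notin> B'" "finite B'" "B' \<subseteq> B"
          using nB finB by (auto simp: B'_def)
        have "U \<union> (?P \<union> ?Q) - ?P = U \<union> ?Q" "U \<union> (?P \<union> ?Q) - ?Q = U \<union> ?P" using sub disj by auto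
        then have pPQ: "pull r I f (U \<union> (?P \<union> ?Q)) = f (U \<union> ?Q) + f (U \<union> ?P)"
          using PQ by (simp add: pull_def)
        have "root_merge w r I f U = 0" using cw by (auto simp: root_merge_def mem_comp)
        then show ?thesis using nB' PQne by (simp add: lhs N 4 sumB pPQ)
      qed
    qed
  qed
qed

lemma dd_nu:
  assumes "w \<in> V"
  shows "dd {w} E * nu w - nu w * dd {w} E = 2 * Phi {w} E + delta w"
proof (rule endo_eqI)
  fix c and i :: "nat set \<times> 'v set"
  obtain J U where i: "i = (J, U)" by (cases i)
  show "app (dd {w} E * nu w - nu w * dd {w} E) c i = app (2 * Phi {w} E + delta w) c i"
  proof (cases "(J, U) \<in> valid {w}")
    case True
    note v = validD[OF True]
    have JE: "J \<inter> E = J" using v(1) by auto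
    have pull_nu: "pull r (J - {r}) (\<lambda>X. app (nu w) c (J - {r}, X)) U =
        pull r (J - {r}) (\<lambda>X. \<Sum>P\<in>unlabelled w (J - {r}) X. c (J - {r}, X \<union> P)) U" for r
    proof -
      have "(J - {r}, U) \<in> valid {w}" using True by (rule valid_mono) auto
      then show ?thesis by (simp add: pull_def app_nu valid_Diff)
    qed
    let ?N = "\<lambda>r X. \<Sum>P\<in>unlabelled w (J - {r}) X. c (J - {r}, X \<union> P)"
    have "app (nu w) (app (dd {w} E) c) (J, U) = (\<Sum>P\<in>unlabelled w J U. app (dd {w} E) c (J, U \<union> P))"
      using True by (simp only: app_nu if_True)
    also have "\<dots> = (\<Sum>P\<in>unlabelled w J U. \<Sum>r\<in>J.
        sg r J * pull r (J - {r}) (\<lambda>X. c (J - {r}, X)) (U \<union> P))"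
      by (rule sum.cong[OF refl]) (simp only: app_dd JE unlabelledD(3)[OF _ True] if_True)
    also have "\<dots> = (\<Sum>r\<in>J. sg r J * (\<Sum>P\<in>unlabelled w J U. pull r (J - {r}) (\<lambda>X. c (J - {r}, X)) (U \<union> P)))"
      by (subst sum.swap) (simp only: sum_distrib_left)
    finally have 1: "app (nu w) (app (dd {w} E) c) (J, U) = \<dots>" .
    have 2: "app (dd {w} E) (app (nu w) c) (J, U) = (\<Sum>r\<in>J. sg r J * pull r (J - {r}) (?N r) U)"
      using True by (simp only: app_dd JE pull_nu if_True)
    have "app (dd {w} E) (app (nu w) c) (J, U) - app (nu w) (app (dd {w} E) c) (J, U) =
      (\<Sum>r\<in>J. sg r J * (pull r (J - {r}) (?N r) U -
         (\<Sum>P\<in>unlabelled w J U. pull r (J - {r}) (\<lambda>X. c (J - {r}, X)) (U \<union> P))))"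
      unfolding 1 2 by (simp only: right_diff_distrib sum_subtractf)
    also have "\<dots> = (\<Sum>r\<in>J. sg r J * (2 * squash r (J - {r}) (\<lambda>X. c (J - {r}, X)) U +
        root_merge w r (J - {r}) (\<lambda>X. c (J - {r}, X)) U))"
    proof (rule sum.cong[OF refl], rule arg_cong[of _ _ "(*) _"])
      fix r assume "r \<in> J"
      then have J: "insert r (J - {r}) = J" by auto
      show "pull r (J - {r}) (\<lambda>X. \<Sum>P\<in>unlabelled w (J - {r}) X. c (J - {r}, X \<union> P)) U -
         (\<Sum>P\<in>unlabelled w J U. pull r (J - {r}) (\<lambda>X. c (J - {r}, X)) (U \<union> P)) =
         2 * squash r (J - {r}) (\<lambda>X. c (J - {r}, X)) U + root_merge w r (J - {r}) (\<lambda>X. c (J - {r}, X)) U"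
        using dd_nu_local[OF assms, of r "J - {r}" U "\<lambda>X. c (J - {r}, X)", unfolded J, OF True]
        .
    qed
    also have "\<dots> = app (2 * Phi {w} E + delta w) c i" using True
      by (simp add: i app_double app_Phi app_delta JE distrib_left sum.distrib sum_distrib_left
          mult.left_commute del: app_ring(3))
    finally show ?thesis by (simp only: i app_ring)
  qed (simp add: i mult_2[of "Phi {w} E"] app_nu app_dd app_Phi app_delta)
qed

section \<open>Deletion and contraction of an edge\<close>

lemma pull_cong:
  assumes "(insert r I, U) \<in> valid W" "\<And>X. X \<subseteq> U \<Longrightarrow> (I, X) \<in> valid W \<Longrightarrow> f X = f' X"
  shows "pull r I f U = pull r I f' U"
proof -
  have "(I, U) \<in> valid W" using assms(1) by (rule valid_mono) auto
  then show ?thesis using assms(2) by (simp add: pull_def valid_Diff)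
qed

text \<open>The edges in \<open>F\<close> are contracted, those in \<open>A\<close> are free and the remaining ones are deleted.\<close>

definition block :: "'v \<Rightarrow> nat set \<Rightarrow> nat set \<Rightarrow> (nat set \<times> 'v set) set" where
  "block w F A = {(I, U) \<in> valid {w}. I - A = F}"

lemma app_dd_cong:
  assumes "(J, U) \<in> valid W \<Longrightarrow> (\<And>r. r \<in> J \<inter> A \<Longrightarrow>
    pull r (J - {r}) (\<lambda>X. c (J - {r}, X)) U = pull r (J - {r}) (\<lambda>X. c' (J - {r}, X)) U)"
  shows "app (dd W A) c (J, U) = app (dd W A) c' (J, U)"
  using assms by (auto simp: app_dd intro!: sum.cong)

lemma dd_block_commute:
  assumes "A \<subseteq> B" "A \<inter> F = {}"
  shows "dd {w} A * restr (block w F B) = restr (block w F B) * dd {w} A"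
proof (rule endo_eqI)
  fix c and i :: "nat set \<times> 'v set"
  obtain J U where i: "i = (J, U)" by (cases i)
  have J: "J - {r} - B = J - B" if "r \<in> A" for r using that assms(1) by auto
  have "app (dd {w} A) (\<lambda>s. if s \<in> block w F B then c s else 0) (J, U) =
      app (dd {w} A) (\<lambda>s. if J - B = F then c s else 0) (J, U)"
  proof (rule app_dd_cong)
    fix r assume v: "(J, U) \<in> valid {w}" and r: "r \<in> J \<inter> A"
    have "insert r (J - {r}) = J" using r by auto
    then show "pull r (J - {r}) (\<lambda>X. if (J - {r}, X) \<in> block w F B then c (J - {r}, X) else 0) U =
        pull r (J - {r}) (\<lambda>X. if J - B = F then c (J - {r}, X) else 0) U"
      using v r J by (intro pull_cong[where W = "{w}"]) (auto simp: block_def)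
  qed
  also have "\<dots> = app (restr (block w F B) * dd {w} A) c i"
    by (cases "J - B = F") (auto simp: i block_def app_dd)
  finally show "app (dd {w} A * restr (block w F B)) c i = app (restr (block w F B) * dd {w} A) c i"
    by (simp only: i app_ring app_restr)
qed

text \<open>Adding e leads from the block with e deleted to the block with e contracted and nowhere
  else, so the complex with e free is the cone of \<open>dd {w} {e}\<close>.\<close>

lemma dd_edge_block:
  assumes "e \<notin> A" "e \<notin> F"
  shows "dd {w} {e} * restr (block w F A) = restr (block w (insert e F) A) * dd {w} {e}"
    and "restr (block w F A) * dd {w} {e} = 0"
    and "dd {w} {e} * restr (block w (insert e F) A) = 0"
proof -
  show "dd {w} {e} * restr (block w F A) = restr (block w (insert e F) A) * dd {w} {e}"
  proof (rule endo_eqI)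
    fix c and i :: "nat set \<times> 'v set"
    obtain J U where i: "i = (J, U)" by (cases i)
    have "app (dd {w} {e}) (\<lambda>s. if s \<in> block w F A then c s else 0) (J, U) =
        app (dd {w} {e}) (\<lambda>s. if J - A = insert e F then c s else 0) (J, U)"
    proof (rule app_dd_cong)
      fix r assume v: "(J, U) \<in> valid {w}" and r: "r \<in> J \<inter> {e}"
      have "insert r (J - {r}) = J" "J - {e} - A = F \<longleftrightarrow> J - A = insert e F" using r assms by auto
      then show "pull r (J - {r}) (\<lambda>X. if (J - {r}, X) \<in> block w F A then c (J - {r}, X) else 0) U =
          pull r (J - {r}) (\<lambda>X. if J - A = insert e F then c (J - {r}, X) else 0) U"
        using v r by (intro pull_cong[where W = "{w}"]) (auto simp: block_def)
    qed
    also have "\<dots> = app (restr (block w (insert e F) A) * dd {w} {e}) c i"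
      by (cases "J - A = insert e F") (auto simp: i block_def app_dd)
    finally show "app (dd {w} {e} * restr (block w F A)) c i = app (restr (block w (insert e F) A) * dd {w} {e}) c i"
      by (simp only: i app_ring app_restr)
  qed
  show "restr (block w F A) * dd {w} {e} = 0"
  proof (rule endo_eqI)
    fix c and i :: "nat set \<times> 'v set"
    obtain J U where i: "i = (J, U)" by (cases i)
    have "J \<inter> {e} = {}" if "J - A = F" using that assms by auto
    then show "app (restr (block w F A) * dd {w} {e}) c i = app 0 c i"
      by (auto simp: i block_def app_dd)
  qed
  show "dd {w} {e} * restr (block w (insert e F) A) = 0"
  proof (rule endo_eqI)
    fix c and i :: "nat set \<times> 'v set"
    obtain J U where i: "i = (J, U)" by (cases i)
    have "app (dd {w} {e}) (\<lambda>s. if s \<in> block w (insert e F) A then c s else 0) (J, U) =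
        app (dd {w} {e}) (\<lambda>_. 0) (J, U)"
    proof (rule app_dd_cong)
      fix r assume v: "(J, U) \<in> valid {w}" and r: "r \<in> J \<inter> {e}"
      have "insert r (J - {r}) = J" "J - {e} - A \<noteq> insert e F" using r by auto
      then show "pull r (J - {r}) (\<lambda>X. if (J - {r}, X) \<in> block w (insert e F) A then c (J - {r}, X) else 0) U =
          pull r (J - {r}) (\<lambda>X. 0) U"
        using v r by (intro pull_cong[where W = "{w}"]) (auto simp: block_def)
    qed
    then show "app (dd {w} {e} * restr (block w (insert e F) A)) c i = app 0 c i"
      by (simp add: i)
  qed
qed

lemma restr_block_insert:
  assumes "e \<notin> A" "e \<notin> F"
  shows "restr (block w F (insert e A)) = restr (block w F A) + restr (block w (insert e F) A)"
    and "restr (block w F A) * restr (block w (insert e F) A) = 0"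
    and "restr (block w (insert e F) A) * restr (block w F A) = 0"
proof -
  have disj: "block w F A \<inter> block w (insert e F) A = {}" using assms by (auto simp: block_def)
  have "block w F (insert e A) = block w F A \<union> block w (insert e F) A"
    using assms by (auto simp: block_def)
  then show "restr (block w F (insert e A)) = restr (block w F A) + restr (block w (insert e F) A)"
    by (simp add: restr_Un[OF disj])
  have "restr {} = (0 :: (nat set \<times> 'v set) endo)" by (rule endo_eqI) simp
  then show "restr (block w F A) * restr (block w (insert e F) A) = 0"
    "restr (block w (insert e F) A) * restr (block w F A) = 0"
    using disj by (simp_all add: restr_mult Int_commute)
qed

text \<open>This map, \<open>unmerge_x\<close> and \<open>merge_x\<close> serve as
  \<open>\<sigma>\<close>, \<open>\<xi>\<close> and \<open>\<tau>\<close> of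
  \<open>retracts_bridge\<close>: remove e and leave 1 at the far component, remove e and put x
  there, and undo the latter.\<close>

definition unmerge :: "'v \<Rightarrow> nat set \<Rightarrow> nat set \<Rightarrow> nat \<Rightarrow> (nat set \<times> 'v set) endo" where
  "unmerge w F A e = Endo (\<lambda>c (I, U). if (I, U) \<in> block w F A \<and> (insert e I, U) \<in> valid {w}
     then sg e I * c (insert e I, U) else 0)"

definition unmerge_x :: "'v \<Rightarrow> nat set \<Rightarrow> nat set \<Rightarrow> nat \<Rightarrow> 'v \<Rightarrow> (nat set \<times> 'v set) endo" where
  "unmerge_x w F A e v = Endo (\<lambda>c (I, U). if (I, U) \<in> block w F A \<and> v \<in> U
     then sg e I * c (insert e I, U - comp_of I v) else 0)"

definition merge_x :: "'v \<Rightarrow> nat set \<Rightarrow> nat set \<Rightarrow> nat \<Rightarrow> 'v \<Rightarrow> (nat set \<times> 'v set) endo" where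
  "merge_x w F A e v = Endo (\<lambda>c (J, U). if (J, U) \<in> block w (insert e F) A
     then sg e J * c (J - {e}, U \<union> comp_of (J - {e}) v) else 0)"

lemma app_unmerge: "app (unmerge w F A e) c (I, U) =
    (if (I, U) \<in> block w F A \<and> (insert e I, U) \<in> valid {w} then sg e I * c (insert e I, U) else 0)"
  unfolding unmerge_def by (subst app_Endo) (auto simp: algebra_simps split: prod.split)

lemma app_unmerge_x: "app (unmerge_x w F A e v) c (I, U) =
    (if (I, U) \<in> block w F A \<and> v \<in> U then sg e I * c (insert e I, U - comp_of I v) else 0)"
  unfolding unmerge_x_def by (subst app_Endo) (auto simp: algebra_simps split: prod.split)

lemma app_merge_x: "app (merge_x w F A e v) c (J, U) =
    (if (J, U) \<in> block w (insert e F) A then sg e J * c (J - {e}, U \<union> comp_of (J - {e}) v) else 0)"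
  unfolding merge_x_def by (subst app_Endo) (auto simp: algebra_simps split: prod.split)

lemma app_dd_edge: "app (dd W {e}) c (J, U) = (if (J, U) \<in> valid W \<and> e \<in> J
    then sg e (J - {e}) * pull e (J - {e}) (\<lambda>X. c (J - {e}, X)) U else 0)"
proof (cases "e \<in> J")
  case True
  then have "J \<inter> {e} = {e}" by auto
  then show ?thesis using True by (simp add: app_dd)
qed (simp add: app_dd)

end

section \<open>One step of deletion and contraction\<close>

locale block_step = ugraph +
  fixes w :: 'a and F A :: "nat set" and e :: nat
  assumes w: "w \<in> V" and FA: "F \<subseteq> E" "A \<subseteq> E" "F \<inter> A = {}" "e \<in> E" "e \<notin> F" "e \<notin> A"
begin

lemma block_FD:
  assumes "(I, U) \<in> block w F A"
  shows "e \<notin> I" "F \<subseteq> I" "I \<subseteq> F \<union> A" "(I, U) \<in> valid {w}" "w \<notin> U"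
  using assms FA by (auto simp: block_def valid_def)

lemma block_eFD:
  assumes "(J, U) \<in> block w (insert e F) A"
  shows "e \<in> J" "(J, U) \<in> valid {w}" "w \<notin> U" "J - {e} - A = F" "insert e (J - {e}) = J"
    "(J - {e}, U) \<in> block w F A"
proof -
  show "e \<in> J" "(J, U) \<in> valid {w}" "w \<notin> U" "J - {e} - A = F" "insert e (J - {e}) = J"
    using assms FA by (auto simp: block_def valid_def)
  then show "(J - {e}, U) \<in> block w F A" using valid_mono[of J U "{w}" "J - {e}"] by (auto simp: block_def)
qed

lemma block_eFI: "(I, X) \<in> block w F A \<Longrightarrow> (insert e I, U) \<in> valid {w} \<Longrightarrow> (insert e I, U) \<in> block w (insert e F) A"
  using FA by (auto simp: block_def)

lemma unmerge_restr:
  "restr (block w F A) * unmerge w F A e = unmerge w F A e"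
  "unmerge w F A e * restr (block w (insert e F) A) = unmerge w F A e"
proof -
  show "restr (block w F A) * unmerge w F A e = unmerge w F A e"
    by (rule endo_eqI) (auto simp: app_unmerge)
  show "unmerge w F A e * restr (block w (insert e F) A) = unmerge w F A e"
    by (rule endo_eqI) (auto simp: app_unmerge dest: block_eFI)
qed

text \<open>Adding \<open>e\<close> acts as the identity on the labellings that survive.\<close>

lemma
  assumes pull_e: "\<And>I U f. (insert e I, U) \<in> valid {w} \<Longrightarrow> (I, U) \<in> block w F A \<Longrightarrow> pull e I f U = f U"
  shows dd_unmerge: "dd {w} {e} * unmerge w F A e = restr (block w (insert e F) A)"
    and app_unmerge_dd: "app (unmerge w F A e * dd {w} {e}) c (I, U) =
      (if (I, U) \<in> block w F A \<and> (insert e I, U) \<in> valid {w} then c (I, U) else 0)"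
proof -
  show "dd {w} {e} * unmerge w F A e = restr (block w (insert e F) A)"
  proof (rule endo_eqI)
    fix c and i :: "nat set \<times> 'a set"
    obtain J U where i: "i = (J, U)" by (cases i)
    show "app (dd {w} {e} * unmerge w F A e) c i = app (restr (block w (insert e F) A)) c i"
    proof (cases "(J, U) \<in> block w (insert e F) A")
      case True
      note b = block_eFD[OF True]
      have "pull e (J - {e}) f U = f U" for f using b by (intro pull_e) auto
      then show ?thesis using True b by (simp add: i app_dd_edge app_unmerge)
    next
      case False
      have "pull e (J - {e}) (\<lambda>X. app (unmerge w F A e) c (J - {e}, X)) U = 0" if J: "(J, U) \<in> valid {w}" "e \<in> J"
      proof -
        have "J - {e} - A \<noteq> F" using False J FA by (auto simp: block_def)
        then have "app (unmerge w F A e) c (J - {e}, X) = 0" for X by (simp add: app_unmerge block_def)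
        then show ?thesis by (simp add: pull_def)
      qed
      then show ?thesis using False by (simp add: i app_dd_edge)
    qed
  qed
  show "app (unmerge w F A e * dd {w} {e}) c (I, U) =
      (if (I, U) \<in> block w F A \<and> (insert e I, U) \<in> valid {w} then c (I, U) else 0)"
    using pull_e block_FD(1)[of I U] by (auto simp: app_unmerge app_dd_edge)
qed

lemma reads_unmerge:
  assumes "\<And>I U. (insert e I, U) \<in> valid {w} \<Longrightarrow> (I, U) \<in> block w F A \<Longrightarrow> deg (insert e I) U = deg I U"
  shows "reads (unmerge w F A e) (grade {w} 1 0)"
  unfolding reads_def
proof (intro allI impI)
  fix s and c c' :: "nat set \<times> 'a set \<Rightarrow> int"
  assume eq: "\<forall>t. (s, t) \<in> grade {w} 1 0 \<longrightarrow> c t = c' t"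
  obtain I U where s: "s = (I, U)" by (cases s)
  show "app (unmerge w F A e) c s = app (unmerge w F A e) c' s"
    using eq assms[of I U] block_FD[of I U] validD(5)[of I U "{w}"] by (auto simp: s app_unmerge grade_def)
qed

lemma sg_edges:
  assumes "finite J" "r \<in> J" "e \<notin> J" "r \<noteq> e"
  shows "sg r J * (sg e (J - {r}) * x) = - (sg e J * (sg r (insert e J) * x))"
proof -
  define K where "K = J - {r}"
  have K: "J = insert r K" "r \<notin> K" "e \<notin> K" "finite K" using assms by (auto simp: K_def)
  have "sg r (insert e J) = sg r (insert e K)" unfolding K(1) insert_commute[of e] by simp
  then have "sg r J * sg e K = - (sg e J * sg r (insert e J))"
    using sg_swap'[OF assms(4) K(4,2,3)] K(1) by simp
  then show ?thesis unfolding K_def[symmetric] by (metis mult.assoc mult_minus_left)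
qed

text \<open>The ends of e are already joined by contracted edges, so adding e changes no component
  and maps the deletion block isomorphically to the contraction block.\<close>

lemma retracts_loop_edge:
  assumes "b e \<in> comp_of F (a e)"
  shows "retracts (restr (block w F (insert e A))) (dd {w} (insert e A)) (unmerge w F A e) 0"
    and "reads (unmerge w F A e) (grade {w} 1 0)"
proof -
  have loop: "b e \<in> comp_of I (a e)" if "F \<subseteq> I" for I using assms comp_mono[OF that] by blast
  have pull_e: "pull e I f U = f U" if "(I, U) \<in> block w F A" for I f U
    using loop[of I] block_FD[OF that] by (simp add: pull_def)
  have vI: "(insert e I, U) \<in> valid {w}" if "(I, U) \<in> block w F A" for I U
    using block_FD[OF that] loop[of I] FA(4) unfolding valid_def
    by (auto simp: sat_insert_same simp del: sat_simps)
  have "dd {w} A * unmerge w F A e = - (unmerge w F A e * dd {w} A)"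
  proof (rule endo_eqI)
    fix c and i :: "nat set \<times> 'a set"
    obtain J U where i: "i = (J, U)" by (cases i)
    show "app (dd {w} A * unmerge w F A e) c i = app (- (unmerge w F A e * dd {w} A)) c i"
    proof (cases "(J, U) \<in> block w F A")
      case True
      note b = block_FD[OF True]
      have JA: "insert e J \<inter> A = J \<inter> A" using FA by auto
      have "app (dd {w} A) (app (unmerge w F A e) c) (J, U) = (\<Sum>r\<in>J \<inter> A. sg r J *
          (sg e (J - {r}) * pull r (insert e J - {r}) (\<lambda>X. c (insert e J - {r}, X)) U))"
      proof -
        have "pull r (J - {r}) (\<lambda>X. app (unmerge w F A e) c (J - {r}, X)) U =
            sg e (J - {r}) * pull r (insert e J - {r}) (\<lambda>X. c (insert e J - {r}, X)) U" if r: "r \<in> J \<inter> A" for r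
        proof -
          have J: "insert r (J - {r}) = J" "F \<subseteq> J - {r}" "insert e (J - {r}) = insert e J - {r}"
            "J - {r} - A = F" using r FA b True by (auto simp: block_def)
          have "pull r (J - {r}) (\<lambda>X. app (unmerge w F A e) c (J - {r}, X)) U =
              pull r (J - {r}) (\<lambda>X. sg e (J - {r}) * c (insert e J - {r}, X)) U"
          proof (rule pull_cong)
            fix X assume "(J - {r}, X) \<in> valid {w}"
            then have B: "(J - {r}, X) \<in> block w F A" using J by (simp add: block_def)
            then show "app (unmerge w F A e) c (J - {r}, X) = sg e (J - {r}) * c (insert e J - {r}, X)"
              using vI[OF B, unfolded J(3)] J(3) by (simp add: app_unmerge)
          qed (use b J in auto)
          also have "\<dots> = sg e (J - {r}) * pull r (J - {r}) (\<lambda>X. c (insert e J - {r}, X)) U"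
            by (simp add: pull_def distrib_left)
          also have "comp_of (J - {r}) = comp_of (insert e J - {r})"
            unfolding J(3)[symmetric] by (rule comp_insert_same[symmetric]) (rule loop[OF J(2)])
          then have "pull r (J - {r}) f U = pull r (insert e J - {r}) f U" for f by (simp add: pull_def)
          finally show ?thesis by simp
        qed
        then show ?thesis using b by (simp add: app_dd)
      qed
      also have "\<dots> = - (\<Sum>r\<in>J \<inter> A. sg e J * (sg r (insert e J) *
          pull r (insert e J - {r}) (\<lambda>X. c (insert e J - {r}, X)) U))"
        unfolding sum_negf[symmetric] using b FA validD(5)[OF b(4)]
        by (intro sum.cong refl sg_edges) auto
      also have "\<dots> = - app (unmerge w F A e) (app (dd {w} A) c) (J, U)"
        using True vI[OF True] by (simp add: app_unmerge app_dd JA sum_distrib_left)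
      finally show ?thesis by (simp add: i)
    next
      case False
      have "app (dd {w} A) (app (unmerge w F A e) c) (J, U) = app (dd {w} A) (\<lambda>_. 0) (J, U)"
      proof (rule app_dd_cong)
        fix r assume v: "(J, U) \<in> valid {w}" and r: "r \<in> J \<inter> A"
        have "J - {r} - A \<noteq> F" using r v False by (auto simp: block_def)
        then have "(J - {r}, X) \<notin> block w F A" for X by (simp add: block_def)
        then show "pull r (J - {r}) (\<lambda>X. app (unmerge w F A e) c (J - {r}, X)) U = pull r (J - {r}) (\<lambda>_. 0) U"
          by (simp add: app_unmerge)
      qed
      then show ?thesis using False by (simp add: i app_unmerge)
    qed
  qed
  moreover have "unmerge w F A e * dd {w} {e} = restr (block w F A)"
  proof (rule endo_eqI)
    fix c and i :: "nat set \<times> 'a set"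
    show "app (unmerge w F A e * dd {w} {e}) c i = app (restr (block w F A)) c i"
      using app_unmerge_dd[OF pull_e, of c "fst i" "snd i"] vI[of "fst i" "snd i"] by (cases i) auto
  qed
  moreover have "dd {w} (insert e A) = dd {w} A + dd {w} {e}"
    using edge_op_Un[OF lin_pull, of A "{e}" "{w}"] FA by (simp add: dd_def)
  ultimately show "retracts (restr (block w F (insert e A))) (dd {w} (insert e A)) (unmerge w F A e) 0"
    unfolding restr_block_insert(1)[OF FA(6,5)]
    using restr_block_insert(2,3)[OF FA(6,5), of w] unmerge_restr dd_unmerge[OF pull_e]
    by (simp add: retracts_loop)
  show "reads (unmerge w F A e) (grade {w} 1 0)"
    by (rule reads_unmerge) (use loop block_FD in \<open>simp add: deg_def comp_insert_same\<close>)
qed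

text \<open>
  If \<open>e\<close> is a bridge from the root to \<open>v\<close>, the generators with \<open>1\<close> at \<open>v\<close> cancel against those that
  contain \<open>e\<close>, and the complex shrinks to a shifted copy of the contraction, with \<open>x\<close> at \<open>v\<close>.
\<close>

lemma unmerge_x_local:
  assumes v: "(insert r I, U) \<in> valid {w}" "v \<in> U" "u \<notin> U"
    and e: "{a e, b e} = {u, v}"
  shows "pull r I (\<lambda>X. if v \<in> X then f (X - comp_of I v) else 0) U =
    pull r (insert e I) f (U - comp_of (insert r I) v)"
proof -
  let ?P = "comp_of I (a r)" and ?Q = "comp_of I (b r)"
  have sJ: "sat (insert r I) U" using validD(4)[OF v(1)] .
  then have sI: "sat I U" and ab: "a r \<in> U \<longleftrightarrow> b r \<in> U" by auto
  have cJ: "comp_of (insert r I) v = (if v \<in> ?P \<union> ?Q then ?P \<union> ?Q else comp_of I v)" by (rule comp_insert)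
  have ce: "comp_of (insert e I) x = comp_of I x" if "x \<notin> comp_of I u" "x \<notin> comp_of I v" for x
    using that e by (auto simp: comp_insert doubleton_eq_iff)
  show ?thesis
  proof (cases "b r \<in> ?P")
    case True
    then have "comp_of (insert r I) v = comp_of I v" by (simp add: comp_insert_same)
    moreover have "b r \<in> comp_of (insert e I) (a r)" using True comp_mono[of I "insert e I"] by blast
    ultimately show ?thesis using True v(2) by (simp add: pull_def)
  next
    case PQ: False
    have disj: "?P \<inter> ?Q = {}" using PQ comp_disjoint by blast
    show ?thesis
    proof (cases "a r \<in> U")
      case False
      then have "v \<notin> ?P \<union> ?Q" using sat_disjoint[OF sI] ab v(2) by blast
      then show ?thesis using False v(2) by (simp add: pull_def cJ)
    next
      case True
      have nu: "x \<notin> comp_of I u" if "x \<in> U" for x using sat_disjoint[OF sI v(3)] that by blast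
      \<comment> \<open>If the component of v is one of the two merged by r, only the summand of
        \<open>pull\<close> that still labels v survives on the left; on the right the merged
        component is removed as a whole.\<close>
      consider "v \<in> ?P" | "v \<in> ?Q" | "v \<notin> ?P" "v \<notin> ?Q" by blast
      then show ?thesis
      proof cases
        case 1
        then have "v \<notin> ?Q" "comp_of I v = ?P" using disj comp_eq by auto
        moreover have "U - ?Q - ?P = U - (?P \<union> ?Q)" by blast
        ultimately show ?thesis using 1 True PQ v(2) by (simp add: pull_def cJ)
      next
        case 2
        then have "v \<notin> ?P" "comp_of I v = ?Q" using disj comp_eq by auto
        moreover have "U - ?P - ?Q = U - (?P \<union> ?Q)" by blast
        ultimately show ?thesis using 2 True PQ v(2) by (simp add: pull_def cJ)
      next
        case 3
        then have nv: "a r \<notin> comp_of I v" "b r \<notin> comp_of I v" by (metis comp_eq comp_self)+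
        have "comp_of (insert e I) (a r) = ?P" "comp_of (insert e I) (b r) = ?Q"
          using ce nu nv True ab by auto
        moreover have "U - ?P - comp_of I v = U - comp_of I v - ?P" "U - ?Q - comp_of I v = U - comp_of I v - ?Q"
          by auto
        ultimately show ?thesis using 3 True PQ v(2) nv by (simp add: pull_def cJ)
      qed
    qed
  qed
qed

text \<open>Contracting e absorbs the component of v into the root: one edge more, one other
  component less. The number of the diagonal in \<open>block_retraction\<close> therefore does not
  change.\<close>

lemma deg_root_insert:
  assumes uv: "{a e, b e} = {u, v}" "u \<in> comp_of F w" and v: "v \<notin> comp_of F w"
  shows "deg F (V - comp_of F w) = Suc (deg (insert e F) (V - comp_of (insert e F) w))"
proof -
  have fin: "finite (V - comp_of F w)" using finite_V by simp
  have sV: "sat F V" using FA ends_in by (auto simp: sat_def)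
  have "v \<in> {a e, b e}" unfolding uv(1) by simp
  then have vV: "v \<in> V" using ends_in[OF FA(4)] by auto
  have cv: "comp_of F u = comp_of F w" using uv(2) by (rule comp_eq)
  have R: "comp_of (insert e F) w = comp_of F w \<union> comp_of F v"
  proof -
    from uv(1) consider "a e = u" "b e = v" | "a e = v" "b e = u" by (auto simp: doubleton_eq_iff)
    then have "comp_of F (a e) \<union> comp_of F (b e) = comp_of F w \<union> comp_of F v"
      by cases (simp_all add: cv Un_commute)
    then show ?thesis by (simp add: comp_insert)
  qed
  have "deg F (V - comp_of F w) = Suc (deg F (V - comp_of F w - comp_of F v))"
    using deg_Diff[OF fin _ , of F v] v vV sV by (simp add: sat_Diff)
  also have "V - comp_of F w - comp_of F v = V - comp_of (insert e F) w" unfolding R by blast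
  also have "deg F (V - comp_of (insert e F) w) = deg (insert e F) (V - comp_of (insert e F) w)"
  proof (rule deg_insert_out[symmetric])
    show "sat F (V - comp_of (insert e F) w)" unfolding R by (intro sat_Diff sat_Un sV comp_sat)
    have "a e \<in> comp_of F w \<union> comp_of F v" "b e \<in> comp_of F w \<union> comp_of F v"
    proof -
      have "{a e, b e} \<subseteq> comp_of F w \<union> comp_of F v" unfolding uv(1) using comp_self[of u F] cv by simp
      then show "a e \<in> comp_of F w \<union> comp_of F v" "b e \<in> comp_of F w \<union> comp_of F v" by simp_all
    qed
    then show "a e \<notin> V - comp_of (insert e F) w" "b e \<notin> V - comp_of (insert e F) w"
      unfolding R by auto
  qed
  finally show ?thesis .
qed

section \<open>Bridges from the root component to v\<close>

context
  fixes u v :: 'a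
  assumes uv: "{a e, b e} = {u, v}" "u \<in> comp_of F w" "v \<notin> comp_of (F \<union> A) w"
begin

lemma u_comp: "F \<subseteq> I \<Longrightarrow> u \<in> comp_of I w"
  using uv(2) comp_mono by blast

lemma v_comp: "I \<subseteq> F \<union> A \<Longrightarrow> w \<notin> comp_of I v"
  using uv(3) comp_mono[of I "F \<union> A" v] comp_eq[of w "F \<union> A" v] comp_self by blast

lemma u_notin: "(I, U) \<in> valid {w} \<Longrightarrow> F \<subseteq> I \<Longrightarrow> u \<notin> U"
  using u_comp[of I] sat_disjoint[of I U w] by (auto simp: valid_def)

lemma valid_insert_e:
  assumes "(I, U) \<in> block w F A"
  shows "(insert e I, U) \<in> valid {w} \<longleftrightarrow> v \<notin> U"
proof -
  have "u \<notin> U" using block_FD[OF assms] u_notin by blast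
  then have "a e \<in> U \<longleftrightarrow> b e \<in> U \<longleftrightarrow> v \<notin> U" using uv(1) by (auto simp: doubleton_eq_iff)
  then have "(a e \<in> U \<longleftrightarrow> b e \<in> U) \<longleftrightarrow> v \<notin> U" using uv(1) \<open>u \<notin> U\<close> by (auto simp: doubleton_eq_iff)
  then show ?thesis using block_FD[OF assms] FA by (auto simp: valid_def)
qed

text \<open>Once e is present, v lies in the root component, which always has label 1.\<close>

lemma ends_e_notin:
  assumes "(J, U) \<in> valid {w}" "F \<subseteq> J" "e \<in> J"
  shows "a e \<notin> U" "b e \<notin> U" "v \<notin> U"
proof -
  have "u \<notin> U" using assms u_notin by blast
  moreover have "a e \<in> U \<longleftrightarrow> b e \<in> U" using validD(4)[OF assms(1)] assms(3) by (simp add: sat_def)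
  ultimately show "a e \<notin> U" "b e \<notin> U" "v \<notin> U" using uv(1) by (auto simp: doubleton_eq_iff)
qed

lemma bridge_pull_e:
  assumes "(insert e I, U) \<in> valid {w}" "(I, U) \<in> block w F A"
  shows "pull e I f U = f U"
  using ends_e_notin[OF assms(1)] block_FD(2)[OF assms(2)] by (simp add: pull_def subset_insertI2)

lemma add_v_block:
  assumes "(J, U) \<in> block w (insert e F) A"
  shows "(J - {e}, U \<union> comp_of (J - {e}) v) \<in> block w F A"
proof -
  note b = block_eFD[OF assms] block_FD[OF block_eFD(6)[OF assms]]
  have "v \<in> V" using uv(1) ends_in[OF FA(4)] by (auto simp: doubleton_eq_iff)
  moreover have "w \<notin> comp_of (J - {e}) v" using b by (intro v_comp) auto
  moreover have "J - {e} \<subseteq> E" using b(2) by (auto simp: valid_def)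
  ultimately have "comp_of (J - {e}) v \<subseteq> V - {w}" using comp_subset_V by blast
  then show ?thesis using b(6) by (auto simp: block_def valid_def sat_Un)
qed

lemma remove_v_block:
  assumes "(I, U) \<in> block w F A"
  shows "(I, U - comp_of I v) \<in> block w F A" "(insert e I, U - comp_of I v) \<in> block w (insert e F) A"
proof -
  show B: "(I, U - comp_of I v) \<in> block w F A"
    using assms valid_Diff[of I U "{w}" "comp_of I v"] by (simp add: block_def)
  show "(insert e I, U - comp_of I v) \<in> block w (insert e F) A"
    using valid_insert_e[OF B] by (intro block_eFI[OF B]) simp
qed

lemma bridge_restr:
  "restr (block w F A) * unmerge_x w F A e v = unmerge_x w F A e v"
  "unmerge_x w F A e v * restr (block w (insert e F) A) = unmerge_x w F A e v"
  "restr (block w (insert e F) A) * merge_x w F A e v = merge_x w F A e v"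
  "merge_x w F A e v * restr (block w F A) = merge_x w F A e v"
proof -
  show "restr (block w F A) * unmerge_x w F A e v = unmerge_x w F A e v"
    by (rule endo_eqI) (auto simp: app_unmerge_x)
  show "restr (block w (insert e F) A) * merge_x w F A e v = merge_x w F A e v"
    by (rule endo_eqI) (auto simp: app_merge_x)
  show "unmerge_x w F A e v * restr (block w (insert e F) A) = unmerge_x w F A e v"
  proof (rule endo_eqI)
    fix c and i :: "nat set \<times> 'a set"
    obtain I U where i: "i = (I, U)" by (cases i)
    show "app (unmerge_x w F A e v * restr (block w (insert e F) A)) c i = app (unmerge_x w F A e v) c i"
      by (simp add: i app_unmerge_x remove_v_block)
  qed
  show "merge_x w F A e v * restr (block w F A) = merge_x w F A e v"
  proof (rule endo_eqI)
    fix c and i :: "nat set \<times> 'a set"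
    obtain J U where i: "i = (J, U)" by (cases i)
    show "app (merge_x w F A e v * restr (block w F A)) c i = app (merge_x w F A e v) c i"
      by (simp add: i app_merge_x add_v_block)
  qed
qed

lemma merge_unmerge_x: "merge_x w F A e v * unmerge_x w F A e v = restr (block w (insert e F) A)"
proof (rule endo_eqI)
  fix c and i :: "nat set \<times> 'a set"
  obtain J U where i: "i = (J, U)" by (cases i)
  show "app (merge_x w F A e v * unmerge_x w F A e v) c i = app (restr (block w (insert e F) A)) c i"
  proof (cases "(J, U) \<in> block w (insert e F) A")
    case True
    note b = block_eFD[OF True] block_FD[OF block_eFD(6)[OF True]]
    have "v \<notin> U" using ends_e_notin[OF b(2)] b by blast
    then have "comp_of (J - {e}) v \<inter> U = {}" using validD(4)[OF b(10)] by (intro sat_disjoint)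
    then have U: "U \<union> comp_of (J - {e}) v - comp_of (J - {e}) v = U" by blast
    from add_v_block[OF True] show ?thesis using True b(5) by (simp add: i app_merge_x app_unmerge_x U)
  qed (simp add: i app_merge_x)
qed

lemma dd_e_unmerge_x: "dd {w} {e} * unmerge_x w F A e v = 0"
proof (rule endo_eqI)
  fix c and i :: "nat set \<times> 'a set"
  obtain J U where i: "i = (J, U)" by (cases i)
  have "pull e (J - {e}) (\<lambda>X. app (unmerge_x w F A e v) c (J - {e}, X)) U = 0"
    if J: "(J, U) \<in> valid {w}" "e \<in> J"
  proof (cases "F \<subseteq> J")
    case True
    then show ?thesis using ends_e_notin[OF J(1) True J(2)] by (simp add: pull_def app_unmerge_x)
  next
    case False
    then have "(J - {e}, X) \<notin> block w F A" for X using block_FD(2) by blast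
    then show ?thesis by (simp add: pull_def app_unmerge_x)
  qed
  then show "app (dd {w} {e} * unmerge_x w F A e v) c i = app 0 c i" by (simp add: i app_dd_edge)
qed

text \<open>In the deletion block the component of v has label 1 or x; the two summands project onto
  these two kinds of labellings.\<close>

lemma bridge_split:
  "unmerge w F A e * dd {w} {e} + unmerge_x w F A e v * merge_x w F A e v = restr (block w F A)"
proof (rule endo_eqI)
  fix c and i :: "nat set \<times> 'a set"
  obtain I U where i: "i = (I, U)" by (cases i)
  have 1: "app (unmerge w F A e * dd {w} {e}) c (I, U) =
      (if (I, U) \<in> block w F A \<and> (insert e I, U) \<in> valid {w} then c (I, U) else 0)"
    by (rule app_unmerge_dd[OF bridge_pull_e])
  show "app (unmerge w F A e * dd {w} {e} + unmerge_x w F A e v * merge_x w F A e v) c i =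
      app (restr (block w F A)) c i"
  proof (cases "(I, U) \<in> block w F A")
    case True
    note b = block_FD[OF True]
    show ?thesis
    proof (cases "v \<in> U")
      case vU: True
      note B = remove_v_block(2)[OF True]
      have "comp_of I v \<subseteq> U" using validD(4)[OF b(4)] vU by (intro comp_least)
      then have "U - comp_of I v \<union> comp_of I v = U" "insert e I - {e} = I" using b(1) by auto
      then have "app (unmerge_x w F A e v) (app (merge_x w F A e v) c) (I, U) = c (I, U)"
        using True vU B b(1) by (simp add: app_unmerge_x app_merge_x)
      then show ?thesis using 1 True vU valid_insert_e[OF True] by (simp add: i)
    next
      case False
      then show ?thesis using 1 True valid_insert_e[OF True] by (simp add: i app_unmerge_x)
    qed
  next
    case False
    then show ?thesis using 1 by (simp add: i app_unmerge_x)
  qed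
qed

lemma dd_unmerge_x: "dd {w} A * unmerge_x w F A e v = - (unmerge_x w F A e v * dd {w} A)"
proof (rule endo_eqI)
  fix c and i :: "nat set \<times> 'a set"
  obtain J U where i: "i = (J, U)" by (cases i)
  show "app (dd {w} A * unmerge_x w F A e v) c i = app (- (unmerge_x w F A e v * dd {w} A)) c i"
  proof (cases "(J, U) \<in> block w F A")
    case True
    note b = block_FD[OF True]
    have JA: "insert e J \<inter> A = J \<inter> A" using FA by auto
    have red: "pull r (J - {r}) (\<lambda>X. app (unmerge_x w F A e v) c (J - {r}, X)) U =
        (if v \<in> U then sg e (J - {r}) *
          pull r (insert e J - {r}) (\<lambda>X. c (insert e J - {r}, X)) (U - comp_of J v) else 0)" if r: "r \<in> J \<inter> A" for r
    proof -
      have J: "insert r (J - {r}) = J" "insert e (J - {r}) = insert e J - {r}"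
        "J - {r} - A = F" using r FA b True by (auto simp: block_def)
      have "pull r (J - {r}) (\<lambda>X. app (unmerge_x w F A e v) c (J - {r}, X)) U =
          pull r (J - {r}) (\<lambda>X. sg e (J - {r}) *
            (if v \<in> X then c (insert e J - {r}, X - comp_of (J - {r}) v) else 0)) U"
      proof (rule pull_cong)
        fix X assume "(J - {r}, X) \<in> valid {w}"
        then have "(J - {r}, X) \<in> block w F A" using J by (simp add: block_def)
        then show "app (unmerge_x w F A e v) c (J - {r}, X) = sg e (J - {r}) *
            (if v \<in> X then c (insert e J - {r}, X - comp_of (J - {r}) v) else 0)"
          using J(2) by (simp add: app_unmerge_x)
      qed (use b J in auto)
      also have "\<dots> = sg e (J - {r}) * pull r (J - {r})
          (\<lambda>X. if v \<in> X then c (insert e J - {r}, X - comp_of (J - {r}) v) else 0) U"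
        by (simp add: pull_def distrib_left)
      finally have 1: "pull r (J - {r}) (\<lambda>X. app (unmerge_x w F A e v) c (J - {r}, X)) U = \<dots>" .
      show ?thesis
      proof (cases "v \<in> U")
        case vU: True
        have v: "(insert r (J - {r}), U) \<in> valid {w}" using b(4) J(1) by simp
        have "u \<notin> U" using u_notin[OF b(4,2)] .
        from unmerge_x_local[OF v vU this uv(1), of "\<lambda>X. c (insert e J - {r}, X)"] show ?thesis
          unfolding 1 J using vU by simp
      next
        case False
        then show ?thesis unfolding 1 by (simp add: pull_def)
      qed
    qed
    show ?thesis
    proof (cases "v \<in> U")
      case vU: True
      have B: "(insert e J, U - comp_of J v) \<in> valid {w}" using remove_v_block(2)[OF True] by (rule block_eFD)
      have "app (dd {w} A) (app (unmerge_x w F A e v) c) (J, U) = (\<Sum>r\<in>J \<inter> A. sg r J *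
          (sg e (J - {r}) * pull r (insert e J - {r}) (\<lambda>X. c (insert e J - {r}, X)) (U - comp_of J v)))"
        using b(4) vU by (simp add: app_dd red)
      also have "\<dots> = - (\<Sum>r\<in>J \<inter> A. sg e J * (sg r (insert e J) *
          pull r (insert e J - {r}) (\<lambda>X. c (insert e J - {r}, X)) (U - comp_of J v)))"
        unfolding sum_negf[symmetric] using b FA validD(5)[OF b(4)]
        by (intro sum.cong refl sg_edges) auto
      also have "\<dots> = - app (unmerge_x w F A e v) (app (dd {w} A) c) (J, U)"
        using True vU B by (simp add: app_unmerge_x app_dd JA sum_distrib_left)
      finally show ?thesis by (simp add: i)
    next
      case False
      then show ?thesis using b(4) red
        by (simp add: i app_dd app_unmerge_x[where I = J and U = U] sum.neutral)
    qed
  next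
    case False
    have "app (dd {w} A) (app (unmerge_x w F A e v) c) (J, U) = app (dd {w} A) (\<lambda>_. 0) (J, U)"
    proof (rule app_dd_cong)
      fix r assume v: "(J, U) \<in> valid {w}" and r: "r \<in> J \<inter> A"
      have "J - {r} - A \<noteq> F" using r v False by (auto simp: block_def)
      then have "(J - {r}, X) \<notin> block w F A" for X by (simp add: block_def)
      then show "pull r (J - {r}) (\<lambda>X. app (unmerge_x w F A e v) c (J - {r}, X)) U = pull r (J - {r}) (\<lambda>_. 0) U"
        by (simp add: app_unmerge_x)
    qed
    then show ?thesis using False by (simp add: i app_unmerge_x)
  qed
qed

lemma reads_unmerge_bridge: "reads (unmerge w F A e) (grade {w} 1 0)"
proof (rule reads_unmerge, rule deg_insert_out)
  fix I U assume v: "(insert e I, U) \<in> valid {w}" and B: "(I, U) \<in> block w F A"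
  have "F \<subseteq> insert e I" using block_FD(2)[OF B] by auto
  then show "a e \<notin> U" "b e \<notin> U" using ends_e_notin[OF v] by auto
  show "sat I U" using block_FD(4)[OF B] by (rule validD)
qed

lemma reads_unmerge_x: "reads (unmerge_x w F A e v) (grade {w} 1 (- 1))"
  unfolding reads_def
proof (intro allI impI)
  fix s and c c' :: "nat set \<times> 'a set \<Rightarrow> int"
  assume eq: "\<forall>t. (s, t) \<in> grade {w} 1 (- 1) \<longrightarrow> c t = c' t"
  obtain I U where s: "s = (I, U)" by (cases s)
  show "app (unmerge_x w F A e v) c s = app (unmerge_x w F A e v) c' s"
  proof (cases "(I, U) \<in> block w F A \<and> v \<in> U")
    case True
    then have B: "(I, U) \<in> block w F A" and v: "v \<in> U" by auto
    note b = block_FD[OF B]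
    note B' = remove_v_block(1)[OF B]
    have val: "(insert e I, U - comp_of I v) \<in> valid {w}" using remove_v_block(2)[OF B] by (rule block_eFD)
    have "F \<subseteq> insert e I" using b(2) by auto
    then have "deg (insert e I) (U - comp_of I v) = deg I (U - comp_of I v)"
      using ends_e_notin[OF val] validD(4)[OF block_FD(4)[OF B']] by (intro deg_insert_out) auto
    moreover have "deg I U = Suc (deg I (U - comp_of I v))"
      using validD[OF b(4)] v by (intro deg_Diff)
    ultimately have "((I, U), (insert e I, U - comp_of I v)) \<in> grade {w} 1 (- 1)"
      using b val validD(5)[OF b(4)] by (simp add: grade_def)
    then show ?thesis using eq by (simp add: s app_unmerge_x)
  qed (auto simp: s app_unmerge_x)
qed

lemma reads_merge_x: "reads (merge_x w F A e v) (grade {w} (- 1) 1)"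
  unfolding reads_def
proof (intro allI impI)
  fix s and c c' :: "nat set \<times> 'a set \<Rightarrow> int"
  assume eq: "\<forall>t. (s, t) \<in> grade {w} (- 1) 1 \<longrightarrow> c t = c' t"
  obtain J U where s: "s = (J, U)" by (cases s)
  show "app (merge_x w F A e v) c s = app (merge_x w F A e v) c' s"
  proof (cases "(J, U) \<in> block w (insert e F) A")
    case True
    note b = block_eFD[OF True] block_FD[OF block_eFD(6)[OF True]]
    let ?I = "J - {e}" and ?C = "comp_of (J - {e}) v"
    have val: "(?I, U \<union> ?C) \<in> valid {w}" using add_v_block[OF True] by (rule block_FD)
    have FJ: "F \<subseteq> J" using b(8) by auto
    note out = ends_e_notin[OF b(2) FJ b(1)]
    have sI: "sat ?I U" using b(10) by (rule validD)
    have "?C \<inter> U = {}" using sI out(3) by (rule sat_disjoint)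
    then have "U \<union> ?C - ?C = U" by blast
    then have "deg ?I (U \<union> ?C) = Suc (deg ?I U)"
      using deg_Diff[of "U \<union> ?C" ?I v] validD(4,6)[OF val] by simp
    moreover have "deg (insert e ?I) U = deg ?I U" using sI out by (intro deg_insert_out)
    moreover have "card J = Suc (card ?I)" using b(1) validD(5)[OF b(2)] by (rule card.remove[rotated])
    ultimately have "((J, U), (?I, U \<union> ?C)) \<in> grade {w} (- 1) 1"
      using b(2,5) val by (simp add: grade_def)
    then show ?thesis using eq by (simp add: s app_merge_x)
  qed (auto simp: s app_merge_x)
qed

lemma retracts_bridge_edge:
  assumes "retracts (restr (block w (insert e F) A)) (dd {w} A) h P"
  defines "\<sigma> \<equiv> unmerge w F A e" and "\<xi> \<equiv> unmerge_x w F A e v" and "\<tau> \<equiv> merge_x w F A e v"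
  shows "retracts (restr (block w F (insert e A))) (dd {w} (insert e A))
    (\<sigma> - \<xi> * h * \<tau> + \<xi> * h * \<tau> * dd {w} A * \<sigma>) (\<xi> * P * \<tau> - \<xi> * P * \<tau> * dd {w} A * \<sigma>)"
proof -
  have d: "dd {w} (insert e A) = dd {w} A + dd {w} {e}"
    using edge_op_Un[OF lin_pull, of A "{e}" "{w}"] FA by (simp add: dd_def)
  have c: "dd {w} A * restr (block w F A) = restr (block w F A) * dd {w} A"
    "dd {w} A * restr (block w (insert e F) A) = restr (block w (insert e F) A) * dd {w} A"
    using FA by (auto intro!: dd_block_commute)
  note eb = dd_edge_block[OF FA(6,5), of w] and rb = restr_block_insert[OF FA(6,5), of w]
  note du = dd_unmerge[OF bridge_pull_e]
  show ?thesis
    unfolding d rb(1) \<sigma>_def \<xi>_def \<tau>_def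
    using retracts_bridge[OF dd_anticomm[of "{w}" "{e}" A] eb rb(2,3) c dd_dd[of "{w}" A] unmerge_restr
        bridge_restr du bridge_split merge_unmerge_x dd_e_unmerge_x dd_unmerge_x assms(1)] .
qed

end

end

context ugraph begin

section \<open>Rooted complexes are concentrated on a diagonal\<close>

definition diagonal :: "'v \<Rightarrow> int \<Rightarrow> int \<Rightarrow> int \<Rightarrow> ((nat set \<times> 'v set) \<times> (nat set \<times> 'v set)) set" where
  "diagonal w n p q = {(s, t) \<in> grade {w} p q. int (card (fst s)) + int (deg (fst s) (snd s)) = n}"

lemma reads_diagonal_left:
  assumes "reads X (grade {w} p q)" "reads P (diagonal w n p' q')"
  shows "reads (X * P) (diagonal w (n - p - q) (p + p') (q + q'))"
  by (rule reads_mult[OF assms]) (auto simp: diagonal_def grade_def)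

lemma reads_diagonal_right:
  assumes "reads P (diagonal w n p q)" "reads X (grade {w} p' q')"
  shows "reads (P * X) (diagonal w n (p + p') (q + q'))"
  by (rule reads_mult[OF assms]) (auto simp: diagonal_def grade_def)

text \<open>Induction on the number of free edges. The diagonal, \<open>card F\<close> plus the
  number of components of F other than the root, is the same after deleting an edge and after
  contracting one that leaves the root component. When no edge is free, every vertex is in the root
  component and the unlabelled generator is the only one.\<close>

lemma block_retraction:
  assumes "w \<in> V" "F \<subseteq> E" "A \<subseteq> E" "F \<inter> A = {}" "\<And>x. x \<in> V \<Longrightarrow> x \<in> comp_of (F \<union> A) w"
  shows "\<exists>h P. retracts (restr (block w F A)) (dd {w} A) h P \<and> reads h (grade {w} 1 0) \<and>
    reads P (diagonal w (int (card F) + int (deg F (V - comp_of F w))) 0 0)"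
  using assms(2-)
proof (induction "card A" arbitrary: F A rule: less_induct)
  case less
  have finA: "finite A" using less.prems(2) finite_E by (rule finite_subset)
  show ?case
  proof (cases "\<exists>e\<in>A. b e \<in> comp_of F (a e)")
    case True
    then obtain e where e: "e \<in> A" "b e \<in> comp_of F (a e)" by blast
    interpret block_step a b V E w F "A - {e}" e
      by unfold_locales (use assms(1) less.prems e in auto)
    have "insert e (A - {e}) = A" using e by auto
    then show ?thesis using retracts_loop_edge[OF e(2)] by (intro exI conjI) auto
  next
    case noloop: False
    show ?thesis
    proof (cases "A = {}")
      case True
      have V: "V \<subseteq> comp_of F w" using less.prems(4) True by auto
      have *: "U = {}" if "(F, U) \<in> valid {w}" for U
      proof (rule ccontr)
        assume "U \<noteq> {}"
        then obtain x where x: "x \<in> U" by blast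
        then have "w \<in> comp_of F x" using V validD(2)[OF that] comp_eq[of x F w] comp_self[of w F] by auto
        then show False using comp_least[OF validD(4)[OF that] x] validD(3)[OF that] by auto
      qed
      have "dd {w} A = 0" by (rule endo_eqI) (auto simp: True app_dd)
      then have "retracts (restr (block w F A)) (dd {w} A) 0 (restr (block w F A))"
        by (simp add: retracts_def restr_mult)
      moreover have "reads (restr (block w F A)) (diagonal w (int (card F) + int (deg F (V - comp_of F w))) 0 0)"
      proof (rule reads_mono[OF reads_restr])
        have k0: "deg F (V - comp_of F w) = 0" using V by (simp add: deg_def Diff_eq_empty_iff[THEN iffD2])
        have "(s, s) \<in> diagonal w (int (card F) + int (deg F (V - comp_of F w))) 0 0"
          if "s \<in> block w F A" for s
        proof -
          have s: "s = (F, {})" "(F, {}) \<in> valid {w}"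
            using that * by (auto simp: block_def True)
          show ?thesis unfolding s(1) using s(2) by (simp add: diagonal_def grade_def deg_def k0[unfolded deg_def])
        qed
        then show "Id_on (block w F A) \<subseteq> diagonal w (int (card F) + int (deg F (V - comp_of F w))) 0 0"
          by (auto elim!: Id_onE)
      qed
      ultimately show ?thesis using reads_0 by blast
    next
      case False
      \<comment> \<open>Without an edge leaving the root component, connectivity would put all of V
        into it, and every free edge would be a loop after contraction.\<close>
      have "\<exists>e\<in>A. (a e \<in> comp_of F w) \<noteq> (b e \<in> comp_of F w)"
      proof (rule ccontr)
        assume no: "\<not> ?thesis"
        then have "sat (F \<union> A) (comp_of F w)" using comp_sat[of F w] by (auto simp: sat_def)
        then have V: "V \<subseteq> comp_of F w" using less.prems(4) comp_least[of "F \<union> A" "comp_of F w" w] by auto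
        obtain e where e: "e \<in> A" using False by blast
        then have "a e \<in> comp_of F w" "b e \<in> comp_of F w" using V less.prems(2) ends_in by blast+
        then have "b e \<in> comp_of F (a e)" by (simp add: comp_eq)
        then show False using noloop e by blast
      qed
      then obtain e u v where e: "e \<in> A" and uv: "{a e, b e} = {u, v}" "u \<in> comp_of F w" "v \<notin> comp_of F w"
        by (metis insert_commute)
      interpret block_step a b V E w F "A - {e}" e
        by unfold_locales (use assms(1) less.prems e in auto)
      have A: "insert e (A - {e}) = A" using e by auto
      have card: "card (A - {e}) < card A" using e finA by (rule card_Diff1_less[rotated])
      define n where "n = int (card F) + int (deg F (V - comp_of F w))"
      have finF: "finite F" using less.prems(1) finite_E by (rule finite_subset)
      have n: "int (card (insert e F)) + int (deg (insert e F) (V - comp_of (insert e F) w)) = n"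
        using deg_root_insert[OF uv] FA(5) finF by (simp add: n_def)
      have eF: "insert e F \<union> (A - {e}) = F \<union> A" using e by auto
      have "\<exists>h P. retracts (restr (block w (insert e F) (A - {e}))) (dd {w} (A - {e})) h P \<and>
          reads h (grade {w} 1 0) \<and>
          reads P (diagonal w (int (card (insert e F)) + int (deg (insert e F) (V - comp_of (insert e F) w))) 0 0)"
        by (rule less.hyps[OF card]) (use FA less.prems(4) eF in auto)
      then obtain h' P' where con: "retracts (restr (block w (insert e F) (A - {e}))) (dd {w} (A - {e})) h' P'"
          "reads h' (grade {w} 1 0)" "reads P' (diagonal w n 0 0)" unfolding n by blast
      show ?thesis
      proof (cases "v \<in> comp_of (F \<union> (A - {e})) w")
        case True
        have "b e \<in> comp_of (F \<union> (A - {e})) (a e)"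
        proof -
          have "u \<in> comp_of (F \<union> (A - {e})) w" using uv(2) comp_mono[of F "F \<union> (A - {e})" w] by blast
          then have "{a e, b e} \<subseteq> comp_of (F \<union> (A - {e})) w" unfolding uv(1) using True by simp
          then show ?thesis by (simp add: mem_comp)
        qed
        then have "comp_of (insert e (F \<union> (A - {e}))) = comp_of (F \<union> (A - {e}))" by (rule comp_insert_same)
        moreover have "insert e (F \<union> (A - {e})) = F \<union> A" using e by auto
        ultimately have conn: "comp_of (F \<union> (A - {e})) = comp_of (F \<union> A)" by simp
        have "\<exists>h P. retracts (restr (block w F (A - {e}))) (dd {w} (A - {e})) h P \<and>
            reads h (grade {w} 1 0) \<and> reads P (diagonal w (int (card F) + int (deg F (V - comp_of F w))) 0 0)"
          by (rule less.hyps[OF card]) (use FA less.prems(4) conn in auto)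
        then obtain h P where del: "retracts (restr (block w F (A - {e}))) (dd {w} (A - {e})) h P"
            "reads h (grade {w} 1 0)" "reads P (diagonal w n 0 0)" unfolding n_def by blast
        define g where "g = dd {w} {e}"
        have g: "reads g (grade {w} (- 1) 0)" unfolding g_def by (rule reads_dd)
        \<comment> \<open>\<open>g\<close> raises i by one and keeps j, while \<open>P\<close> and
          \<open>P'\<close> live on the same diagonal i + j = n, so the connecting map on homology
          is zero.\<close>
        have "reads (P' * g * P) {}"
          by (rule reads_mult[OF reads_diagonal_right[OF con(3) g] del(3)]) (auto simp: diagonal_def grade_def)
        then have PgP: "P' * g * P = 0" by (rule reads_empty)
        have d: "dd {w} A = dd {w} (A - {e}) + g"
          using edge_op_Un[OF lin_pull, of "A - {e}" "{e}" "{w}"] A by (simp add: dd_def g_def)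
        have "retracts (restr (block w F A)) (dd {w} A) (h' + h - h' * g * h) (P' + P - P' * g * h - h' * g * P)"
          using retracts_extension[OF dd_anticomm[of "{w}" "{e}" "A - {e}"] dd_edge_block[OF FA(6,5)]
              restr_block_insert(2,3)[OF FA(6,5)] del(1) con(1) PgP[unfolded g_def]]
            restr_block_insert(1)[OF FA(6,5), of w]
          unfolding A d g_def by simp
        moreover have "reads (h' + h - h' * g * h) (grade {w} 1 0)"
          using reads_grade_mult[OF reads_grade_mult[OF con(2) g] del(2)] con(2) del(2)
          by (simp add: reads_add reads_diff)
        moreover have "reads (P' + P - P' * g * h - h' * g * P) (diagonal w n 0 0)"
          using reads_diagonal_right[OF reads_diagonal_right[OF con(3) g] del(2)]
            reads_diagonal_left[OF reads_grade_mult[OF con(2) g] del(3)] con(3) del(3)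
          by (simp add: reads_add reads_diff)
        ultimately show ?thesis unfolding n_def by blast
      next
        case False
        note uv' = uv(1,2) False
        define \<sigma> where "\<sigma> = unmerge w F (A - {e}) e"
        define \<xi> where "\<xi> = unmerge_x w F (A - {e}) e v"
        define \<tau> where "\<tau> = merge_x w F (A - {e}) e v"
        let ?d = "dd {w} (A - {e})"
        have r: "reads \<sigma> (grade {w} 1 0)" "reads \<xi> (grade {w} 1 (- 1))" "reads \<tau> (grade {w} (- 1) 1)"
          "reads ?d (grade {w} (- 1) 0)"
          unfolding \<sigma>_def \<xi>_def \<tau>_def
          using reads_unmerge_bridge[OF uv'] reads_unmerge_x[OF uv'] reads_merge_x[OF uv'] reads_dd by auto
        have "retracts (restr (block w F A)) (dd {w} A) (\<sigma> - \<xi> * h' * \<tau> + \<xi> * h' * \<tau> * ?d * \<sigma>)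
            (\<xi> * P' * \<tau> - \<xi> * P' * \<tau> * ?d * \<sigma>)"
          using retracts_bridge_edge[OF uv' con(1)] unfolding A \<sigma>_def \<xi>_def \<tau>_def .
        moreover have "reads (\<sigma> - \<xi> * h' * \<tau> + \<xi> * h' * \<tau> * ?d * \<sigma>) (grade {w} 1 0)"
          using reads_grade_mult[OF reads_grade_mult[OF r(2) con(2)] r(3)]
            reads_grade_mult[OF reads_grade_mult[OF reads_grade_mult[OF reads_grade_mult[OF r(2) con(2)] r(3)] r(4)] r(1)] r(1)
          by (simp add: reads_add reads_diff)
        \<comment> \<open>\<open>\<xi>\<close> and \<open>\<tau>\<close> have bidegrees (-1, 1) and
          (1, -1) and thus preserve i + j, so the shifted copy stays on the diagonal.\<close>
        moreover have "reads (\<xi> * P' * \<tau> - \<xi> * P' * \<tau> * ?d * \<sigma>) (diagonal w n 0 0)"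
          using reads_diagonal_right[OF reads_diagonal_left[OF r(2) con(3)] r(3)]
            reads_diagonal_right[OF reads_diagonal_right[OF reads_diagonal_right[OF reads_diagonal_left[OF r(2) con(3)] r(3)] r(4)] r(1)]
          by (simp add: reads_diff)
        ultimately show ?thesis unfolding n_def by blast
      qed
    qed
  qed
qed

end

section \<open>Rooted complexes split\<close>

text \<open>The boolean stands for the label at the root, \<open>False\<close> for 1 and
  \<open>True\<close> for x. \<open>lift\<close> acts on both copies alike, and \<open>eps\<close>
  carries the copy with root 1 to the copy with root x.\<close>

definition lift :: "'i endo \<Rightarrow> ('i \<times> bool) endo" where
  "lift X = Endo (\<lambda>c (s, \<beta>). app X (\<lambda>t. c (t, \<beta>)) s)"

definition eps :: "('i \<times> bool) endo" where
  "eps = Endo (\<lambda>c (s, \<beta>). if \<beta> then c (s, False) else 0)"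

definition eps' :: "('i \<times> bool) endo" where
  "eps' = Endo (\<lambda>c (s, \<beta>). if \<beta> then 0 else c (s, True))"

lemma app_lift: "app (lift X) c (s, \<beta>) = app X (\<lambda>t. c (t, \<beta>)) s"
  unfolding lift_def by (subst app_Endo) (auto simp: app_lincomb split: prod.split)

lemma app_eps: "app eps c (s, \<beta>) = (if \<beta> then c (s, False) else 0)"
  and app_eps': "app eps' c (s, \<beta>) = (if \<beta> then 0 else c (s, True))"
  unfolding eps_def eps'_def by (subst app_Endo; auto split: prod.split)+

lemma endo_prod_eqI: "(\<And>c s \<beta>. app X c (s, \<beta>) = app Y c (s, \<beta>)) \<Longrightarrow> X = Y"
  by (rule endo_eqI) auto

lemma lift_ring:
  "lift (X * Y) = lift X * lift Y" "lift (X + Y) = lift X + lift Y" "lift (X - Y) = lift X - lift Y"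
  "lift (- X) = - lift X" "lift 1 = 1" "lift 0 = 0"
  by (rule endo_prod_eqI, simp add: app_lift)+

lemma eps_relations:
  "eps * eps = 0" "eps' * eps + eps * eps' = 1" "eps * lift X = lift X * eps" "eps' * lift X = lift X * eps'"
  by (rule endo_prod_eqI, simp add: app_lift app_eps app_eps')+

context ugraph begin

text \<open>Filtration by i + j: operators supported here lower i + j by at least m. The homotopy h
  lowers it by one and \<open>\<Phi>\<close> preserves it.\<close>

definition above :: "'v \<Rightarrow> int \<Rightarrow> ((nat set \<times> 'v set) \<times> (nat set \<times> 'v set)) set" where
  "above w m = {((I, U), (J, X)). (I, U) \<in> valid {w} \<and> (J, X) \<in> valid {w} \<and>
     int (card I) + int (deg I U) + m \<le> int (card J) + int (deg J X)}"

lemma reads_above_mult: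
  "reads X (above w m) \<Longrightarrow> reads Y (above w m') \<Longrightarrow> reads (X * Y) (above w (m + m'))"
  by (erule (1) reads_mult) (auto simp: above_def)

lemma reads_above_mono: "reads X (above w m) \<Longrightarrow> m' \<le> m \<Longrightarrow> reads X (above w m')"
  by (erule reads_mono) (auto simp: above_def)

lemma reads_above_grade: "reads X (grade {w} p q) \<Longrightarrow> reads X (above w (p + q))"
  by (erule reads_mono) (auto simp: above_def grade_def)

lemma deg_le:
  assumes "(I, U) \<in> valid W"
  shows "deg I U \<le> card V"
proof -
  note v = validD[OF assms]
  have "deg I U \<le> card U" unfolding deg_def using v(6) by (rule card_image_le)
  also have "\<dots> \<le> card V" using finite_V v(2) by (rule card_mono)
  finally show ?thesis .
qed

text \<open>On valid indices i + j is at least 0 and at most \<open>card E + card V\<close>, so it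
  cannot drop as often as the exponent demands.\<close>

lemma above_nilpotent:
  assumes "reads x (above w 1)"
  shows "x ^ Suc (card E + card V + 1) = 0"
proof -
  have pow: "reads (x ^ Suc k) (above w (int (Suc k)))" for k
  proof (induction k)
    case (Suc k)
    show ?case using reads_above_mult[OF assms Suc] by simp
  qed (use assms in simp)
  have le: "card I + deg I U \<le> card E + card V" if "(I, U) \<in> valid {w}" for I U
    using deg_le[OF that] card_mono[OF finite_E validD(1)[OF that]] by simp
  have ge: "card I + deg I U \<ge> Suc (card E + card V + 1)" "(I, U) \<in> valid {w}"
    if "(s, (I, U)) \<in> above w (int (Suc (card E + card V + 1)))" for s I U
    using that by (cases s; simp add: above_def)+
  have "p \<notin> above w (int (Suc (card E + card V + 1)))" for p
  proof
    assume p: "p \<in> above w (int (Suc (card E + card V + 1)))"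
    obtain s I U where "p = (s, (I, U))" by (metis surj_pair)
    with p have "(s, (I, U)) \<in> above w (int (Suc (card E + card V + 1)))" by simp
    from le[OF ge(2)[OF this]] ge(1)[OF this] show False by simp
  qed
  then have "above w (int (Suc (card E + card V + 1))) = {}" by blast
  with pow[of "card E + card V + 1"] have "reads (x ^ Suc (card E + card V + 1)) {}" by metis
  then show ?thesis by (rule reads_empty)
qed

text \<open>\<open>block_retraction\<close> with nothing contracted and all edges free, extended by
  the identity off the valid indices and then made idempotent. The valid part of \<open>P\<close>
  lives on one diagonal, so an operator that lowers i + j dies between two copies of
  \<open>P\<close>.\<close>

lemma rooted_retraction:
  assumes w: "w \<in> V" and conn: "\<And>x. x \<in> V \<Longrightarrow> x \<in> comp_of E w"
  obtains h P where "retracts 1 (dd {w} E) h P" "P * P = P" "reads h (grade {w} 1 0)"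
    "flip * P = P * flip" "\<And>X. reads X (above w 1) \<Longrightarrow> P * X * P = 0"
proof -
  define \<rho> where "\<rho> = restr (valid {w})"
  have "block w {} E = valid {w}" by (auto simp: block_def valid_def)
  moreover have "\<exists>h P. retracts (restr (block w {} E)) (dd {w} E) h P \<and> reads h (grade {w} 1 0) \<and>
      reads P (diagonal w (int (card ({} :: nat set)) + int (deg {} (V - comp_of {} w))) 0 0)"
    by (rule block_retraction[OF w]) (use conn in simp_all)
  ultimately obtain h P0 where h: "retracts \<rho> (dd {w} E) h P0" "reads h (grade {w} 1 0)"
    and P0'': "reads P0 (diagonal w (int (card ({} :: nat set)) + int (deg {} (V - comp_of {} w))) 0 0)"
    unfolding \<rho>_def by metis
  define n where "n = int (card ({} :: nat set)) + int (deg {} (V - comp_of {} w))"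
  have P0: "reads P0 (diagonal w n 0 0)" using P0'' unfolding n_def .
  have P0': "reads P0 (grade {w} 0 0)" by (rule reads_mono[OF P0]) (auto simp: diagonal_def)
  have \<rho>d: "\<rho> * dd {w} E = dd {w} E" "dd {w} E * \<rho> = dd {w} E"
    unfolding \<rho>_def by (rule reads_grade_valid[OF reads_dd])+
  have \<rho>P: "\<rho> * P0 = P0" "P0 * \<rho> = P0"
    unfolding \<rho>_def by (rule reads_grade_valid[OF P0'])+
  have \<rho>\<rho>: "\<rho> * \<rho> = \<rho>" unfolding \<rho>_def by (simp add: restr_mult)
  define P1 where "P1 = P0 + (1 - \<rho>)"
  have "retracts 1 (dd {w} E) h P1"
    using h(1) \<rho>d unfolding retracts_def P1_def by (simp add: algebra_simps)
  note idem = retracts_idempotent[OF this]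
  have P2: "P1 * P1 = P0 * P0 + (1 - \<rho>)" by (simp add: P1_def algebra_simps \<rho>P \<rho>\<rho>)
  have h0: "\<rho> * h = h" unfolding \<rho>_def by (rule reads_grade_valid[OF h(2)])
  have P1h: "P1 * h = P0 * h" by (simp add: P1_def algebra_simps h0)
  have Q: "reads (P0 * P0) (diagonal w n 0 0)" using reads_diagonal_right[OF P0 P0'] by simp
  show thesis
  proof (rule that[OF idem])
    show "reads (h + P1 * h) (grade {w} 1 0)"
      unfolding P1h using reads_grade_mult[OF P0' h(2)] h(2) by (simp add: reads_add)
    have f: "flip * P0 = P0 * flip" using P0' by (rule flip_even_grade) simp
    have "flip * \<rho> = \<rho> * flip" unfolding \<rho>_def by (rule flip_even) (auto intro: reads_mono[OF reads_restr])
    then show "flip * (P1 * P1) = P1 * P1 * flip"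
      unfolding P2 by (simp add: algebra_simps assoc_eq[OF f] f)
    fix X assume X: "reads X (above w 1)"
    have \<rho>X: "\<rho> * X = X" "X * \<rho> = X" unfolding \<rho>_def
      by (rule restr_mult_left restr_mult_right, rule reads_mono[OF X], auto simp: above_def)+
    have "reads (P0 * P0 * X * (P0 * P0)) {}"
      by (rule reads_mult[OF reads_mult[OF Q X order.refl] Q]) (auto simp: diagonal_def above_def grade_def)
    then have "P0 * P0 * X * (P0 * P0) = 0" by (rule reads_empty)
    then show "P1 * P1 * X * (P1 * P1) = 0"
      unfolding P2 by (simp add: algebra_simps \<rho>X assoc_eq[OF \<rho>X(1)])
  qed
qed

lemma rooted_torsion_split:
  assumes w: "w \<in> V" and conn: "\<And>x. x \<in> V \<Longrightarrow> x \<in> comp_of E w"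
  shows "torsion_split (lift flip) (lift (dd {w} E) + lift (delta w) * eps)"
proof -
  obtain h P where P: "retracts 1 (dd {w} E) h P" "P * P = P" "flip * P = P * flip"
    and h: "reads h (grade {w} 1 0)" and PXP: "\<And>X. reads X (above w 1) \<Longrightarrow> P * X * P = 0"
    using rooted_retraction[OF assms] by metis
  define d where "d = dd {w} E"
  define \<Phi> where "\<Phi> = Phi {w} E"
  have g\<Phi>: "reads \<Phi> (grade {w} (- 1) 1)" unfolding \<Phi>_def by (rule reads_Phi)
  obtain H \<pi> where H: "(d + \<Phi>) * H + H * (d + \<Phi>) = 1 - \<pi>" "\<pi> * (d + \<Phi>) = 0"
    "flip * H = - (H * flip)" using deform_contraction[of "{w}"] unfolding d_def \<Phi>_def by metis
  have a: "reads h (above w 1)" "reads \<Phi> (above w 0)"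
    using reads_above_grade[OF h] reads_above_grade[OF g\<Phi>] by simp_all
  have x: "reads (h * \<Phi>) (above w 1)" using reads_above_mult[OF a] by simp
  obtain u where u: "(1 + h * \<Phi>) * u = 1" "u * (1 + h * \<Phi>) = 1"
    and u_sum: "u = (\<Sum>k<Suc (card E + card V + 1). (- (h * \<Phi>)) ^ k)"
    by (rule nilpotent_inverse[OF above_nilpotent[OF x]])
  define y where "y = (\<Sum>k<card E + card V + 1. (- (h * \<Phi>)) ^ Suc k)"
  \<comment> \<open>All terms of the geometric series except the first lower i + j, and so do not
    survive between two copies of \<open>P\<close>.\<close>
  have u1: "u = 1 + y" unfolding u_sum y_def sum.lessThan_Suc_shift by simp
  have y: "reads y (above w 1)"
    unfolding y_def
  proof (rule reads_sum)
    fix k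
    show "reads ((- (h * \<Phi>)) ^ Suc k) (above w 1)"
    proof (induction k)
      case (Suc k)
      have "reads (- (h * \<Phi>) * (- (h * \<Phi>)) ^ Suc k) (above w (1 + 1))"
        by (rule reads_above_mult[OF reads_uminus[OF x] Suc])
      then show ?case by (simp add: reads_above_mono)
    qed (simp add: reads_uminus x)
  qed
  have fl: "flip * d = - (d * flip)" "flip * \<Phi> = - (\<Phi> * flip)" "flip * h = - (h * flip)"
    using flip_odd_grade[OF reads_dd[of "{w}" E]] flip_odd_grade[OF g\<Phi>] flip_odd_grade[OF h]
    by (simp_all add: d_def)
  have "flip * (h * \<Phi>) = h * \<Phi> * flip" by (simp add: mult.assoc fl assoc_eq[OF fl(3)])
  then have "u * (flip * (1 + h * \<Phi>)) * u = u * ((1 + h * \<Phi>) * flip) * u"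
    by (simp add: distrib_left distrib_right)
  then have "u * flip * ((1 + h * \<Phi>) * u) = u * (1 + h * \<Phi>) * flip * u" by (simp only: mult.assoc)
  then have fu: "flip * u = u * flip" by (simp add: u)
  have fnu: "flip * nu w = nu w * flip"
  proof (rule flip_even, unfold reads_def, intro allI impI)
    fix s :: "nat set \<times> 'v set" and c c' :: "nat set \<times> 'v set \<Rightarrow> int"
    assume "\<forall>t. (s, t) \<in> {(s, t). even (card (fst s)) = even (card (fst t))} \<longrightarrow> c t = c' t"
    then have "c (fst s, X) = c' (fst s, X)" for X by simp
    then show "app (nu w) c s = app (nu w) c' s" by (cases s) (simp add: app_nu)
  qed
  have PyP: "P * \<Phi> * u * P = P * \<Phi> * P"
    using PXP[of "\<Phi> * y"] reads_above_mult[OF a(2) y] by (simp add: u1 algebra_simps)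
  \<comment> \<open>After expansion, each term other than the leading 1 contains \<open>h\<close> or
    \<open>y\<close> and lowers i + j.\<close>
  have PuuP: "P * (1 - \<Phi> * u * h) * u * P = P"
  proof -
    have 1: "reads (\<Phi> * h) (above w 1)" "reads (\<Phi> * y * h) (above w 1)"
      using reads_above_mult[OF a(2,1)] reads_above_mult[OF reads_above_mult[OF a(2) y] a(1)]
      by (auto intro: reads_above_mono)
    have "reads (\<Phi> * h * y) (above w 1)" "reads (\<Phi> * y * h * y) (above w 1)"
      using reads_above_mult[OF 1(1) y] reads_above_mult[OF 1(2) y] by (auto intro: reads_above_mono)
    with 1 y have X: "reads (y - \<Phi> * h - \<Phi> * y * h - \<Phi> * h * y - \<Phi> * y * h * y) (above w 1)"
      by (intro reads_diff)
    have "P * (1 - \<Phi> * u * h) * u * P =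
        P * P + P * (y - \<Phi> * h - \<Phi> * y * h - \<Phi> * h * y - \<Phi> * y * h * y) * P"
      by (simp add: u1 algebra_simps)
    then show ?thesis using PXP[OF X] P(2) by simp
  qed
  note R = P(1)[folded d_def, unfolded retracts_def]
  have anti: "\<Phi> * d = - (d * \<Phi>)" unfolding d_def \<Phi>_def by (rule Phi_dd)
  have dnu: "d * nu w - nu w * d = \<Phi> + \<Phi> + delta w"
    using dd_nu[OF w] unfolding d_def \<Phi>_def mult_2 .
  note L = lift_ring(1-4)[symmetric]
  show ?thesis
    unfolding d_def[symmetric]
  proof (rule torsion_split_cone[where \<Phi> = "lift \<Phi>" and h = "lift h" and P = "lift P" and H = "lift H" and
        \<pi> = "lift \<pi>" and \<nu> = "lift (nu w)" and \<epsilon>' = eps' and u = "lift u"])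
    show "lift d * lift d = 0" by (simp add: L d_def dd_dd lift_ring(6))
    show "lift \<Phi> * lift d = - (lift d * lift \<Phi>)" by (simp only: L anti)
    show "lift \<Phi> * lift \<Phi> = 0" by (simp add: L \<Phi>_def Phi_Phi lift_ring(6))
    show "1 = lift P + lift d * lift h + lift h * lift d"
      unfolding lift_ring(5)[symmetric] L using R by (intro arg_cong[of _ _ lift]) blast
    show "lift d * lift P = 0" "lift P * lift d = 0" using R by (simp_all add: L lift_ring(6))
    show "lift P * lift P = lift P" by (simp add: L P(2))
    show "lift u * (1 + lift h * lift \<Phi>) = 1" "(1 + lift h * lift \<Phi>) * lift u = 1"
      unfolding lift_ring(5)[symmetric] L u by (rule refl)+
    show "lift P * lift \<Phi> * lift u * lift P = lift P * lift \<Phi> * lift P" by (simp only: L PyP)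
    show "lift P * (1 - lift \<Phi> * lift u * lift h) * lift u * lift P = lift P"
      unfolding lift_ring(5)[symmetric] L PuuP by (rule refl)
    show "(lift d + lift \<Phi>) * lift H + lift H * (lift d + lift \<Phi>) = 1 - lift \<pi>"
      unfolding lift_ring(5)[symmetric] L H(1) by (rule refl)
    show "lift \<pi> * (lift d + lift \<Phi>) = 0"
      by (simp only: L H lift_ring(6))
    show "lift d * lift (nu w) - lift (nu w) * lift d = 2 * lift \<Phi> + lift (delta w)"
      unfolding mult_2 L dnu by (rule refl)
    show "eps * T = T * eps" "eps' * T = T * eps'"
      if "T \<in> {lift d, lift \<Phi>, lift h, lift P, lift H, lift \<pi>, lift (nu w), lift (delta w), lift u}" for T
      using that eps_relations(3,4) by blast+
    show "lift flip * T = T * lift flip" if "T \<in> {lift P, lift (nu w), eps, eps', lift u}" for T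
      using that by (auto simp: L P(3) fnu fu eps_relations(3,4))
    show "lift flip * T = - (T * lift flip)" if "T \<in> {lift \<Phi>, lift h, lift H}" for T
      using that by (auto simp: L fl H(3))
  qed (rule eps_relations)+
qed

end

section \<open>Connected graphs\<close>

definition linear_map :: "(('i \<Rightarrow> int) \<Rightarrow> 'j \<Rightarrow> int) \<Rightarrow> bool" where
  "linear_map f \<longleftrightarrow> (\<forall>k x y. f (\<lambda>i. k * x i + y i) = (\<lambda>j. k * f x j + f y j))"

lemma linear_mapD: "linear_map f \<Longrightarrow> f (\<lambda>i. k * x i + y i) = (\<lambda>j. k * f x j + f y j)"
  by (simp add: linear_map_def)

lemma linear_map_add: "linear_map f \<Longrightarrow> f (\<lambda>i. x i + y i) = (\<lambda>j. f x j + f y j)"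
  using linear_mapD[of f 1 x y] by simp

lemma linear_map_zero: "linear_map f \<Longrightarrow> f (\<lambda>_. 0) = (\<lambda>_. 0)"
  using linear_mapD[of f "-1" "\<lambda>_. 0" "\<lambda>_. 0"] by simp

lemma linear_map_scale: "linear_map f \<Longrightarrow> f (\<lambda>i. k * x i) = (\<lambda>j. k * f x j)"
  using linear_mapD[of f k x "\<lambda>_. 0"] by (simp add: linear_map_zero)

text \<open>The data X are pulled back to the maps c to \<open>g (app X (f c))\<close>, which turns
  the identity into \<open>\<rho>\<close>. The differential vanishes off \<open>\<rho>\<close>, so
  \<open>1 - \<rho>\<close> joins the summand with zero differential.\<close>

lemma torsion_split_transport:
  fixes f :: "('i \<Rightarrow> int) \<Rightarrow> 'j \<Rightarrow> int" and g :: "('j \<Rightarrow> int) \<Rightarrow> 'i \<Rightarrow> int"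
  assumes f: "linear_map f" and g: "linear_map g" and gf: "\<And>c. g (f c) = app \<rho> c"
    and fd: "\<And>c. f (app d c) = app d' (f c)" and dg: "\<And>c. app d (g c) = g (app d' c)"
    and f\<kappa>: "\<And>c. f (app \<kappa> c) = app \<kappa>' (f c)" and \<kappa>g: "\<And>c. app \<kappa> (g c) = g (app \<kappa>' c)"
    and \<rho>: "\<rho> * d = d" "d * \<rho> = d" "\<rho> * \<kappa> = \<kappa> * \<rho>"
    and split: "torsion_split \<kappa>' d'"
  shows "torsion_split \<kappa> d"
proof -
  define T where "T X = Endo (\<lambda>c. g (app X (f c)))" for X
  have app_T: "app (T X) c = g (app X (f c))" for X c
    unfolding T_def
    by (subst app_Endo) (simp_all add: linear_mapD[OF f] linear_mapD[OF g] app_lincomb)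
  have T_add: "T (X + Y) = T X + T Y" for X Y
    by (rule endo_eqI) (simp add: app_T linear_map_add[OF g])
  have T1: "T 1 = \<rho>" by (rule endo_eqI) (simp add: app_T gf)
  have T0: "T 0 = 0" by (rule endo_eqI) (simp add: app_T linear_map_zero[OF g])
  have Td: "T (X * d') = T X * d" "T (d' * X) = d * T X" for X
    by (rule endo_eqI, simp add: app_T fd dg)+
  have T\<kappa>: "T (X * \<kappa>') = T X * \<kappa>" "T (\<kappa>' * X) = \<kappa> * T X" for X
    by (rule endo_eqI, simp add: app_T f\<kappa> \<kappa>g)+
  have Tm: "T (- X) = - T X" for X
    using T_add[of X "- X"] by (simp add: T0 eq_neg_iff_add_eq_0 add.commute)
  obtain P e h k where s: "1 = P + e + d' * h + h * d'" "d' * P = 0" "P * d' = 0" "2 * e = d' * k + k * d'"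
    "\<kappa>' * P = P * \<kappa>'" "\<kappa>' * e = e * \<kappa>'" "\<kappa>' * h = - (h * \<kappa>')" "\<kappa>' * k = - (k * \<kappa>')"
    using split unfolding torsion_split_def by blast
  have 1: "\<rho> = T P + T e + d * T h + T h * d"
    using arg_cong[OF s(1), of T] by (simp only: T_add Td T1)
  have 2: "2 * T e = d * T k + T k * d"
    using arg_cong[OF s(4), of T] by (simp only: mult_2 T_add Td)
  have 3: "d * T P = 0" "T P * d = 0"
    using arg_cong[OF s(2), of T] arg_cong[OF s(3), of T] by (simp_all only: Td T0)
  have 4: "\<kappa> * T P = T P * \<kappa>" "\<kappa> * T e = T e * \<kappa>" "\<kappa> * T h = - (T h * \<kappa>)" "\<kappa> * T k = - (T k * \<kappa>)"
    using arg_cong[OF s(5), of T] arg_cong[OF s(6), of T] arg_cong[OF s(7), of T] arg_cong[OF s(8), of T]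
    by (simp_all only: T\<kappa> Tm)
  show ?thesis unfolding torsion_split_def
  proof (intro exI conjI)
    show "1 = (T P + (1 - \<rho>)) + T e + d * T h + T h * d" using 1 by (simp add: algebra_simps)
    show "d * (T P + (1 - \<rho>)) = 0" "(T P + (1 - \<rho>)) * d = 0" using 3 \<rho> by (simp_all add: algebra_simps)
    show "\<kappa> * (T P + (1 - \<rho>)) = (T P + (1 - \<rho>)) * \<kappa>" using 4 \<rho>(3) by (simp add: algebra_simps)
  qed (rule 2 4)+
qed

context ugraph begin

text \<open>The root component is split off from the label set, because rooted labellings avoid w;
  the boolean remembers it.\<close>

definition to_rooted :: "'v \<Rightarrow> (nat set \<times> 'v set \<Rightarrow> int) \<Rightarrow> (nat set \<times> 'v set) \<times> bool \<Rightarrow> int" where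
  "to_rooted w c = (\<lambda>((I, U), \<beta>). if (I, U) \<in> valid {w}
     then c (I, if \<beta> then U \<union> comp_of I w else U) else 0)"

definition of_rooted :: "'v \<Rightarrow> ((nat set \<times> 'v set) \<times> bool \<Rightarrow> int) \<Rightarrow> nat set \<times> 'v set \<Rightarrow> int" where
  "of_rooted w z = (\<lambda>(I, U). if (I, U) \<in> valid {}
     then if w \<in> U then z ((I, U - comp_of I w), True) else z ((I, U), False) else 0)"

lemma linear_to_rooted: "linear_map (to_rooted w)" and linear_of_rooted: "linear_map (of_rooted w)"
  by (auto simp: linear_map_def to_rooted_def of_rooted_def fun_eq_iff)

lemma valid_add_root:
  assumes "w \<in> V" "(I, U) \<in> valid {w}"
  shows "(I, U \<union> comp_of I w) \<in> valid {}" "(U \<union> comp_of I w) - comp_of I w = U"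
proof -
  note v = validD[OF assms(2)]
  show "(I, U \<union> comp_of I w) \<in> valid {}"
    using v comp_subset_V[OF v(1) assms(1)] by (auto simp: valid_def sat_Un)
  have "comp_of I w \<inter> U = {}" using v by (intro sat_disjoint) auto
  then show "(U \<union> comp_of I w) - comp_of I w = U" by blast
qed

lemma valid_remove_root:
  assumes "(I, U) \<in> valid {}"
  shows "(I, U - comp_of I w) \<in> valid {w}" "w \<in> U \<Longrightarrow> U - comp_of I w \<union> comp_of I w = U"
    "w \<notin> U \<Longrightarrow> (I, U) \<in> valid {w}"
proof -
  note v = validD[OF assms]
  show "(I, U - comp_of I w) \<in> valid {w}" using v comp_self[of w I] by (auto simp: valid_def sat_Diff)
  show "w \<in> U \<Longrightarrow> U - comp_of I w \<union> comp_of I w = U" using comp_least[OF v(4)] by blast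
  show "w \<notin> U \<Longrightarrow> (I, U) \<in> valid {w}" using v by (auto simp: valid_def)
qed

lemma of_to_rooted: "w \<in> V \<Longrightarrow> of_rooted w (to_rooted w c) = app (restr (valid {})) c"
proof
  fix i :: "nat set \<times> 'v set" assume "w \<in> V"
  obtain I U where i: "i = (I, U)" by (cases i)
  show "of_rooted w (to_rooted w c) i = app (restr (valid {})) c i"
    using valid_remove_root[of I U w] by (simp add: i of_rooted_def to_rooted_def)
qed

lemma to_of_rooted:
  assumes "w \<in> V"
  shows "to_rooted w (of_rooted w z) = (\<lambda>((I, U), \<beta>). if (I, U) \<in> valid {w} then z ((I, U), \<beta>) else 0)"
proof
  fix i :: "(nat set \<times> 'v set) \<times> bool"
  obtain I U \<beta> where i: "i = ((I, U), \<beta>)" by (metis surj_pair)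
  show "to_rooted w (of_rooted w z) i = (\<lambda>((I, U), \<beta>). if (I, U) \<in> valid {w} then z ((I, U), \<beta>) else 0) i"
  proof (cases "(I, U) \<in> valid {w}")
    case True
    then have "(I, U) \<in> valid {}" "w \<notin> U" by (auto simp: valid_def)
    then show ?thesis using True valid_add_root[OF assms True]
      by (cases \<beta>) (simp_all add: i to_rooted_def of_rooted_def)
  qed (simp add: i to_rooted_def)
qed

text \<open>There are two sources of a label x at the root after adding r: it was there before, or a
  component with label x was merged into a root with label 1. They give the diagonal part of the
  cone and \<open>delta\<close>.\<close>

lemma rooted_local:
  assumes "w \<in> V" "(insert r I, U) \<in> valid {w}"
  shows "pull r I f (U \<union> comp_of (insert r I) w) =
    pull r I (\<lambda>X. f (X \<union> comp_of I w)) U + root_merge w r I f U"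
proof -
  let ?J = "insert r I" and ?P = "comp_of I (a r)" and ?Q = "comp_of I (b r)" and ?R = "comp_of I w"
  note v = validD[OF assms(2)]
  have ab: "a r \<in> U \<longleftrightarrow> b r \<in> U" and sI: "sat I U" and wU: "w \<notin> U" using v(3,4) by auto
  show ?thesis
  proof (cases "b r \<in> ?P")
    case True
    then have "a r \<in> ?R \<longleftrightarrow> b r \<in> ?R" by (simp add: mem_comp)
    then have "root_merge w r I f U = 0" by (auto simp: root_merge_def)
    then show ?thesis using True by (simp add: pull_def comp_insert_same)
  next
    case PQ: False
    have disj: "?P \<inter> ?Q = {}" using PQ comp_disjoint by blast
    have aQ: "a r \<notin> ?Q" using PQ by (simp add: mem_comp)
    show ?thesis
    proof (cases "a r \<in> U")
      case True
      have sub: "?P \<subseteq> U" "?Q \<subseteq> U" using sI True ab by (auto intro: comp_least[THEN subsetD])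
      then have "w \<notin> ?P" "w \<notin> ?Q" using wU by auto
      then have cJ: "comp_of ?J w = ?R" and R: "a r \<notin> ?R" "b r \<notin> ?R"
        by (simp_all add: comp_insert mem_comp eq_commute)
      have "?R \<inter> U = {}" using sI wU by (rule sat_disjoint)
      then have "U \<union> ?R - ?P = U - ?P \<union> ?R" "U \<union> ?R - ?Q = U - ?Q \<union> ?R" using sub by auto
      then show ?thesis using True PQ R by (simp add: pull_def cJ root_merge_def)
    next
      case aU: False
      have sub: "?P \<inter> U = {}" "?Q \<inter> U = {}" using sat_disjoint[OF sI] aU ab by auto
      consider "w \<in> ?P" | "w \<in> ?Q" | "w \<notin> ?P" "w \<notin> ?Q" by blast
      then show ?thesis
      proof cases
        case 1
        then have R: "?R = ?P" by (rule comp_eq)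
        have cJ: "comp_of ?J w = ?P \<union> ?Q" using 1 by (simp add: comp_insert)
        have "U \<union> (?P \<union> ?Q) - ?P = U \<union> ?Q" "U \<union> (?P \<union> ?Q) - ?Q = U \<union> ?P" using sub disj by auto
        then show ?thesis using aU PQ by (simp add: pull_def cJ root_merge_def R)
      next
        case 2
        then have R: "?R = ?Q" by (rule comp_eq)
        have cJ: "comp_of ?J w = ?P \<union> ?Q" using 2 by (simp add: comp_insert)
        have "U \<union> (?P \<union> ?Q) - ?P = U \<union> ?Q" "U \<union> (?P \<union> ?Q) - ?Q = U \<union> ?P" using sub disj by auto
        then show ?thesis using aU PQ aQ by (simp add: pull_def cJ root_merge_def R)
      next
        case 3
        then have cJ: "comp_of ?J w = ?R" and R: "a r \<notin> ?R" "b r \<notin> ?R"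
          by (simp_all add: comp_insert mem_comp eq_commute)
        then show ?thesis using aU by (simp add: pull_def root_merge_def)
      qed
    qed
  qed
qed

lemma root_merge_cong:
  assumes "(insert r I, U) \<in> valid {w}" "\<And>X. (I, X) \<in> valid {w} \<Longrightarrow> f X = f' X"
  shows "root_merge w r I f U = root_merge w r I f' U"
proof -
  have vI: "(I, U) \<in> valid {w}" using assms(1) by (rule valid_mono) auto
  have abV: "a r \<in> V" "b r \<in> V" "I \<subseteq> E" using validD(1)[OF assms(1)] ends_in by auto
  have "f (U \<union> comp_of I x) = f' (U \<union> comp_of I x)" if "x \<in> V" "x \<notin> comp_of I w" for x
  proof (rule assms(2))
    have "w \<notin> comp_of I x" using that(2) by (simp add: mem_comp eq_commute)
    moreover have "comp_of I x \<subseteq> V" using abV(3) that(1) by (rule comp_subset_V)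
    ultimately show "(I, U \<union> comp_of I x) \<in> valid {w}" using vI by (auto simp: valid_def sat_Un)
  qed
  then show ?thesis using abV by (simp add: root_merge_def)
qed

lemma delta_restr: "delta w * restr (valid {w}) = delta w"
proof (rule endo_eqI)
  fix c and i :: "nat set \<times> 'v set"
  obtain J U where i: "i = (J, U)" by (cases i)
  have "root_merge w r (J - {r}) (\<lambda>X. if (J - {r}, X) \<in> valid {w} then c (J - {r}, X) else 0) U =
      root_merge w r (J - {r}) (\<lambda>X. c (J - {r}, X)) U" if "(J, U) \<in> valid {w}" "r \<in> J" for r
    by (rule root_merge_cong) (use that in \<open>simp_all add: insert_absorb\<close>)
  then show "app (delta w * restr (valid {w})) c i = app (delta w) c i"
    by (auto simp: i app_delta intro!: sum.cong)
qed

lemma to_rooted_dd: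
  assumes w: "w \<in> V"
  shows "to_rooted w (app (dd {} E) c) = app (lift (dd {w} E) + lift (delta w) * eps) (to_rooted w c)"
proof
  fix i :: "(nat set \<times> 'v set) \<times> bool"
  obtain J U \<beta> where i: "i = ((J, U), \<beta>)" by (metis surj_pair)
  show "to_rooted w (app (dd {} E) c) i = app (lift (dd {w} E) + lift (delta w) * eps) (to_rooted w c) i"
  proof (cases "(J, U) \<in> valid {w}")
    case True
    note v = validD[OF True]
    have JE: "J \<inter> E = J" using v(1) by auto
    have v0: "(J, U) \<in> valid {}" using True by (auto simp: valid_def)
    have p: "pull r (J - {r}) (\<lambda>X. to_rooted w c ((J - {r}, X), \<beta>)) U =
        pull r (J - {r}) (\<lambda>X. c (J - {r}, if \<beta> then X \<union> comp_of (J - {r}) w else X)) U" if "r \<in> J" for r \<beta>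
    proof (rule pull_cong)
      show "(insert r (J - {r}), U) \<in> valid {w}" using True that by (simp add: insert_absorb)
    qed (simp add: to_rooted_def)
    show ?thesis
    proof (cases \<beta>)
      case False
      then show ?thesis using True v0 p[of _ False]
        by (simp add: i to_rooted_def[of w "app (dd {} E) c"] app_lift app_eps app_dd JE)
    next
      case \<beta>: True
      have q: "root_merge w r (J - {r}) (\<lambda>X. to_rooted w c ((J - {r}, X), False)) U =
          root_merge w r (J - {r}) (\<lambda>X. c (J - {r}, X)) U" if r: "r \<in> J" for r
        by (rule root_merge_cong) (use True r in \<open>simp_all add: insert_absorb to_rooted_def\<close>)
      have "app (dd {} E) c (J, U \<union> comp_of J w) =
          (\<Sum>r\<in>J. sg r J * pull r (J - {r}) (\<lambda>X. c (J - {r}, X)) (U \<union> comp_of J w))"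
        using valid_add_root(1)[OF w True] by (simp add: app_dd JE)
      also have "\<dots> = (\<Sum>r\<in>J. sg r J * (pull r (J - {r}) (\<lambda>X. c (J - {r}, X \<union> comp_of (J - {r}) w)) U +
          root_merge w r (J - {r}) (\<lambda>X. c (J - {r}, X)) U))"
      proof (rule sum.cong[OF refl], rule arg_cong[of _ _ "(*) _"])
        fix r assume r: "r \<in> J"
        then have J: "insert r (J - {r}) = J" by auto
        show "pull r (J - {r}) (\<lambda>X. c (J - {r}, X)) (U \<union> comp_of J w) =
            pull r (J - {r}) (\<lambda>X. c (J - {r}, X \<union> comp_of (J - {r}) w)) U +
            root_merge w r (J - {r}) (\<lambda>X. c (J - {r}, X)) U"
          using rooted_local[OF w, of r "J - {r}" U "\<lambda>X. c (J - {r}, X)"] True unfolding J by blast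
      qed
      also have "\<dots> = app (lift (dd {w} E) + lift (delta w) * eps) (to_rooted w c) i"
        using True \<beta> p[of _ True] q
        by (simp add: i app_lift app_eps app_dd app_delta JE distrib_left sum.distrib)
      finally show ?thesis using True \<beta> by (simp add: i to_rooted_def[of w "app (dd {} E) c"])
    qed
  next
    case False
    then show ?thesis by (simp add: i to_rooted_def[of w "app (dd {} E) c"] app_lift app_dd app_delta)
  qed
qed

lemma connected_torsion_split:
  assumes w: "w \<in> V" and conn: "\<And>x. x \<in> V \<Longrightarrow> x \<in> comp_of E w"
  shows "torsion_split flip (dd {} E)"
proof (rule torsion_split_transport[OF linear_to_rooted linear_of_rooted of_to_rooted[OF w] to_rooted_dd[OF w]])
  let ?Z = "lift (dd {w} E) + lift (delta w) * eps"
  show "torsion_split (lift flip) ?Z" by (rule rooted_torsion_split[OF assms])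
  show \<rho>: "restr (valid {}) * dd {} E = dd {} E" "dd {} E * restr (valid {}) = dd {} E"
    by (rule reads_grade_valid[OF reads_dd])+
  show "restr (valid {}) * flip = flip * restr (valid {})" by (rule endo_eqI) simp
  show "to_rooted w (app flip c) = app (lift flip) (to_rooted w c)" for c
    by (auto simp: fun_eq_iff to_rooted_def app_lift)
  show "app flip (of_rooted w c) = of_rooted w (app (lift flip) c)" for c
    by (auto simp: fun_eq_iff of_rooted_def app_lift)
  show "app (dd {} E) (of_rooted w z) = of_rooted w (app ?Z z)" for z
  proof -
    have "dd {w} E * restr (valid {w}) = dd {w} E" by (rule reads_grade_valid[OF reads_dd])
    then have Z: "?Z * lift (restr (valid {w})) = ?Z"
      using delta_restr[of w]
      by (simp add: distrib_right mult.assoc eps_relations(3)) (simp add: assoc_eq[OF lift_ring(1)[symmetric]] lift_ring(1)[symmetric])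
    have fg: "to_rooted w (of_rooted w z) = app (lift (restr (valid {w}))) z"
      unfolding to_of_rooted[OF w] by (auto simp: fun_eq_iff app_lift)
    have "app (dd {} E) (of_rooted w z) = app (restr (valid {}) * dd {} E) (of_rooted w z)"
      by (simp only: \<rho>)
    also have "\<dots> = of_rooted w (to_rooted w (app (dd {} E) (of_rooted w z)))"
      by (simp only: of_to_rooted[OF w] app_ring(3))
    also have "\<dots> = of_rooted w (app (?Z * lift (restr (valid {w}))) z)"
      by (simp only: to_rooted_dd[OF w] fg app_ring(3))
    finally show ?thesis unfolding Z .
  qed
qed

end

section \<open>Disjoint unions\<close>

text \<open>The induction over components carries only this property of the homology; the explicit
  data of \<open>torsion_split\<close> are needed just for the connected factor that is split
  off.\<close>

definition two_torsion :: "'i endo \<Rightarrow> bool" where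
  "two_torsion d \<longleftrightarrow> (\<forall>m c b. m > 0 \<and> app d c = (\<lambda>_. 0) \<and> (\<lambda>i. m * c i) = app d b \<longrightarrow>
     (\<exists>b'. (\<lambda>i. 2 * c i) = app d b'))"

lemma two_torsion_transport:
  fixes f :: "('i \<Rightarrow> int) \<Rightarrow> 'j \<Rightarrow> int" and g :: "('j \<Rightarrow> int) \<Rightarrow> 'i \<Rightarrow> int"
  assumes f: "linear_map f" and g: "linear_map g" and gf: "\<And>c. g (f c) = app \<rho> c"
    and fd: "\<And>c. f (app d c) = app d' (f c)" and fg: "\<And>c. g (app d' (f (g c))) = g (app d' c)"
    and \<rho>: "\<rho> * d = d"
    and tors: "two_torsion d'"
  shows "two_torsion d"
  unfolding two_torsion_def
proof (intro allI impI, elim conjE)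
  fix m :: int and c b
  assume m: "0 < m" and c: "app d c = (\<lambda>_. 0)" and mc: "(\<lambda>i. m * c i) = app d b"
  have \<rho>d: "app \<rho> (app d x) = app d x" for x using arg_cong[OF \<rho>, of "\<lambda>X. app X x"] by simp
  have "(\<lambda>i. m * app \<rho> c i) = app \<rho> (\<lambda>i. m * c i)" by (simp add: app_scale)
  also have "\<dots> = (\<lambda>i. m * c i)" unfolding mc by (rule \<rho>d)
  finally have \<rho>c: "app \<rho> c = c" using m by (simp add: fun_eq_iff)
  have "app d' (f c) = (\<lambda>_. 0)" unfolding fd[symmetric] c by (rule linear_map_zero[OF f])
  moreover have "(\<lambda>i. m * f c i) = app d' (f b)"
    unfolding fd[symmetric] mc[symmetric] by (rule linear_map_scale[OF f, symmetric])
  ultimately obtain z where z: "(\<lambda>i. 2 * f c i) = app d' z"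
    using tors m unfolding two_torsion_def by blast
  have "(\<lambda>i. 2 * c i) = g (\<lambda>i. 2 * f c i)"
    unfolding linear_map_scale[OF g] gf \<rho>c ..
  also have "\<dots> = g (app d' (f (g z)))" unfolding z fg ..
  also have "\<dots> = app d (g z)" unfolding fd[symmetric] gf by (rule \<rho>d)
  finally show "\<exists>b'. (\<lambda>i. 2 * c i) = app d b'" by blast
qed

text \<open>\<open>hat\<close> and \<open>hat'\<close> are the two actions on a tensor product, on
  the second and on the first index.\<close>

definition hat :: "'l endo \<Rightarrow> ('k \<times> 'l) endo" where
  "hat X = Endo (\<lambda>c (k, l). app X (\<lambda>l. c (k, l)) l)"

definition hat' :: "'k endo \<Rightarrow> ('k \<times> 'l) endo" where
  "hat' X = Endo (\<lambda>c (k, l). app X (\<lambda>k. c (k, l)) k)"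

lemma app_hat: "app (hat X) c (k, l) = app X (\<lambda>l. c (k, l)) l"
  and app_hat': "app (hat' Y) c (k, l) = app Y (\<lambda>k. c (k, l)) k"
  unfolding hat_def hat'_def by (subst app_Endo; auto simp: app_lincomb split: prod.split)+

lemma endo_pair_eqI: "(\<And>c k l. app X c (k, l) = app Y c (k, l)) \<Longrightarrow> X = Y"
  by (rule endo_eqI) auto

lemma hat_ring:
  "hat (X * Y) = hat X * hat Y" "hat (X + Y) = hat X + hat Y" "hat (- X) = - hat X"
  "hat 1 = 1" "hat 0 = 0"
  by (rule endo_pair_eqI, simp add: app_hat)+

text \<open>As M reads only the finite set S, applying it is a finite linear combination of slices,
  and the linear operator T commutes with such combinations.\<close>

lemma hat_commute:
  fixes T :: "'l endo" and M :: "'k endo"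
  assumes "reads M (UNIV \<times> S)" "finite S"
  shows "hat T * hat' M = hat' M * hat T"
proof (rule endo_pair_eqI)
  fix c :: "'k \<times> 'l \<Rightarrow> int" and k l
  have M: "app M x k = (\<Sum>k'\<in>S. x k' * app M (\<lambda>i. of_bool (i = k')) k)" for x
    by (rule reads_expand[OF assms(1)]) (use assms(2) in auto)
  have "(\<lambda>l. app M (\<lambda>k. c (k, l)) k) = (\<lambda>l. \<Sum>k'\<in>S. app M (\<lambda>i. of_bool (i = k')) k * c (k', l))"
    by (rule ext, rule trans[OF M]) (simp only: mult.commute)
  then have "app T (\<lambda>l. app M (\<lambda>k. c (k, l)) k) l =
      app T (\<lambda>l. \<Sum>k'\<in>S. app M (\<lambda>i. of_bool (i = k')) k * c (k', l)) l"
    by (rule arg_cong)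
  also have "\<dots> = (\<Sum>k'\<in>S. app M (\<lambda>i. of_bool (i = k')) k * app T (\<lambda>l. c (k', l)) l)"
    by (simp only: app_sum)
  also have "\<dots> = app M (\<lambda>k. app T (\<lambda>l. c (k, l)) l) k"
    by (rule trans[OF _ M[symmetric]]) (simp only: mult.commute)
  finally show "app (hat T * hat' M) c (k, l) = app (hat' M * hat T) c (k, l)"
    by (simp add: app_hat app_hat')
qed

text \<open>\<open>hat \<kappa>\<close> is the Koszul sign. The homotopies anticommute with
  \<open>\<kappa>\<close>, hence with the second summand of the differential, and remain homotopies
  for the total one. On \<open>e\<close> twice the identity is null-homotopic; on \<open>P\<close>
  only the second summand is left, which is M up to sign on each slice.\<close>

lemma two_torsion_tensor:
  fixes d \<kappa> :: "'l endo" and M :: "'k endo"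
  assumes split: "torsion_split \<kappa> d" and \<kappa>: "\<kappa> * \<kappa> = 1"
    and \<sigma>: "\<And>c l. app \<kappa> c l = \<sigma> l * c l"
    and M: "two_torsion M" "reads M (UNIV \<times> S)" "finite S"
  shows "two_torsion (hat d + hat \<kappa> * hat' M)"
proof -
  obtain P0 e0 h0 k0 where s: "1 = P0 + e0 + d * h0 + h0 * d" "d * P0 = 0" "P0 * d = 0"
    "2 * e0 = d * k0 + k0 * d" "\<kappa> * P0 = P0 * \<kappa>" "\<kappa> * h0 = - (h0 * \<kappa>)" "\<kappa> * k0 = - (k0 * \<kappa>)"
    using split unfolding torsion_split_def by blast
  let ?hat = "hat :: 'l endo \<Rightarrow> ('k \<times> 'l) endo"
  define P e h k where "P = (hat P0 :: ('k \<times> 'l) endo)" and "e = (hat e0 :: ('k \<times> 'l) endo)"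
    and "h = (hat h0 :: ('k \<times> 'l) endo)" and "k = (hat k0 :: ('k \<times> 'l) endo)"
  define N where "N = ?hat \<kappa> * hat' M"
  define D where "D = ?hat d + N"
  note hc = hat_commute[OF M(2,3)]
  have NX: "hat X * N = N * hat X" if "\<kappa> * X = X * \<kappa>" for X
  proof -
    have c: "?hat X * ?hat \<kappa> = ?hat \<kappa> * ?hat X" using arg_cong[OF that[symmetric], of ?hat] by (simp only: hat_ring)
    have "hat X * N = (hat X * hat \<kappa>) * hat' M" by (simp only: N_def mult.assoc)
    also have "\<dots> = hat \<kappa> * (hat X * hat' M)" by (simp only: c mult.assoc)
    finally show ?thesis by (simp only: hc[of X] N_def mult.assoc)
  qed
  have NX': "hat X * N = - (N * hat X)" if "\<kappa> * X = - (X * \<kappa>)" for X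
  proof -
    have c: "?hat \<kappa> * ?hat X = - (?hat X * ?hat \<kappa>)" using arg_cong[OF that, of ?hat] by (simp only: hat_ring)
    have "hat X * N = - (- (hat X * hat \<kappa>) * hat' M)" by (simp add: N_def mult.assoc)
    also have "\<dots> = - (hat \<kappa> * (hat X * hat' M))" by (simp only: c[symmetric] mult.assoc)
    finally show ?thesis by (simp only: hc[of X] N_def mult.assoc)
  qed
  have PN: "P * N = N * P" and hN: "h * N = - (N * h)" and kN: "k * N = - (N * k)"
    unfolding P_def h_def k_def using NX NX' s by auto
  have s': "1 = P + e + hat d * h + h * hat d" "hat d * P = 0" "P * hat d = 0" "2 * e = hat d * k + k * hat d"
    using arg_cong[OF s(1), of ?hat] arg_cong[OF s(2), of ?hat] arg_cong[OF s(3), of ?hat] arg_cong[OF s(4), of ?hat]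
    by (simp_all only: P_def e_def h_def k_def hat_ring mult_2)
  have one: "1 = P + e + D * h + h * D" using s'(1) by (simp add: D_def algebra_simps hN)
  have two: "2 * e = D * k + k * D" using s'(4) by (simp add: D_def algebra_simps kN)
  have PD: "P * D = N * P" "D * P = N * P" using s'(2,3) PN by (simp_all add: D_def algebra_simps)
  have split_c: "\<exists>x. (\<lambda>i. 2 * c i) = (\<lambda>i. 2 * app P c i + app D x i)" if "app D c = (\<lambda>_. 0)" for c
  proof -
    have c: "c = (\<lambda>i. app P c i + app e c i + app D (app h c) i)"
      using arg_cong[OF one, of "\<lambda>X. app X c"] that by simp
    have "app (2 * e) c = app (D * k + k * D) c" by (simp only: two)
    then have e2: "2 * app e c i = app D (app k c) i" for i using that by (simp only: mult_2 app_ring fun_eq_iff) simp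
    have "(\<lambda>i. 2 * c i) = (\<lambda>i. 2 * app P c i + app D (\<lambda>i. app k c i + 2 * app h c i) i)"
      by (subst c) (simp add: app_add app_scale e2[symmetric] algebra_simps)
    then show ?thesis by blast
  qed
  have "two_torsion D"
    unfolding two_torsion_def
  proof (intro allI impI, elim conjE)
    fix m :: int and c b
    assume m: "0 < m" and c: "app D c = (\<lambda>_. 0)" and mc: "(\<lambda>i. m * c i) = app D b"
    have NPc: "app N (app P c) = (\<lambda>_. 0)"
      using arg_cong[OF PD(1), of "\<lambda>X. app X c"] c by simp
    have "(\<lambda>i. m * app P c i) = app P (app D b)" unfolding mc[symmetric] by (simp add: app_scale)
    also have "\<dots> = app N (app P b)" using arg_cong[OF PD(1), of "\<lambda>X. app X b"] by simp
    finally have mPc: "m * app P c (x, l) = app N (app P b) (x, l)" for x l by (simp add: fun_eq_iff)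
    have N: "app N z (x, l) = \<sigma> l * app M (\<lambda>x. z (x, l)) x" for z x l
      by (simp add: N_def app_hat app_hat' \<sigma>)
    have \<sigma>\<sigma>: "\<sigma> l * \<sigma> l = 1" for l
      using arg_cong[OF \<kappa>, of "\<lambda>X. app X (\<lambda>_. 1) l"] by (simp add: \<sigma>)
    \<comment> \<open>For fixed l the slice of \<open>app P c\<close> is a torsion cycle of M, so
      the hypothesis on M applies slice by slice.\<close>
    have "\<exists>y. (\<lambda>x. 2 * app P c (x, l)) = app M y" for l
    proof -
      have "\<sigma> l * (\<sigma> l * app M (\<lambda>x. app P c (x, l)) x) = 0" for x using NPc N[of "app P c" x l] by simp
      then have "app M (\<lambda>x. app P c (x, l)) = (\<lambda>_. 0)"
        by (simp add: mult.assoc[symmetric] \<sigma>\<sigma> fun_eq_iff)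
      moreover have "(\<lambda>x. m * app P c (x, l)) = app M (\<lambda>x. \<sigma> l * app P b (x, l))"
        unfolding app_scale mPc N ..
      ultimately show ?thesis using M(1) m unfolding two_torsion_def by blast
    qed
    then obtain y where y: "\<And>l. (\<lambda>x. 2 * app P c (x, l)) = app M (y l)" by metis
    define B where "B = (\<lambda>(x, l). \<sigma> l * y l x)"
    have "app N B (x, l) = 2 * app P c (x, l)" for x l
    proof -
      have "app N B (x, l) = \<sigma> l * (\<sigma> l * app M (y l) x)" by (simp add: N B_def app_scale)
      also have "\<dots> = app M (y l) x" by (simp add: mult.assoc[symmetric] \<sigma>\<sigma>)
      finally show ?thesis using fun_cong[OF y[of l], of x] by simp
    qed
    then have NB: "app N B = (\<lambda>i. 2 * app P c i)" by (auto simp: fun_eq_iff)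
    have DPc: "app D (app P c) = (\<lambda>_. 0)"
      using arg_cong[OF PD(2), of "\<lambda>X. app X c"] NPc by simp
    \<comment> \<open>\<open>D\<close> agrees with \<open>N\<close> only next to \<open>P\<close>,
      so the bound is obtained for the double application of \<open>P\<close>; applying
      \<open>split_c\<close> to \<open>app P c\<close> as well compensates for this.\<close>
    have "(\<lambda>i. 2 * app P (app P c) i) = app P (app N B)" unfolding NB by (simp add: app_scale)
    also have "\<dots> = app D (app P B)"
      using arg_cong[OF PN, of "\<lambda>X. app X B"] arg_cong[OF PD(2), of "\<lambda>X. app X B"] by simp
    finally have PPc: "(\<lambda>i. 2 * app P (app P c) i) = app D (app P B)" .
    obtain x1 where 1: "(\<lambda>i. 2 * c i) = (\<lambda>i. 2 * app P c i + app D x1 i)" using split_c[OF c] by blast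
    obtain x2 where 2: "(\<lambda>i. 2 * app P c i) = (\<lambda>i. 2 * app P (app P c) i + app D x2 i)"
      using split_c[OF DPc] by blast
    have "(\<lambda>i. 2 * c i) = app D (\<lambda>i. app P B i + x2 i + x1 i)"
      unfolding app_add using 1 fun_cong[OF 2] fun_cong[OF PPc] by (simp add: fun_eq_iff)
    then show "\<exists>b'. (\<lambda>i. 2 * c i) = app D b'" by blast
  qed
  then show ?thesis by (simp add: D_def N_def)
qed

lemma sg_prod: "finite I \<Longrightarrow> sg r I = (\<Prod>l\<in>I. if l < r then - 1 else 1)"
proof (induction I rule: finite_induct)
  case (insert x I)
  have "{l \<in> insert x I. l < r} = (if x < r then insert x {l \<in> I. l < r} else {l \<in> I. l < r})" by auto
  then show ?case using insert by (simp add: sg_def)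
qed (simp add: sg_def)

lemma sg_Un: "finite I \<Longrightarrow> finite J \<Longrightarrow> I \<inter> J = {} \<Longrightarrow> sg r (I \<union> J) = sg r I * sg r J"
  by (simp add: sg_prod prod.union_disjoint)

text \<open>The sign of sorting the concatenation of \<open>I\<close> and \<open>J\<close>, which relates the two orderings of the edges.\<close>

definition shuffle_sign :: "nat set \<Rightarrow> nat set \<Rightarrow> int" where
  "shuffle_sign I J = (\<Prod>l\<in>I. sg l J)"

lemma shuffle_sign_square [simp]: "shuffle_sign I J * shuffle_sign I J = 1"
  by (simp add: shuffle_sign_def flip: prod.distrib)

lemma shuffle_sign_square_left [simp]: "shuffle_sign I J * (shuffle_sign I J * x) = x"
  by (simp flip: mult.assoc)

text \<open>The factor \<open>sg r J\<close> occurs both in the shuffle sign and in the sign of r in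
  the union, and cancels.\<close>

lemma shuffle_sign_left:
  assumes "finite I" "finite J" "I \<inter> J = {}" "r \<in> I"
  shows "shuffle_sign I J * sg r (I \<union> J) = sg r I * shuffle_sign (I - {r}) J"
proof -
  have "shuffle_sign I J = sg r J * shuffle_sign (I - {r}) J"
    unfolding shuffle_sign_def using assms by (simp add: prod.remove)
  then have "shuffle_sign I J * sg r (I \<union> J) = sg r I * shuffle_sign (I - {r}) J * (sg r J * sg r J)"
    using assms by (simp add: sg_Un del: sg_square)
  then show ?thesis by simp
qed

text \<open>The elements of I below r enter through the sign of r, those above r through the shuffle
  sign. Together all of I is counted, which is the Koszul sign.\<close>

lemma shuffle_sign_right:
  assumes "finite I" "finite J" "I \<inter> J = {}" "r \<in> J"
  shows "shuffle_sign I J * sg r (I \<union> J) = (- 1) ^ card I * (sg r J * shuffle_sign I (J - {r}))"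
proof -
  have "sg l J = (if r < l then - 1 else 1) * sg l (J - {r})" for l
    using assms by (simp add: sg_prod prod.remove)
  then have 1: "shuffle_sign I J = (\<Prod>l\<in>I. if r < l then - 1 else 1) * shuffle_sign I (J - {r})"
    by (simp add: shuffle_sign_def prod.distrib)
  have "(\<Prod>l\<in>I. if r < l then - 1 else 1) * sg r I =
      (\<Prod>l\<in>I. (if r < l then - 1 else 1) * (if l < r then - 1 else (1 :: int)))"
    using assms(1) by (simp add: sg_prod prod.distrib)
  also have "\<dots> = (\<Prod>l\<in>I. - 1)" using assms by (intro prod.cong refl) auto
  also have "\<dots> = (- 1) ^ card I" by simp
  finally have 2: "(\<Prod>l\<in>I. if r < l then - 1 else 1) * sg r I = (- 1) ^ card I" .
  have "shuffle_sign I J * sg r (I \<union> J) =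
      ((\<Prod>l\<in>I. if r < l then - 1 else 1) * sg r I) * (sg r J * shuffle_sign I (J - {r}))"
    unfolding 1 sg_Un[OF assms(1-3)] by (simp only: ac_simps)
  then show ?thesis unfolding 2 .
qed

section \<open>The complex of a disjoint union\<close>

locale ugraph_pair = ends a b + Y: ugraph a b Y E1 + Z: ugraph a b Z E2
  for a b :: "nat \<Rightarrow> 'v" and Y E1 Z E2 +
  assumes YZ: "Y \<inter> Z = {}"
begin

sublocale ugraph a b "Y \<union> Z" "E1 \<union> E2"
  by unfold_locales (use Y.finite_V Y.finite_E Y.ends_in Z.finite_V Z.finite_E Z.ends_in in auto)

lemma E_disjoint: "E1 \<inter> E2 = {}"
  using Y.ends_in(1) Z.ends_in(1) YZ by blast

lemma ends_notin: "r \<in> E1 \<Longrightarrow> a r \<notin> Z \<and> b r \<notin> Z" "r \<in> E2 \<Longrightarrow> a r \<notin> Y \<and> b r \<notin> Y"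
  using Y.ends_in Z.ends_in YZ by blast+

lemma comp_Un:
  assumes "I \<subseteq> E1" "J \<subseteq> E2"
  shows "v \<in> Y \<Longrightarrow> comp_of (I \<union> J) v = comp_of I v" and "v \<in> Z \<Longrightarrow> comp_of (I \<union> J) v = comp_of J v"
proof -
  assume v: "v \<in> Y"
  have "comp_of I v \<subseteq> Y" using assms(1) v by (rule Y.comp_subset_V)
  then have "sat J (comp_of I v)" using assms(2) ends_notin(2) unfolding sat_def by blast
  then have "comp_of (I \<union> J) v \<subseteq> comp_of I v" by (intro comp_least sat_union) auto
  then show "comp_of (I \<union> J) v = comp_of I v" using comp_mono[of I "I \<union> J" v] by auto
next
  assume v: "v \<in> Z"
  have "comp_of J v \<subseteq> Z" using assms(2) v by (rule Z.comp_subset_V)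
  then have "sat I (comp_of J v)" using assms(1) ends_notin(1) unfolding sat_def by blast
  then have "comp_of (I \<union> J) v \<subseteq> comp_of J v" by (intro comp_least sat_union) auto
  then show "comp_of (I \<union> J) v = comp_of J v" using comp_mono[of J "I \<union> J" v] by auto
qed

lemma pull_Un:
  assumes "I \<subseteq> E1" "J \<subseteq> E2" "U \<subseteq> Y" "X \<subseteq> Z"
  shows "r \<in> E1 \<Longrightarrow> pull r (I \<union> J) f (U \<union> X) = pull r I (\<lambda>U. f (U \<union> X)) U"
    and "r \<in> E2 \<Longrightarrow> pull r (I \<union> J) f (U \<union> X) = pull r J (\<lambda>X. f (U \<union> X)) X"
proof -
  assume r: "r \<in> E1"
  note ab = Y.ends_in[OF r]
  have "comp_of I (a r) \<inter> X = {}" "comp_of I (b r) \<inter> X = {}"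
    using Y.comp_subset_V[OF assms(1)] ab assms(4) YZ by blast+
  then have "U \<union> X - comp_of I (a r) = U - comp_of I (a r) \<union> X" "U \<union> X - comp_of I (b r) = U - comp_of I (b r) \<union> X"
    by auto
  moreover have "a r \<notin> X" using ab assms(4) YZ by auto
  ultimately show "pull r (I \<union> J) f (U \<union> X) = pull r I (\<lambda>U. f (U \<union> X)) U"
    by (simp add: pull_def comp_Un(1)[OF assms(1,2)] ab)
next
  assume r: "r \<in> E2"
  note ab = Z.ends_in[OF r]
  have "comp_of J (a r) \<inter> U = {}" "comp_of J (b r) \<inter> U = {}"
    using Z.comp_subset_V[OF assms(2)] ab assms(3) YZ by blast+
  then have "U \<union> X - comp_of J (a r) = U \<union> (X - comp_of J (a r))" "U \<union> X - comp_of J (b r) = U \<union> (X - comp_of J (b r))"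
    by auto
  moreover have "a r \<notin> U" using ab assms(3) YZ by auto
  ultimately show "pull r (I \<union> J) f (U \<union> X) = pull r J (\<lambda>X. f (U \<union> X)) X"
    by (simp add: pull_def comp_Un(2)[OF assms(1,2)] ab)
qed

lemma valid_Un:
  "(I, U) \<in> Y.valid {} \<Longrightarrow> (J, X) \<in> Z.valid {} \<Longrightarrow> (I \<union> J, U \<union> X) \<in> valid {}"
  using Y.ends_in Z.ends_in YZ unfolding valid_def Y.valid_def Z.valid_def sat_def by blast

lemma valid_Int:
  assumes "(I, U) \<in> valid {}"
  shows "(I \<inter> E1, U \<inter> Y) \<in> Y.valid {}" "(I \<inter> E2, U \<inter> Z) \<in> Z.valid {}"
  using assms Y.ends_in Z.ends_in unfolding valid_def Y.valid_def Z.valid_def sat_def by auto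

text \<open>The index of the \<open>Z\<close> part comes first because
  \<open>two_torsion_tensor\<close> expects the factor with a \<open>torsion_split\<close>
  second.\<close>

definition to_pair :: "(nat set \<times> 'v set \<Rightarrow> int) \<Rightarrow> (nat set \<times> 'v set) \<times> (nat set \<times> 'v set) \<Rightarrow> int" where
  "to_pair c = (\<lambda>((J, X), (I, U)). if (I, U) \<in> Y.valid {} \<and> (J, X) \<in> Z.valid {}
     then shuffle_sign I J * c (I \<union> J, U \<union> X) else 0)"

definition of_pair :: "((nat set \<times> 'v set) \<times> (nat set \<times> 'v set) \<Rightarrow> int) \<Rightarrow> nat set \<times> 'v set \<Rightarrow> int" where
  "of_pair z = (\<lambda>(I, U). if (I, U) \<in> valid {}
     then shuffle_sign (I \<inter> E1) (I \<inter> E2) * z ((I \<inter> E2, U \<inter> Z), (I \<inter> E1, U \<inter> Y)) else 0)"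

lemma to_pair_apply: "to_pair c ((J, X), (I, U)) = (if (I, U) \<in> Y.valid {} \<and> (J, X) \<in> Z.valid {}
     then shuffle_sign I J * c (I \<union> J, U \<union> X) else 0)"
  by (simp add: to_pair_def)

lemma linear_to_pair: "linear_map to_pair" and linear_of_pair: "linear_map of_pair"
  by (auto simp: linear_map_def to_pair_def of_pair_def fun_eq_iff distrib_left)

lemma of_to_pair: "of_pair (to_pair c) = app (restr (valid {})) c"
proof
  fix i :: "nat set \<times> 'v set"
  obtain I U where i: "i = (I, U)" by (cases i)
  have "I \<inter> E1 \<union> I \<inter> E2 = I" "U \<inter> Y \<union> U \<inter> Z = U" if "(I, U) \<in> valid {}"
    using validD(1,2)[OF that] by auto
  then show "of_pair (to_pair c) i = app (restr (valid {})) c i"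
    using valid_Int[of I U] by (simp add: i of_pair_def to_pair_def)
qed

lemma to_of_pair:
  assumes "(I, U) \<in> Y.valid {}" "(J, X) \<in> Z.valid {}"
  shows "to_pair (of_pair z) ((J, X), (I, U)) = z ((J, X), (I, U))"
proof -
  have "(I \<union> J) \<inter> E1 = I" "(I \<union> J) \<inter> E2 = J" "(U \<union> X) \<inter> Y = U" "(U \<union> X) \<inter> Z = X"
    using Y.validD(1,2)[OF assms(1)] Z.validD(1,2)[OF assms(2)] YZ E_disjoint by blast+
  then show ?thesis using assms valid_Un[OF assms] by (simp add: to_pair_def of_pair_def)
qed

abbreviation tensor_dd where
  "tensor_dd \<equiv> hat (Y.dd {} E1) + hat flip * hat' (Z.dd {} E2)"

lemma app_tensor_dd: "app tensor_dd z (k, (I, U)) =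
  app (Y.dd {} E1) (\<lambda>l. z (k, l)) (I, U) + (- 1) ^ card I * app (Z.dd {} E2) (\<lambda>k. z (k, (I, U))) k"
  by (simp add: app_hat app_hat')

lemma to_pair_dd: "to_pair (app (dd {} (E1 \<union> E2)) c) = app tensor_dd (to_pair c)"
proof
  fix i :: "(nat set \<times> 'v set) \<times> (nat set \<times> 'v set)"
  obtain J X I U where i: "i = ((J, X), (I, U))" by (metis surj_pair)
  show "to_pair (app (dd {} (E1 \<union> E2)) c) i = app tensor_dd (to_pair c) i"
  proof (cases "(I, U) \<in> Y.valid {} \<and> (J, X) \<in> Z.valid {}")
    case True
    then have y: "(I, U) \<in> Y.valid {}" and z: "(J, X) \<in> Z.valid {}" by auto
    note vy = Y.validD[OF y] and vz = Z.validD[OF z]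
    have disj: "I \<inter> J = {}" using vy(1) vz(1) E_disjoint by blast
    have IE: "I \<inter> E1 = I" "J \<inter> E2 = J" "(I \<union> J) \<inter> (E1 \<union> E2) = I \<union> J" using vy(1) vz(1) by auto
    have Y: "pull r (I - {r}) (\<lambda>U. to_pair c ((J, X), (I - {r}, U))) U =
        shuffle_sign (I - {r}) J * pull r (I \<union> J - {r}) (\<lambda>X. c (I \<union> J - {r}, X)) (U \<union> X)" if r: "r \<in> I" for r
    proof -
      have IJ: "I - {r} \<union> J = I \<union> J - {r}" using r disj by auto
      have "pull r (I - {r}) (\<lambda>U. to_pair c ((J, X), (I - {r}, U))) U =
          pull r (I - {r}) (\<lambda>U. shuffle_sign (I - {r}) J * c (I \<union> J - {r}, U \<union> X)) U"
      proof (rule Y.pull_cong)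
        show "(insert r (I - {r}), U) \<in> Y.valid {}" using y r by (simp add: insert_absorb)
      qed (use z IJ in \<open>simp add: to_pair_apply\<close>)
      also have "\<dots> = shuffle_sign (I - {r}) J * pull r (I - {r}) (\<lambda>U. c (I \<union> J - {r}, U \<union> X)) U"
        by (simp add: pull_def distrib_left)
      also have "pull r (I - {r}) (\<lambda>U. c (I \<union> J - {r}, U \<union> X)) U =
          pull r (I - {r} \<union> J) (\<lambda>X. c (I \<union> J - {r}, X)) (U \<union> X)"
        using r vy vz by (intro pull_Un(1)[symmetric]) auto
      finally show ?thesis unfolding IJ .
    qed
    have Z: "pull r (J - {r}) (\<lambda>X. to_pair c ((J - {r}, X), (I, U))) X =
        shuffle_sign I (J - {r}) * pull r (I \<union> J - {r}) (\<lambda>X. c (I \<union> J - {r}, X)) (U \<union> X)" if r: "r \<in> J" for r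
    proof -
      have IJ: "I \<union> (J - {r}) = I \<union> J - {r}" using r disj by auto
      have "pull r (J - {r}) (\<lambda>X. to_pair c ((J - {r}, X), (I, U))) X =
          pull r (J - {r}) (\<lambda>X. shuffle_sign I (J - {r}) * c (I \<union> J - {r}, U \<union> X)) X"
      proof (rule Z.pull_cong)
        show "(insert r (J - {r}), X) \<in> Z.valid {}" using z r by (simp add: insert_absorb)
      qed (use y IJ in \<open>simp add: to_pair_apply\<close>)
      also have "\<dots> = shuffle_sign I (J - {r}) * pull r (J - {r}) (\<lambda>X. c (I \<union> J - {r}, U \<union> X)) X"
        by (simp add: pull_def distrib_left)
      also have "pull r (J - {r}) (\<lambda>X. c (I \<union> J - {r}, U \<union> X)) X =
          pull r (I \<union> (J - {r})) (\<lambda>X. c (I \<union> J - {r}, X)) (U \<union> X)"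
        using r vy vz by (intro pull_Un(2)[symmetric]) auto
      finally show ?thesis unfolding IJ .
    qed
    let ?p = "\<lambda>r. pull r (I \<union> J - {r}) (\<lambda>X. c (I \<union> J - {r}, X)) (U \<union> X)"
    have "to_pair (app (dd {} (E1 \<union> E2)) c) i = (\<Sum>r\<in>I \<union> J. shuffle_sign I J * sg r (I \<union> J) * ?p r)"
      using y z valid_Un[OF y z] by (simp add: i to_pair_apply app_dd IE sum_distrib_left mult.assoc)
    also have "\<dots> = (\<Sum>r\<in>I. shuffle_sign I J * sg r (I \<union> J) * ?p r) + (\<Sum>r\<in>J. shuffle_sign I J * sg r (I \<union> J) * ?p r)"
      using disj vy(5) vz(5) by (intro sum.union_disjoint)
    also have "(\<Sum>r\<in>I. shuffle_sign I J * sg r (I \<union> J) * ?p r) =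
        (\<Sum>r\<in>I. sg r I * pull r (I - {r}) (\<lambda>U. to_pair c ((J, X), (I - {r}, U))) U)"
      by (rule sum.cong[OF refl]) (simp only: shuffle_sign_left[OF vy(5) vz(5) disj] Y mult.assoc)
    also have "(\<Sum>r\<in>J. shuffle_sign I J * sg r (I \<union> J) * ?p r) =
        (\<Sum>r\<in>J. (- 1) ^ card I * (sg r J * pull r (J - {r}) (\<lambda>X. to_pair c ((J - {r}, X), (I, U))) X))"
      by (rule sum.cong[OF refl]) (simp only: shuffle_sign_right[OF vy(5) vz(5) disj] Z mult.assoc)
    finally show ?thesis using y z
      by (simp only: i app_tensor_dd Y.app_dd Z.app_dd IE if_True sum_distrib_left)
  next
    case False
    then have "(I, U) \<notin> Y.valid {} \<or> (J, X) \<notin> Z.valid {}" by blast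
    then show ?thesis
    proof
      assume "(I, U) \<notin> Y.valid {}"
      then have "(\<lambda>k. to_pair c (k, (I, U))) = (\<lambda>_. 0)" by (auto simp: to_pair_def fun_eq_iff)
      then show ?thesis using \<open>(I, U) \<notin> Y.valid {}\<close>
        unfolding i app_tensor_dd by (simp add: Y.app_dd to_pair_apply)
    next
      assume "(J, X) \<notin> Z.valid {}"
      then have "(\<lambda>l. to_pair c ((J, X), l)) = (\<lambda>_. 0)" by (auto simp: to_pair_def fun_eq_iff)
      then show ?thesis using \<open>(J, X) \<notin> Z.valid {}\<close>
        unfolding i app_tensor_dd by (simp add: Z.app_dd to_pair_apply)
    qed
  qed
qed

lemma two_torsion_Un:
  assumes "torsion_split flip (Y.dd {} E1)" "two_torsion (Z.dd {} E2)"
  shows "two_torsion (dd {} (E1 \<union> E2))"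
proof (rule two_torsion_transport[OF linear_to_pair linear_of_pair of_to_pair to_pair_dd])
  show "restr (valid {}) * dd {} (E1 \<union> E2) = dd {} (E1 \<union> E2)" by (rule reads_grade_valid[OF reads_dd])
  have r: "reads (Z.dd {} E2) (UNIV \<times> Z.valid {})"
    by (rule reads_mono[OF Z.reads_dd]) (auto simp: Z.grade_def)
  have "flip * flip = (1 :: (nat set \<times> 'v set) endo)"
    by (rule endo_eqI) (simp flip: power_add mult.assoc)
  from two_torsion_tensor[OF assms(1) this app_flip assms(2) r Z.finite_valid]
  show "two_torsion tensor_dd" .
  fix z
  \<comment> \<open>\<open>to_pair\<close> inverts \<open>of_pair\<close> on valid indices only;
    this is enough, since both differentials read nothing else.\<close>
  show "of_pair (app tensor_dd (to_pair (of_pair z))) = of_pair (app tensor_dd z)"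
  proof
    fix i :: "nat set \<times> 'v set"
    obtain I U where i: "i = (I, U)" by (cases i)
    show "of_pair (app tensor_dd (to_pair (of_pair z))) i = of_pair (app tensor_dd z) i"
    proof (cases "(I, U) \<in> valid {}")
      case True
      note v = valid_Int[OF True]
      have "app (Y.dd {} E1) (\<lambda>l. to_pair (of_pair z) ((I \<inter> E2, U \<inter> Z), l)) (I \<inter> E1, U \<inter> Y) =
          app (Y.dd {} E1) (\<lambda>l. z ((I \<inter> E2, U \<inter> Z), l)) (I \<inter> E1, U \<inter> Y)"
        by (rule readsD[OF Y.reads_dd]) (use v to_of_pair in \<open>auto simp: Y.grade_def\<close>)
      moreover have "app (Z.dd {} E2) (\<lambda>k. to_pair (of_pair z) (k, (I \<inter> E1, U \<inter> Y))) (I \<inter> E2, U \<inter> Z) =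
          app (Z.dd {} E2) (\<lambda>k. z (k, (I \<inter> E1, U \<inter> Y))) (I \<inter> E2, U \<inter> Z)"
        by (rule readsD[OF Z.reads_dd]) (use v to_of_pair in \<open>auto simp: Z.grade_def\<close>)
      ultimately show ?thesis using True by (simp only: i of_pair_def prod.case if_True app_tensor_dd)
    qed (simp add: i of_pair_def)
  qed
qed

end

text \<open>Induction on the number of vertices: the connected component Y of some vertex has a
  \<open>torsion_split\<close>, and its complement is smaller.\<close>

theorem ugraph_two_torsion:
  assumes "ugraph a b V E"
  shows "two_torsion (ugraph.dd a b V E {} E)"
  using assms
proof (induction "card V" arbitrary: V E rule: less_induct)
  case less
  interpret ugraph a b V E by (rule less.prems)
  show ?case
  proof (cases "V = {}")
    case True
    then have E: "J \<inter> E = {}" for J using ends_in by auto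
    have "dd {} E = 0"
    proof (rule endo_eqI)
      fix c and i :: "nat set \<times> 'a set"
      obtain J U where i: "i = (J, U)" by (cases i)
      show "app (dd {} E) c i = app 0 c i" unfolding i app_dd E by simp
    qed
    then show ?thesis by (auto simp: two_torsion_def fun_eq_iff)
  next
    case False
    then obtain w where w: "w \<in> V" by blast
    define Y where "Y = comp_of E w"
    define E1 where "E1 = {r \<in> E. a r \<in> Y}"
    have YV: "Y \<subseteq> V" unfolding Y_def using w by (intro comp_subset_V) auto
    have sY: "a r \<in> Y \<longleftrightarrow> b r \<in> Y" if "r \<in> E" for r
      using comp_sat[of E w] that by (simp add: Y_def sat_def)
    have Y: "ugraph a b Y E1"
      by unfold_locales (use YV sY finite_V finite_E in \<open>auto simp: E1_def intro: finite_subset\<close>)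
    have Z: "ugraph a b (V - Y) (E - E1)"
      by unfold_locales (use sY finite_V finite_E ends_in in \<open>auto simp: E1_def\<close>)
    interpret pair: ugraph_pair a b Y E1 "V - Y" "E - E1"
      by (intro ugraph_pair.intro Y Z ugraph_pair_axioms.intro) auto
    have "comp_of E1 w = Y"
    proof
      show "comp_of E1 w \<subseteq> Y" unfolding Y_def by (rule comp_mono) (auto simp: E1_def)
      have "comp_of E1 w \<subseteq> Y" unfolding Y_def by (rule comp_mono) (auto simp: E1_def)
      then have "sat (E - E1) (comp_of E1 w)" using sY by (auto simp: sat_def E1_def)
      then have "sat (E1 \<union> (E - E1)) (comp_of E1 w)" by (intro sat_union) auto
      moreover have "E1 \<union> (E - E1) = E" by (auto simp: E1_def)
      ultimately show "Y \<subseteq> comp_of E1 w" unfolding Y_def by (intro comp_least) auto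
    qed
    then have "torsion_split flip (pair.Y.dd {} E1)"
      by (intro pair.Y.connected_torsion_split[of w]) (auto simp: Y_def)
    moreover have "two_torsion (pair.Z.dd {} (E - E1))"
    proof (rule less.hyps[OF _ Z])
      have "w \<in> Y" by (simp add: Y_def)
      then show "card (V - Y) < card V" using w finite_V by (intro psubset_card_mono) auto
    qed
    ultimately have "two_torsion (pair.dd {} (E1 \<union> (E - E1)))" by (rule pair.two_torsion_Un)
    moreover have "E1 \<union> (E - E1) = E" "Y \<union> (V - Y) = V" using YV by (auto simp: E1_def)
    ultimately show ?thesis by simp
  qed
qed

section \<open>Chromatic homology\<close>

lemma a2_coeff_0 [simp]: "a2_coeff 0 n = 0"
  by transfer simp

text \<open>The multiplication table at the merged factor: 1 arises only from two labels 1, x only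
  from one 1 and one x, and two labels x give nothing.\<close>

lemma pure_tensor_merge:
  fixes S :: "'c set"
  defines "x \<equiv> basis_labels S :: 'c \<Rightarrow> int a2"
  assumes "finite K" "W \<notin> K" "S \<subseteq> K" and T: "T \<subseteq> insert W (K - {P, Q})"
  shows "pure_tensor (insert W (K - {P, Q})) (x(W := x P * x Q)) T =
    of_bool ((if W \<in> T then (P \<in> S) \<noteq> (Q \<in> S) else P \<notin> S \<and> Q \<notin> S) \<and> S - {P, Q} = T - {W})"
proof -
  let ?K = "K - {P, Q}"
  have "pure_tensor (insert W ?K) (x(W := x P * x Q)) T =
      (\<Prod>X\<in>insert W ?K. a2_coeff ((x(W := x P * x Q)) X) (of_bool (X \<in> T)))"
    using T by (simp only: pure_tensor_def if_True)
  also have "\<dots> = a2_coeff (x P * x Q) (of_bool (W \<in> T)) *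
      (\<Prod>X\<in>?K. a2_coeff ((x(W := x P * x Q)) X) (of_bool (X \<in> T)))"
    using assms(2,3) by (subst prod.insert) auto
  also have "(\<Prod>X\<in>?K. a2_coeff ((x(W := x P * x Q)) X) (of_bool (X \<in> T))) =
      (\<Prod>X\<in>?K. of_bool (X \<in> S \<longleftrightarrow> X \<in> T))"
    using assms(3) by (intro prod.cong refl) (auto simp: x_def basis_labels_def)
  also have "\<dots> = of_bool (\<forall>X\<in>?K. X \<in> S \<longleftrightarrow> X \<in> T)"
  proof (cases "\<forall>X\<in>?K. X \<in> S \<longleftrightarrow> X \<in> T")
    case False
    then have "(\<Prod>X\<in>?K. of_bool (X \<in> S \<longleftrightarrow> X \<in> T)) = (0 :: int)"
      using assms(2) by (intro prod_zero) auto
    then show ?thesis using False by simp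
  qed simp
  also have "(\<forall>X\<in>?K. X \<in> S \<longleftrightarrow> X \<in> T) \<longleftrightarrow> S - {P, Q} = T - {W}"
    using assms(3,4) T by blast
  also have "a2_coeff (x P * x Q) (of_bool (W \<in> T)) =
      of_bool (if W \<in> T then (P \<in> S) \<noteq> (Q \<in> S) else P \<notin> S \<and> Q \<notin> S)"
    by (auto simp: x_def basis_labels_def a2_x_squared)
  finally show ?thesis by (simp only: of_bool_conj)
qed

text \<open>If W is labelled x in T, its x came from P or from Q; otherwise T is its own only
  source.\<close>

lemma sum_merge_coeffs:
  fixes t :: "'c set \<Rightarrow> int"
  assumes K: "finite K" and "W \<notin> K" and PQ: "P \<in> K" "Q \<in> K" "P \<noteq> Q" and T: "T \<subseteq> insert W (K - {P, Q})"
  shows "(\<Sum>S\<in>Pow K. t S * of_bool ((if W \<in> T then (P \<in> S) \<noteq> (Q \<in> S) else P \<notin> S \<and> Q \<notin> S) \<and>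
      S - {P, Q} = T - {W})) =
    (if W \<in> T then t (insert P (T - {W})) + t (insert Q (T - {W})) else t T)"
proof -
  let ?A = "if W \<in> T then {insert P (T - {W}), insert Q (T - {W})} else {T}"
  have notin: "P \<notin> T" "Q \<notin> T" using T PQ \<open>W \<notin> K\<close> by auto
  have A: "?A \<subseteq> Pow K" using T PQ by auto
  have "(\<Sum>S\<in>Pow K. t S * of_bool ((if W \<in> T then (P \<in> S) \<noteq> (Q \<in> S) else P \<notin> S \<and> Q \<notin> S) \<and>
      S - {P, Q} = T - {W})) = (\<Sum>S\<in>Pow K. if S \<in> ?A then t S else 0)"
  proof (rule sum.cong[OF refl])
    fix S assume "S \<in> Pow K"
    have "(if W \<in> T then (P \<in> S) \<noteq> (Q \<in> S) else P \<notin> S \<and> Q \<notin> S) \<and> S - {P, Q} = T - {W} \<longleftrightarrow> S \<in> ?A"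
      using notin PQ(3) by (cases "W \<in> T"; cases "P \<in> S"; cases "Q \<in> S") (simp_all, blast+)
    then show "t S * of_bool ((if W \<in> T then (P \<in> S) \<noteq> (Q \<in> S) else P \<notin> S \<and> Q \<notin> S) \<and>
      S - {P, Q} = T - {W}) = (if S \<in> ?A then t S else 0)" by simp
  qed
  also have "\<dots> = sum t ?A"
    using A K by (simp only: sum.inter_restrict[symmetric] finite_Pow_iff Int_absorb1)
  also have "\<dots> = (if W \<in> T then t (insert P (T - {W})) + t (insert Q (T - {W})) else t T)"
  proof -
    have "insert P (T - {W}) \<noteq> insert Q (T - {W})" using notin PQ(3) by blast
    then show ?thesis by simp
  qed
  finally show ?thesis .
qed

lemma edge_map_coeff:
  fixes t :: "'v set set \<Rightarrow> int"
  assumes graph: "finite_multigraph G" and cube: "insert r I \<in> cube G" and e: "edges G ! r = {u, v}"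
    and PQ: "P \<in> components G I" "Q \<in> components G I" "u \<in> P" "v \<in> Q" "P \<noteq> Q"
    and W: "P \<union> Q \<notin> components G I" and t: "t \<in> a2_tensor (components G I)"
    and T: "T \<subseteq> insert (P \<union> Q) (components G I - {P, Q})"
  shows "edge_map G I (insert r I) t T =
    (if P \<union> Q \<in> T then t (insert P (T - {P \<union> Q})) + t (insert Q (T - {P \<union> Q})) else t T)"
proof -
  let ?K = "components G I" and ?J = "insert r I" and ?W = "P \<union> Q"
  let ?x = "basis_labels :: 'v set set \<Rightarrow> 'v set \<Rightarrow> int a2"
  have K: "finite ?K" using graph by (rule finite_components)
  have "pure_tensor (components G ?J) (merge_labels ?K (?x S)) =
      pure_tensor (insert ?W (?K - {P, Q})) ((?x S)(?W := ?x S P * ?x S Q))" for S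
  proof -
    have "pure_tensor (components G ?J) (merge_labels ?K (?x S)) = edge_map G I ?J (pure_tensor ?K (?x S))"
      unfolding edge_map_def
      by (rule tensor_merge_pure[symmetric]) (rule components_refines[OF graph], blast)
    also have "\<dots> = pure_tensor (insert ?W (?K - {P, Q})) ((?x S)(?W := ?x S P * ?x S Q))"
      using edge_map_merge[OF graph cube e PQ] by simp
    finally show ?thesis .
  qed
  then have "edge_map G I ?J t T =
      (\<Sum>S\<in>Pow ?K. t S * pure_tensor (insert ?W (?K - {P, Q})) ((?x S)(?W := ?x S P * ?x S Q)) T)"
    by (simp only: edge_map_def tensor_merge_def)
  also have "\<dots> = (\<Sum>S\<in>Pow ?K. t S * of_bool ((if ?W \<in> T then (P \<in> S) \<noteq> (Q \<in> S) else P \<notin> S \<and> Q \<notin> S) \<and>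
      S - {P, Q} = T - {?W}))"
    by (rule sum.cong[OF refl]) (simp only: Pow_iff pure_tensor_merge[OF K W _ T])
  also have "\<dots> = (if ?W \<in> T then t (insert P (T - {?W})) + t (insert Q (T - {?W})) else t T)"
    by (rule sum_merge_coeffs[OF K W PQ(1,2,5) T])
  finally show ?thesis .
qed

text \<open>Edges are unordered sets, while the operators above name the two ends; \<open>a\<close>
  and \<open>b\<close> are an arbitrary choice of names.\<close>

locale multigraph_ends = ugraph a b "verts G" "{..<length (edges G)}" for a b and G :: "'v multigraph" +
  assumes graph: "finite_multigraph G"
    and ends: "r < length (edges G) \<Longrightarrow> edges G ! r = {a r, b r}"
begin

abbreviation "E \<equiv> {..<length (edges G)}"

lemma adjacent_eq:
  assumes "I \<subseteq> E"
  shows "adjacent G I = (\<Union>r\<in>I. {(a r, b r), (b r, a r)})"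
proof -
  have "adjacent G I = {(u, v). \<exists>r\<in>I. {a r, b r} = {u, v}}"
    unfolding adjacent_def using assms by (auto simp: ends subset_iff)
  then show ?thesis by (auto simp: doubleton_eq_iff)
qed

lemma connected_rel_Image: "I \<subseteq> E \<Longrightarrow> v \<in> verts G \<Longrightarrow> connected_rel G I `` {v} = comp_of I v"
  using comp_subset_V[of I v] by (auto simp: connected_rel_def adjacent_eq comp_of_def)

lemma components_eq: "I \<subseteq> E \<Longrightarrow> components G I = comp_of I ` verts G"
  by (auto simp: components_def quotient_def connected_rel_Image)

lemma Union_comp: "sat I U \<Longrightarrow> \<Union> (comp_of I ` U) = U"
  by (auto dest: comp_least)

lemma comp_image_Union:
  assumes "S \<subseteq> comp_of I ` verts G"
  shows "comp_of I ` \<Union> S = S" and "sat I (\<Union> S)"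
proof -
  have S: "\<exists>v. P = comp_of I v" if "P \<in> S" for P
    using assms that by auto
  have eq: "comp_of I ` P = {P}" if "P \<in> S" for P using S[OF that] by (elim exE) simp
  have "comp_of I ` \<Union> S = (\<Union>P\<in>S. comp_of I ` P)" by (rule image_Union)
  also have "\<dots> = (\<Union>P\<in>S. {P})" by (rule SUP_cong) (simp_all add: eq)
  finally show "comp_of I ` \<Union> S = S" by simp
  have "sat I P" if "P \<in> S" for P using S[OF that] by auto
  then show "sat I (\<Union> S)" by (auto simp: sat_def)
qed

lemma edge_map_pull:
  fixes t :: "'v set set \<Rightarrow> int"
  assumes v: "(insert r I, U) \<in> valid {}" and t: "t \<in> a2_tensor (components G I)"
  shows "edge_map G I (insert r I) t (comp_of (insert r I) ` U) = pull r I (\<lambda>X. t (comp_of I ` X)) U"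
proof -
  let ?J = "insert r I" and ?K = "components G I" and ?P = "comp_of I (a r)" and ?Q = "comp_of I (b r)"
  note vD = validD[OF v]
  have I: "I \<subseteq> E" and cube: "?J \<in> cube G" using vD(1) by (auto simp: cube_def)
  have ab: "a r \<in> verts G" "b r \<in> verts G" using vD(1) ends_in by auto
  have K: "?K = comp_of I ` verts G" using I by (rule components_eq)
  have sI: "sat I U" and abU: "a r \<in> U \<longleftrightarrow> b r \<in> U" using vD(4) by auto
  show ?thesis
  proof (cases "b r \<in> ?P")
    case True
    then have "components G ?J = ?K"
      unfolding components_eq[OF vD(1)] K by (simp add: comp_insert_same)
    then show ?thesis using edge_map_id[OF graph _ t] True by (simp add: pull_def comp_insert_same)
  next
    case PQ: False
    let ?W = "?P \<union> ?Q" and ?T = "comp_of ?J ` U"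
    have PQne: "?P \<noteq> ?Q" using PQ by (auto simp: mem_comp)
    have inK: "?P \<in> ?K" "?Q \<in> ?K" using ab by (auto simp: K)
    have WK: "?W \<notin> ?K"
    proof
      assume "?W \<in> ?K"
      then obtain v where v: "?W = comp_of I v" unfolding K by auto
      have "a r \<in> comp_of I v" "b r \<in> comp_of I v" unfolding v[symmetric] by simp_all
      then show False using PQne by (simp add: mem_comp)
    qed
    have e: "edges G ! r = {a r, b r}" using vD(1) by (intro ends) auto
    have JK: "components G ?J = insert ?W (?K - {?P, ?Q})"
      using components_insert[OF graph cube e inK comp_self comp_self] by simp
    have "?T \<subseteq> components G ?J" unfolding components_eq[OF vD(1)] using vD(2) by (rule image_mono)
    then have TK: "?T \<subseteq> insert ?W (?K - {?P, ?Q})" unfolding JK .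
    have edge: "edge_map G I ?J t ?T = (if ?W \<in> ?T then t (insert ?P (?T - {?W})) + t (insert ?Q (?T - {?W})) else t ?T)"
      by (rule edge_map_coeff[OF graph cube e inK comp_self comp_self PQne WK t TK])
    have cJ: "comp_of ?J x = (if x \<in> ?W then ?W else comp_of I x)" for x by (rule comp_insert)
    show ?thesis
    proof (cases "a r \<in> U")
      case False
      then have out: "x \<notin> ?W" if "x \<in> U" for x
        using that sat_disjoint[OF sI, of "a r"] sat_disjoint[OF sI, of "b r"] abU by blast
      have T: "?T = comp_of I ` U" using out by (intro image_cong refl) (simp add: cJ)
      have "?W \<notin> ?T"
      proof
        assume "?W \<in> ?T"
        then obtain x where "x \<in> U" "?W = comp_of I x" unfolding T by auto
        then show False using out[of x] comp_self[of x I] by simp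
      qed
      then show ?thesis unfolding edge using False by (simp add: pull_def T)
    next
      case True
      then have bU: "b r \<in> U" using abU by simp
      have sub: "?P \<subseteq> U" "?Q \<subseteq> U" by (rule comp_least[OF sI]; use True bU in simp)+
      have dis: "?P \<inter> ?Q = {}" using comp_disjoint[OF PQ] by (simp add: Int_commute)
      define B where "B = comp_of I ` (U - ?W)"
      have U: "U = ?W \<union> (U - ?W)" "U - ?P = ?Q \<union> (U - ?W)" "U - ?Q = ?P \<union> (U - ?W)"
        using sub dis by blast+
      have "comp_of ?J ` ?W = (\<lambda>_. ?W) ` ?W" by (rule image_cong) (simp_all add: cJ)
      then have imgJ: "comp_of ?J ` ?W = {?W}" using image_constant[of "a r" ?W] by simp
      have "comp_of ?J ` (U - ?W) = B" unfolding B_def by (rule image_cong) (simp_all add: cJ)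
      then have T: "?T = insert ?W B" using imgJ U(1) image_Un[of "comp_of ?J" ?W "U - ?W"] by simp
      have TP: "comp_of I ` (U - ?P) = insert ?Q B" "comp_of I ` (U - ?Q) = insert ?P B"
        using image_Un[of "comp_of I" ?Q "U - ?W"] image_Un[of "comp_of I" ?P "U - ?W"]
        unfolding U(2,3) comp_image_comp B_def by simp_all
      have "B \<subseteq> ?K" unfolding B_def K using vD(2) by blast
      then have "?T - {?W} = B" using WK unfolding T by blast
      moreover have "?W \<in> ?T" unfolding T by simp
      ultimately show ?thesis unfolding edge using True PQ by (simp add: pull_def TP)
    qed
  qed
qed

definition of_chain :: "('v, int) chain \<Rightarrow> nat set \<times> 'v set \<Rightarrow> int" where
  "of_chain c = (\<lambda>(I, U). if (I, U) \<in> valid {} then c I (comp_of I ` U) else 0)"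

lemma chain_tensor: "c \<in> chains G i j \<Longrightarrow> c I \<in> a2_tensor (components G I)"
  by (auto simp: chains_def a2_tensor_def)

lemma of_chain_differential:
  assumes c: "c \<in> chains G i j" and v: "(J, U) \<in> valid {}"
  shows "app (dd {} E) (of_chain c) (J, U) = differential G c J (comp_of J ` U)"
proof -
  have J: "J \<in> cube G" "J \<inter> E = J" using validD(1)[OF v] by (auto simp: cube_def)
  have "pull r (J - {r}) (\<lambda>X. of_chain c (J - {r}, X)) U =
      edge_map G (J - {r}) J (c (J - {r})) (comp_of J ` U)" if r: "r \<in> J" for r
  proof -
    have rJ: "insert r (J - {r}) = J" using r by auto
    have "pull r (J - {r}) (\<lambda>X. of_chain c (J - {r}, X)) U =
        pull r (J - {r}) (\<lambda>X. c (J - {r}) (comp_of (J - {r}) ` X)) U"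
      by (rule pull_cong) (use v rJ in \<open>auto simp: of_chain_def\<close>)
    also have "\<dots> = edge_map G (J - {r}) J (c (J - {r})) (comp_of J ` U)"
      using edge_map_pull[of r "J - {r}" U "c (J - {r})"] v chain_tensor[OF c] unfolding rJ by simp
    finally show ?thesis .
  qed
  moreover have "{l \<in> J - {r}. l < r} = {l \<in> J. l < r}" for r by auto
  ultimately show ?thesis using v J by (simp add: app_dd differential_def sg_def)
qed

text \<open>\<open>of_chain\<close> turns the relations between chains into relations between
  functions, where \<open>two_torsion\<close> applies; the bounding function is then brought back to
  a chain.\<close>

lemma twice_cycle_boundary:
  assumes c: "c \<in> cycles G i j" and n: "n > 0" and nc: "(\<lambda>I S. int n * c I S) \<in> boundaries G i j"
  shows "(\<lambda>I S. 2 * c I S) \<in> boundaries G i j"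
proof -
  have cc: "c \<in> chains G i j" and dc: "differential G c = (\<lambda>_ _. 0)" using c by (auto simp: cycles_def)
  obtain b where b: "b \<in> chains G (i - 1) j" "(\<lambda>I S. int n * c I S) = differential G b"
    using nc by (auto simp: boundaries_def)
  have "app (dd {} E) (of_chain c) (J, U) = 0" for J U
  proof (cases "(J, U) \<in> valid {}")
    case True
    then show ?thesis using of_chain_differential[OF cc True] dc by simp
  qed (simp add: app_dd)
  then have 1: "app (dd {} E) (of_chain c) = (\<lambda>_. 0)" by (auto simp: fun_eq_iff)
  have "int n * of_chain c (J, U) = app (dd {} E) (of_chain b) (J, U)" for J U
  proof (cases "(J, U) \<in> valid {}")
    case True
    then show ?thesis using of_chain_differential[OF b(1) True] fun_cong[OF fun_cong[OF b(2)]]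
      by (simp add: of_chain_def)
  qed (simp add: of_chain_def app_dd)
  then have 2: "(\<lambda>s. int n * of_chain c s) = app (dd {} E) (of_chain b)" by (auto simp: fun_eq_iff)
  have "two_torsion (dd {} E)" by (rule ugraph_two_torsion) unfold_locales
  with 1 2 n obtain z where z: "(\<lambda>s. 2 * of_chain c s) = app (dd {} E) z"
    unfolding two_torsion_def by (metis of_nat_0_less_iff)
  \<comment> \<open>\<open>z\<close> need not be homogeneous, so it is cut down to bidegree (i - 1,
    j). In bidegree (i, j) nothing changes, because \<open>dd\<close> reads only from there.\<close>
  define y :: "('v, int) chain" where "y = (\<lambda>I S. if I \<in> cube G \<and> int (card I) = i - 1 \<and>
    S \<subseteq> components G I \<and> int (card S) = j then z (I, \<Union> S) else 0)"
  have y: "y \<in> chains G (i - 1) j" by (auto simp: chains_def y_def)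
  have dy: "differential G y \<in> chains G i j" using differential_chains[OF graph y] by simp
  have "2 * c J T = differential G y J T" for J T
  proof (cases "J \<in> cube G \<and> int (card J) = i \<and> T \<subseteq> components G J \<and> int (card T) = j")
    case False
    then have "c J T = 0" "differential G y J T = 0" using cc dy unfolding chains_def by blast+
    then show ?thesis by simp
  next
    case True
    define U where "U = \<Union> T"
    have J: "J \<subseteq> E" using True by (auto simp: cube_def)
    have T: "T \<subseteq> comp_of J ` verts G" using True components_eq[OF J] by simp
    have U: "comp_of J ` U = T" "sat J U" unfolding U_def using comp_image_Union[OF T] by auto
    have v: "(J, U) \<in> valid {}"
      using J U(2) T comp_subset_V[OF J] unfolding U_def by (intro validI) auto
    have "differential G y J T = app (dd {} E) (of_chain y) (J, U)"
      unfolding of_chain_differential[OF y v] U(1) ..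
    also have "\<dots> = app (dd {} E) z (J, U)"
    proof (rule readsD[OF reads_dd])
      fix s assume s: "((J, U), s) \<in> grade {} (- 1) 0"
      obtain I X where s': "s = (I, X)" by (cases s)
      have vI: "(I, X) \<in> valid {}" and card: "int (card I) = i - 1" "int (card (comp_of I ` X)) = j"
        using s True U(1) by (auto simp: grade_def s' deg_def)
      have I: "I \<subseteq> E" using validD(1)[OF vI] .
      have "comp_of I ` X \<subseteq> components G I" using validD(2)[OF vI] components_eq[OF I] by auto
      then show "of_chain y s = z s"
        using vI card I Union_comp[OF validD(4)[OF vI]] by (simp add: of_chain_def y_def s' cube_def)
    qed
    also have "\<dots> = 2 * c J T" using fun_cong[OF z, of "(J, U)"] v U(1) by (simp add: of_chain_def)
    finally show ?thesis by simp
  qed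
  then have "(\<lambda>I S. 2 * c I S) = differential G y" by (simp add: fun_eq_iff)
  with y show ?thesis by (auto simp: boundaries_def)
qed

end

lemma multigraph_ends_exist:
  assumes "finite_multigraph G"
  obtains a b where "multigraph_ends a b G"
proof -
  have "\<exists>u v. u \<in> verts G \<and> v \<in> verts G \<and> edges G ! r = {u, v}" if "r < length (edges G)" for r
    using assms nth_mem[OF that] unfolding finite_multigraph_def by blast
  then obtain a b where "\<And>r. r < length (edges G) \<Longrightarrow> a r \<in> verts G \<and> b r \<in> verts G \<and> edges G ! r = {a r, b r}"
    by metis
  then have "multigraph_ends a b G"
    using assms by unfold_locales (auto simp: finite_multigraph_def)
  then show thesis by (rule that)
qed

lemma cycle_group_pow:
  "c [^]\<^bsub>cycle_group G i j\<^esub> n = (\<lambda>I S. of_nat n * c I S :: 'r::comm_ring_1)"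
proof (induction n)
  case 0
  show ?case by (simp add: nat_pow_def cycle_group_def)
next
  case (Suc n)
  have "c [^]\<^bsub>cycle_group G i j\<^esub> Suc n = (c [^]\<^bsub>cycle_group G i j\<^esub> n) \<otimes>\<^bsub>cycle_group G i j\<^esub> c"
    by (simp add: nat_pow_def)
  also have "\<dots> = (\<lambda>I S. of_nat (Suc n) * c I S)"
    unfolding Suc by (simp add: cycle_group_def algebra_simps)
  finally show ?case .
qed

theorem theorem1p3:
  fixes G :: "'v multigraph"
    and i j :: int
    and a :: "('v, int) chain set"
  assumes "finite_multigraph G"
    and "torsion_element (chromatic_homology G i j) a"
  shows "a [^]\<^bsub>chromatic_homology G i j\<^esub> (2::nat) = \<one>\<^bsub>chromatic_homology G i j\<^esub>"
proof -
  obtain ea eb where "multigraph_ends ea eb G" using multigraph_ends_exist[OF assms(1)] .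
  then interpret multigraph_ends ea eb G .
  let ?Z = "cycle_group G i j :: ('v, int) chain monoid" and ?B = "boundaries G i j :: ('v, int) chain set"
  interpret normal ?B ?Z by (rule boundaries_normal[OF assms(1)])
  have "a \<in> (\<lambda>c. ?B #>\<^bsub>?Z\<^esub> c) ` carrier ?Z"
    using assms(2) by (simp add: torsion_element_def chromatic_homology_def carrier_FactGroup)
  then obtain c where c: "c \<in> carrier ?Z" "a = ?B #>\<^bsub>?Z\<^esub> c" by (rule imageE) auto
  obtain n :: nat where n: "n > 0" and an: "a [^]\<^bsub>?Z Mod ?B\<^esub> n = \<one>\<^bsub>?Z Mod ?B\<^esub>"
    using assms(2) unfolding torsion_element_def chromatic_homology_def by (elim conjE exE)
  have pow: "a [^]\<^bsub>?Z Mod ?B\<^esub> k = ?B #>\<^bsub>?Z\<^esub> (c [^]\<^bsub>?Z\<^esub> k)" for k :: nat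
    unfolding c(2) by (rule FactGroup_pow[OF c(1)])
  have carrier: "c [^]\<^bsub>?Z\<^esub> k \<in> carrier ?Z" for k :: nat using c(1) by (rule nat_pow_closed)
  \<comment> \<open>A power of a coset is the coset of a multiple of its representative, and it is
    trivial exactly if this multiple is a boundary.\<close>
  have "?B #>\<^bsub>?Z\<^esub> (c [^]\<^bsub>?Z\<^esub> n) = ?B" using trans[OF pow[symmetric] an] by (simp only: one_FactGroup)
  then have "c [^]\<^bsub>?Z\<^esub> n \<in> ?B" by (rule coset_join1[OF _ carrier is_subgroup])
  then have "(\<lambda>I S. int n * c I S) \<in> ?B" by (simp only: cycle_group_pow)
  then have "(\<lambda>I S. 2 * c I S) \<in> ?B"
    using c(1) n by (intro twice_cycle_boundary) (auto simp: cycle_group_def)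
  then have "c [^]\<^bsub>?Z\<^esub> (2::nat) \<in> ?B" by (simp only: cycle_group_pow of_nat_numeral)
  then have "?B #>\<^bsub>?Z\<^esub> (c [^]\<^bsub>?Z\<^esub> (2::nat)) = ?B" by (rule coset_join2[OF carrier is_subgroup])
  then have "a [^]\<^bsub>?Z Mod ?B\<^esub> (2::nat) = \<one>\<^bsub>?Z Mod ?B\<^esub>" unfolding pow one_FactGroup .
  then show ?thesis unfolding chromatic_homology_def .
qed

end
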